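(* (i) Let $f'\in C_c^\infty(S)$ transfer to $(f_0,f_1)\in C_c^\infty(G_0)\times C_c^\infty(G_1)$, and let $\gamma_0=\operatorname{diag}(a_0,d_0)$ with $a_0,d_0\in F^1$. If $f_i=0$ for some $i\in\{0,1\}$, then there exist a neighborhood $U$ of $\gamma_0$ in $S(F_0)$ and a constant $C$ (depending on $\gamma_0$, $f'$, $i$) such that for every $\gamma\in U\cap S_{{\rm rs},i}$ with upper-left entry $a$, $$\omega_S(\gamma)\,\partial\mathrm{Orb}(\gamma,f')=\tfrac12\mathrm{Orb}(\operatorname{diag}(a_0,d_0),f_{1-i})\log|1-\mathrm N a|+C.$$ (ii) Let $\phi'\in C_c^\infty(\mathfrak s)$ transfer to $(\phi_0,\phi_1)\in C_c^\infty(\mathfrak g_0)\times C_c^\infty(\mathfrak g_1)$, and let $y_0=\operatorname{diag}(a_0,d_0)$ with $a_0,d_0\in\pi F_0$. If $\phi_i=0$ for some $i$, then there exist a neighborhood $U$ of $y_0$ in $\mathfrak s(F_0)$ and a constant $C$ such that for every $y=\begin{bmatrix}a&b\\ c&d\end{bmatrix}\in U\cap\mathfrak s_{{\rm rs},i}$, $$\omega_{\mathfrak s}(y)\,\partial\mathrm{Orb}(y,\phi')=\tfrac12\mathrm{Orb}(\operatorname{diag}(a_0,d_0),\phi_{1-i})\log|bc|+C.$$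
   Context: Let $F_0$ be a finite extension of $\mathbb Q_p$, $p$ odd, $F/F_0$ ramified quadratic with uniformizer $\pi$, $\pi^2=\varpi\in F_0$, conjugation $a\mapsto\bar a$, norm $\mathrm N$, $F^1$ the norm-one elements, $\eta$ the quadratic character of $F_0^\times$, $\tilde\eta$ a fixed extension of $\eta$ to a character of $F^\times$, $|\cdot|$ the normalized absolute value on $F_0$. Let $e=(0,1)^t$, $S(F_0)=\{\gamma\in GL_2(F):\gamma\bar\gamma=1\}$, $\mathfrak s(F_0)=\{y\in M_2(F):y+\bar y=0\}$ (whose entries lie in $\pi F_0$), with $F_0^\times$ acting by conjugation by $\operatorname{diag}(h,1)$. An element of $M_2(F)$ is regular semisimple (rs) iff both off-diagonal entries are nonzero. $\mathrm{Orb}(\gamma,f',s)=\int_{F_0^\times}f'(h^{-1}\gamma h)\eta(h)|h|^sdh$ ($\mathrm{vol}(O_{F_0}^\times)=1$), $\mathrm{Orb}$ its value and $\partial\mathrm{Orb}$ its derivative at $s=0$; same on $\mathfrak s$. $\omega_S(\gamma)=\tilde\eta(\det(\gamma)^{-1}\det[e\ \gamma e])$, $\omega_{\mathfrak s}(y)=\tilde\eta(\det[e\ ye])$. Unitary side: $W_0$ (split) and $W_1$ (non-split) are the $2$-dimensional $F/F_0$-hermitian spaces, $u_i\in W_i$ with $(u_i,u_i)=-1$, $W_i^\flat=u_i^\perp$ with a basis vector $w_i$; $G_i=U(W_i)$, $\mathfrak g_i=\operatorname{Lie}G_i$, $H_i=U(W_i^\flat)\cong F^1$ acting by conjugation, realized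 as matrices in $GL_2(F)$, $M_2(F)$, $\operatorname{diag}(F^1,1)$ via the basis $(w_i,u_i)$ (so diagonal matrices $\operatorname{diag}(a_0,d_0)$ with $a_0,d_0\in F^1$ lie in $G_i(F_0)$, and with $a_0,d_0\in\pi F_0$ lie in $\mathfrak g_i(F_0)$). $\mathrm{Orb}(g,f)=\int_{H_i(F_0)}f(h^{-1}gh)dh$ with total volume 1, defined for all $g$. Rs elements $\gamma\in S(F_0)$ and $g\in G_i(F_0)$ match if conjugate by $\operatorname{diag}(F^\times,1)$ (same for Lie algebras); $S_{{\rm rs},i}$ (resp. $\mathfrak s_{{\rm rs},i}$) is the set of rs elements matching some element of $G_i(F_0)$ (resp. $\mathfrak g_i(F_0)$). $f'$ transfers to $(f_0,f_1)$ if $\mathrm{Orb}(g,f_i)=\omega_S(\gamma)\mathrm{Orb}(\gamma,f')$ whenever rs $\gamma$ matches $g\in G_i(F_0)$; similarly on Lie algebras with $\omega_{\mathfrak s}$. *)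

theory Defs
  imports "HOL-Analysis.Analysis" "HOL-Computational_Algebra.Computational_Algebra"
begin

text \<open>
  The field \<open>F\<close> is a type carrying the metric of an absolute value, the fields \<open>\<rat>\<^sub>p\<close> and
  \<open>F\<^sub>0\<close> are subsets of it.  Hence \<^typ>\<open>'a^2^2\<close> carries the \<open>p\<close>-adic topology of \<open>M\<^sub>2(F)\<close>,
  and every group below has the subspace topology.
\<close>

subsection \<open>Local fields\<close>

definition av :: "'a::{field_char_0,metric_space} \<Rightarrow> real" where
  "av x = dist x 0"

definition padic_metric :: "nat \<Rightarrow> 'a::{field_char_0,metric_space} set \<Rightarrow> bool" where
  "padic_metric p E \<longleftrightarrow>
     (\<forall>x\<in>E. \<forall>y\<in>E. dist x y = av (x - y)) \<and>
     (\<forall>x\<in>E. \<forall>y\<in>E. av (x * y) = av x * av y) \<and>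
     (\<forall>x\<in>E. \<forall>y\<in>E. av (x + y) \<le> max (av x) (av y)) \<and>
     (\<forall>m::int. m \<noteq> 0 \<longrightarrow> av (of_int m :: 'a) = (1 / real p) ^ multiplicity (int p) m)"

definition is_subfield :: "'a::field set \<Rightarrow> bool" where
  "is_subfield E \<longleftrightarrow> 0 \<in> E \<and> 1 \<in> E \<and>
     (\<forall>x\<in>E. \<forall>y\<in>E. x - y \<in> E \<and> x * y \<in> E) \<and> (\<forall>x\<in>E. inverse x \<in> E)"

text \<open>The closure of \<open>\<rat>\<close>, if complete, is the completion \<open>\<rat>\<^sub>p\<close> of \<open>\<rat>\<close> for its \<open>p\<close>-adic metric.\<close>

definition finite_ext_Qp :: "nat \<Rightarrow> 'a::{field_char_0,metric_space} set \<Rightarrow> bool" where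
  "finite_ext_Qp p E \<longleftrightarrow>
     is_subfield E \<and> padic_metric p E \<and>
     complete (closure \<rat> :: 'a set) \<and> closure \<rat> \<subseteq> E \<and>
     (\<exists>B. finite B \<and> B \<subseteq> E \<and>
        (\<forall>x\<in>E. \<exists>c. (\<forall>b\<in>B. c b \<in> closure \<rat>) \<and> x = (\<Sum>b\<in>B. c b * b)))"

definition int_ring :: "'a::{field_char_0,metric_space} set \<Rightarrow> 'a set" where
  "int_ring E = {x \<in> E. av x \<le> 1}"

definition residue_card :: "'a::{field_char_0,metric_space} set \<Rightarrow> nat" where
  "residue_card E =
     card (int_ring E // {(x, y). x \<in> int_ring E \<and> y \<in> int_ring E \<and> av (x - y) < 1})"

definition is_uniformizer :: "'a::{field_char_0,metric_space} set \<Rightarrow> 'a \<Rightarrow> bool" where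
  "is_uniformizer E t \<longleftrightarrow>
     t \<in> E \<and> t \<noteq> 0 \<and> av t < 1 \<and> (\<forall>x\<in>E. av x < 1 \<longrightarrow> av x \<le> av t)"

definition valuation :: "'a::{field_char_0,metric_space} set \<Rightarrow> 'a \<Rightarrow> int" where
  "valuation E x = (THE k. \<exists>t. is_uniformizer E t \<and> av x = av t powi k)"

text \<open>The metric gives \<open>p\<close> absolute value \<open>1/p\<close>; the normalized absolute value of \<open>E\<close> differs from
  it by a power.\<close>

definition nabs :: "'a::{field_char_0,metric_space} set \<Rightarrow> 'a \<Rightarrow> real" where
  "nabs E x = (if x = 0 then 0 else real (residue_card E) powi (- valuation E x))"

text \<open>Here \<open>cj\<close> is the nontrivial \<open>E\<close>-automorphism of the whole type.  Ramified means that the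
  value group of \<open>F\<close> is strictly larger than that of \<open>E\<close>.\<close>

definition ramified_quadratic ::
  "'a::{field_char_0,metric_space} set \<Rightarrow> ('a \<Rightarrow> 'a) \<Rightarrow> bool" where
  "ramified_quadratic E cj \<longleftrightarrow>
     (\<exists>t. t \<notin> E \<and> (\<forall>x. \<exists>u\<in>E. \<exists>v\<in>E. x = u + v * t)) \<and>
     av ` (UNIV - {0} :: 'a set) \<noteq> av ` (E - {0}) \<and>
     (\<forall>x y. cj (x + y) = cj x + cj y) \<and> (\<forall>x y. cj (x * y) = cj x * cj y) \<and>
     (\<forall>x\<in>E. cj x = x) \<and> (\<exists>x. cj x \<noteq> x)"

definition nm :: "('a::field \<Rightarrow> 'a) \<Rightarrow> 'a \<Rightarrow> 'a" where
  "nm cj x = x * cj x"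

definition norm_one :: "('a::field \<Rightarrow> 'a) \<Rightarrow> 'a set" where
  "norm_one cj = {x. nm cj x = 1}"

text \<open>The character of \<open>F\<^sub>0\<^sup>\<times>\<close> attached to \<open>F/F\<^sub>0\<close>: trivial exactly on norms from \<open>F\<^sup>\<times>\<close>.
  Only its values on \<open>F\<^sub>0\<^sup>\<times>\<close> matter.\<close>

definition quad_char :: "('a::field \<Rightarrow> 'a) \<Rightarrow> 'a \<Rightarrow> complex" where
  "quad_char cj x = (if x \<in> nm cj ` (UNIV - {0}) then 1 else - 1)"

definition extends_quad_char ::
  "'a::{field_char_0,metric_space} set \<Rightarrow> ('a \<Rightarrow> 'a) \<Rightarrow> ('a \<Rightarrow> complex) \<Rightarrow> bool" where
  "extends_quad_char E cj \<psi> \<longleftrightarrow>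
     (\<forall>x y. x \<noteq> 0 \<longrightarrow> y \<noteq> 0 \<longrightarrow> \<psi> (x * y) = \<psi> x * \<psi> y) \<and>
     continuous_on (UNIV - {0}) \<psi> \<and>
     (\<forall>x\<in>E - {0}. \<psi> x = quad_char cj x)"

text \<open>Haar measures on a multiplicative subgroup \<open>X\<close> of \<open>F\<^sup>\<times>\<close>; the normalization is
  prescribed separately.\<close>

definition haar_on :: "'a::{field_char_0,metric_space} set \<Rightarrow> 'a measure \<Rightarrow> bool" where
  "haar_on X M \<longleftrightarrow>
     sets M = sets (restrict_space borel X) \<and>
     (\<forall>h\<in>X. \<forall>A\<in>sets M. emeasure M ((\<lambda>x. h * x) ` A) = emeasure M A) \<and>
     (\<forall>K. compact K \<and> K \<subseteq> X \<longrightarrow> emeasure M K < \<infinity>)"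

subsection \<open>Matrices and test functions\<close>

definition mat2 :: "'a::zero \<Rightarrow> 'a \<Rightarrow> 'a \<Rightarrow> 'a \<Rightarrow> 'a^2^2" where
  "mat2 a b c d = vector [vector [a, b], vector [c, d]]"

definition diag2 :: "'a::zero \<Rightarrow> 'a \<Rightarrow> 'a^2^2" where
  "diag2 a d = mat2 a 0 0 d"

definition cj_mat :: "('a \<Rightarrow> 'a) \<Rightarrow> 'a^2^2 \<Rightarrow> 'a^2^2" where
  "cj_mat cj g = (\<chi> i j. cj (g $ i $ j))"

text \<open>\<open>dconj h g\<close> is \<open>h\<^sup>-\<^sup>1gh\<close> with \<open>h\<close> read as \<open>diag(h, 1)\<close>.\<close>

definition dconj :: "'a::field \<Rightarrow> 'a^2^2 \<Rightarrow> 'a^2^2" where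
  "dconj h g = diag2 (inverse h) 1 ** g ** diag2 h 1"

definition rs :: "'a::zero^2^2 \<Rightarrow> bool" where
  "rs g \<longleftrightarrow> g $ 1 $ 2 \<noteq> 0 \<and> g $ 2 $ 1 \<noteq> 0"

text \<open>Functions on a subspace \<open>X\<close> are total functions whose values off \<open>X\<close> are irrelevant; smooth
  means locally constant.\<close>

definition Cc_smooth :: "'b::topological_space set \<Rightarrow> ('b \<Rightarrow> complex) \<Rightarrow> bool" where
  "Cc_smooth X f \<longleftrightarrow>
     (\<forall>x\<in>X. \<exists>U. open U \<and> x \<in> U \<and> (\<forall>y\<in>U \<inter> X. f y = f x)) \<and>
     (\<exists>K. compact K \<and> K \<subseteq> X \<and> (\<forall>x\<in>X - K. f x = 0))"

subsection \<open>The symmetric space and its Lie algebra\<close>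

definition S_space :: "('a::field \<Rightarrow> 'a) \<Rightarrow> ('a^2^2) set" where
  "S_space cj = {g. g ** cj_mat cj g = mat 1}"

definition s_lie :: "('a::field \<Rightarrow> 'a) \<Rightarrow> ('a^2^2) set" where
  "s_lie cj = {y. y + cj_mat cj y = 0}"

text \<open>\<open>col_det g = det [e ge]\<close>, the matrix with columns \<open>e = (0,1)\<^sup>t\<close> and \<open>ge\<close>.\<close>

definition col_det :: "'a::field^2^2 \<Rightarrow> 'a" where
  "col_det g = (let e = vector [0, 1] in det (transpose (vector [e, g *v e])))"

definition omega_S :: "('a::field \<Rightarrow> complex) \<Rightarrow> 'a^2^2 \<Rightarrow> complex" where
  "omega_S \<psi> g = \<psi> (inverse (det g) * col_det g)"

definition omega_s :: "('a::field \<Rightarrow> complex) \<Rightarrow> 'a^2^2 \<Rightarrow> complex" where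
  "omega_s \<psi> y = \<psi> (col_det y)"

definition Orb_s ::
  "'a::{field_char_0,metric_space} set \<Rightarrow> ('a \<Rightarrow> 'a) \<Rightarrow> 'a measure \<Rightarrow>
   'a^2^2 \<Rightarrow> ('a^2^2 \<Rightarrow> complex) \<Rightarrow> complex \<Rightarrow> complex" where
  "Orb_s E cj \<mu> g f s =
     (\<integral>h. f (dconj h g) * quad_char cj h * (complex_of_real (nabs E h) powr s) \<partial>\<mu>)"

definition dOrb ::
  "'a::{field_char_0,metric_space} set \<Rightarrow> ('a \<Rightarrow> 'a) \<Rightarrow> 'a measure \<Rightarrow>
   'a^2^2 \<Rightarrow> ('a^2^2 \<Rightarrow> complex) \<Rightarrow> complex" where
  "dOrb E cj \<mu> g f = deriv (Orb_s E cj \<mu> g f) 0"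

subsection \<open>The unitary side\<close>

text \<open>\<open>hf\<close> is a nondegenerate hermitian form on the two-dimensional space \<open>W = F\<^sup>2\<close>, linear in the
  first variable, \<open>u\<close> has \<open>(u,u) = -1\<close>, and \<open>w\<close> is a basis vector of \<open>u\<^sup>\<bottom>\<close>.\<close>

definition hermitian_form :: "('a::field \<Rightarrow> 'a) \<Rightarrow> ('a^2 \<Rightarrow> 'a^2 \<Rightarrow> 'a) \<Rightarrow> bool" where
  "hermitian_form cj hf \<longleftrightarrow>
     (\<forall>x y z. hf (x + y) z = hf x z + hf y z) \<and>
     (\<forall>c x y. hf (c *s x) y = c * hf x y) \<and>
     (\<forall>x y. hf y x = cj (hf x y)) \<and>
     (\<forall>x. (\<forall>y. hf x y = 0) \<longrightarrow> x = 0)"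

definition split_form :: "('a::field^2 \<Rightarrow> 'a^2 \<Rightarrow> 'a) \<Rightarrow> bool" where
  "split_form hf \<longleftrightarrow> (\<exists>x. x \<noteq> 0 \<and> hf x x = 0)"

definition adapted_basis :: "('a::field^2 \<Rightarrow> 'a^2 \<Rightarrow> 'a) \<Rightarrow> 'a^2 \<Rightarrow> 'a^2 \<Rightarrow> bool" where
  "adapted_basis hf w u \<longleftrightarrow>
     hf u u = - 1 \<and> w \<noteq> 0 \<and> {x. hf x u = 0} = range (\<lambda>c. c *s w)"

text \<open>Elements of \<open>U(W)\<close> and of its Lie algebra, as matrices in the basis \<open>(w, u)\<close>:
  \<open>coord w u\<close> is the isomorphism from coordinate vectors to \<open>W\<close>.\<close>

definition coord :: "'a::field^2 \<Rightarrow> 'a^2 \<Rightarrow> 'a^2 \<Rightarrow> 'a^2" where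
  "coord w u v = (v $ 1) *s w + (v $ 2) *s u"

definition U_group :: "('a::field^2 \<Rightarrow> 'a^2 \<Rightarrow> 'a) \<Rightarrow> 'a^2 \<Rightarrow> 'a^2 \<Rightarrow> ('a^2^2) set" where
  "U_group hf w u = {g. \<forall>x y.
     hf (coord w u (g *v x)) (coord w u (g *v y)) = hf (coord w u x) (coord w u y)}"

definition u_lie :: "('a::field^2 \<Rightarrow> 'a^2 \<Rightarrow> 'a) \<Rightarrow> 'a^2 \<Rightarrow> 'a^2 \<Rightarrow> ('a^2^2) set" where
  "u_lie hf w u = {g. \<forall>x y.
     hf (coord w u (g *v x)) (coord w u y) + hf (coord w u x) (coord w u (g *v y)) = 0}"

text \<open>\<open>\<nu>\<close> is the Haar measure on \<open>U(W\<^sup>\<flat>) = F\<^sup>1\<close>.\<close>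

definition Orb_u ::
  "'a::field measure \<Rightarrow> 'a^2^2 \<Rightarrow> ('a^2^2 \<Rightarrow> complex) \<Rightarrow> complex" where
  "Orb_u \<nu> g f = (\<integral>h. f (dconj h g) \<partial>\<nu>)"

subsection \<open>Matching and transfer\<close>

definition matches :: "'a::field^2^2 \<Rightarrow> 'a^2^2 \<Rightarrow> bool" where
  "matches \<gamma> g \<longleftrightarrow> rs \<gamma> \<and> rs g \<and> (\<exists>t. t \<noteq> 0 \<and> g = dconj t \<gamma>)"

text \<open>Used for \<open>(X, Y) = (S, G\<^sub>i)\<close> and \<open>(X, Y) = (\<ss>, \<gg>\<^sub>i)\<close>.\<close>

definition matched :: "('a::field^2^2) set \<Rightarrow> ('a^2^2) set \<Rightarrow> ('a^2^2) set" where
  "matched X Y = {\<gamma> \<in> X. rs \<gamma> \<and> (\<exists>g\<in>Y. matches \<gamma> g)}"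

definition transfers ::
  "'a::{field_char_0,metric_space} set \<Rightarrow> ('a \<Rightarrow> 'a) \<Rightarrow> 'a measure \<Rightarrow> 'a measure \<Rightarrow>
   ('a^2^2 \<Rightarrow> complex) \<Rightarrow> ('a^2^2) set \<Rightarrow> (nat \<Rightarrow> ('a^2^2) set) \<Rightarrow>
   ('a^2^2 \<Rightarrow> complex) \<Rightarrow> (nat \<Rightarrow> 'a^2^2 \<Rightarrow> complex) \<Rightarrow> bool" where
  "transfers E cj \<mu> \<nu> \<omega> X Y f' f \<longleftrightarrow>
     (\<forall>i\<in>{0, 1}. \<forall>\<gamma>\<in>X. \<forall>g\<in>Y i. matches \<gamma> g \<longrightarrow>
        Orb_u \<nu> g (f i) = \<omega> \<gamma> * Orb_s E cj \<mu> \<gamma> f' 0)"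

end

(*
  Put x = b/b0 and z = c/c0 for suitable fixed b0, c0, so that near diag(a0, d0) the test function
  depends only on (x, z) in F0 x F0, and let D = xz up to a factor close to 1; thus D = 1 - Na on S
  and D = bc on the Lie algebra.  Conjugation by h turns (x, z) into (x/h, zh), so for small D the
  integral over h splits into a part where zh is negligible, a part where x/h is negligible, and a
  middle range on which the function is constant; the last contributes 0 because the quadratic character is nontrivial on units.  Hence, up to the transfer
  factor, Orb(s) = eta(D) |D|^(-s) A(s) + B(s) with entire A and B depending only on the test function.
  The sign eta(D) = e_i is determined by which hermitian space the orbit matches, and e_0 = - e_1.
  If f_i = 0 then e_i A(0) + B(0) = 0, while on the other side the value is 2 B(0), which by continuity
  of the unitary orbital integrals equals Orb(diag(a0, d0), f_{1-i}).  Differentiating at s = 0 then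
  leaves B(0) log |D| plus a constant.
*)
theory Submission
  imports Defs
begin

no_notation fps_nth (infixl \<open>$\<close> 75)

subsection \<open>Ramified quadratic extensions\<close>

text \<open>The group and its Lie algebra share one argument, abstracted over the invariant
  \<open>\<Delta>\<close>, the transfer factor and the two lines \<open>b0 * E\<close> and
  \<open>c0 * E\<close> along which the test function is sampled. On the Lie algebra the
  off-diagonal entries lie exactly on such lines. On the symmetric space they do not: the equation
  \<open>a * cj b + b * cj d = 0\<close> makes the line of \<open>b\<close> turn with
  \<open>a\<close> and \<open>d\<close>. Hilbert 90 supplies its direction \<open>b0\<close> at
  \<open>diag2 a0 d0\<close>, and entries of nearby matrices lie on \<open>b0 * E\<close> up to a
  factor close to 1, which the germ expansion tolerates.

  The values A(0) and B(0) have to be extracted from the transfer identity, which speaks only of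
  matched regular semisimple pairs. Such pairs must therefore be exhibited near the diagonal element
  for each of the two hermitian spaces; on the group they come from a Cayley transform.

  Differentiation in \<open>s\<close> takes place on finite sums of terms
  \<open>v powr s * a v\<close>, because a function supported between two positive radii meets
  finitely many absolute values. That the character is nontrivial on units rests on the finiteness
  of the residue field, which is read off from the Haar measure.\<close>

locale ramified_extension =
  fixes p :: nat and E :: "'a::{field_char_0,metric_space} set"
    and cj :: "'a \<Rightarrow> 'a" and \<pi> :: 'a
  assumes p: "prime p" "odd p"
    and ext: "finite_ext_Qp p E"
    and abs: "padic_metric p (UNIV :: 'a set)"
    and ram: "ramified_quadratic E cj"
    and unif: "is_uniformizer UNIV \<pi>" "\<pi>\<^sup>2 \<in> E"
begin

section \<open>The ultrametric absolute value\<close>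

lemma av_nonneg [simp]: "av (x::'a) \<ge> 0"
  by (simp add: av_def)

lemma av_eq_0 [simp]: "av (x::'a) = 0 \<longleftrightarrow> x = 0"
  by (simp add: av_def)

lemma av_zero [simp]: "av (0::'a) = 0"
  by simp

lemma av_pos [simp]: "av (x::'a) > 0 \<longleftrightarrow> x \<noteq> 0"
  by (simp add: av_def)

lemma dist_av: "dist x y = av (x - y :: 'a)"
  using abs by (auto simp: padic_metric_def)

lemma av_mult [simp]: "av (x * y :: 'a) = av x * av y"
  using abs by (auto simp: padic_metric_def)

lemma av_add_le: "av (x + y :: 'a) \<le> max (av x) (av y)"
  using abs by (auto simp: padic_metric_def)

lemma av_one [simp]: "av (1::'a) = 1"
proof -
  have "av (1::'a) * av (1::'a) = av (1::'a)"
    by (metis av_mult mult_1)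
  then show ?thesis
    by simp
qed

lemma av_minus [simp]: "av (- x :: 'a) = av x"
proof -
  have "av (-1::'a) * av (-1::'a) = 1"
    by (metis av_mult av_one mult_minus1 minus_minus)
  then have "av (-1::'a) = 1"
    by (metis av_nonneg abs_of_nonneg abs_square_eq_1 power2_eq_square)
  then show ?thesis
    by (metis av_mult mult_1 mult_minus1)
qed

lemma av_diff_le: "av (x - y :: 'a) \<le> max (av x) (av y)"
  using av_add_le[of x "- y"] by simp

lemma av_diff_commute: "av (x - y :: 'a) = av (y - x)"
  using av_minus[of "x - y"] by simp

lemma av_inverse [simp]: "av (inverse x :: 'a) = inverse (av x)"
proof (cases "x = 0")
  case False
  have "av x * av (inverse x) = 1"
    using False by (metis av_mult av_one right_inverse)
  then show ?thesis
    by (simp add: inverse_unique)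
qed simp

lemma av_divide [simp]: "av (x / y :: 'a) = av x / av y"
  by (simp add: divide_inverse)

lemma av_power [simp]: "av (x ^ n :: 'a) = av x ^ n"
  by (induction n) auto

lemma av_power_int [simp]: "av (x powi k :: 'a) = av x powi k"
  by (simp add: power_int_def)

lemma av_add_eq: "av x < av y \<Longrightarrow> av (x + y :: 'a) = av y"
  using av_add_le[of x y] av_diff_le[of "x + y" x] by (auto simp: max_def split: if_splits)

lemma av_close: "av (x - y) < av y \<Longrightarrow> av x = av (y :: 'a)"
  using av_add_eq[of "x - y" y] by simp

lemma av_diff_less: "av (x - y) < r \<Longrightarrow> av (y - z) < r \<Longrightarrow> av (x - z :: 'a) < r"
  using av_add_le[of "x - y" "y - z"] by (auto simp: max_def split: if_splits)

text \<open>Oddness of \<open>p\<close> enters through this equality. It keeps 1 and -1 apart in the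
  residue field and lets the \<open>\<pi>\<close>-component of an element be recovered from
  \<open>x - cj x\<close> without change of size.\<close>

lemma av_two [simp]: "av (2::'a) = 1"
proof -
  have "\<not> int p dvd 2"
    using p by (metis dvd_refl even_of_nat int_dvd_int_iff of_nat_numeral primes_dvd_imp_eq two_is_prime_nat)
  then have "multiplicity (int p) 2 = 0"
    by (rule not_dvd_imp_multiplicity_0)
  moreover have "\<forall>m::int. m \<noteq> 0 \<longrightarrow> av (of_int m :: 'a) = (1 / real p) ^ multiplicity (int p) m"
    using abs by (auto simp: padic_metric_def)
  ultimately show ?thesis
    by (metis of_int_numeral power_0 zero_neq_numeral)
qed

section \<open>The base field and the conjugation\<close>

lemma subfield: "is_subfield E"
  using ext by (simp add: finite_ext_Qp_def)

lemma E_closed [simp]: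
  "0 \<in> E" "1 \<in> E" "x \<in> E \<Longrightarrow> y \<in> E \<Longrightarrow> x - y \<in> E" "x \<in> E \<Longrightarrow> y \<in> E \<Longrightarrow> x * y \<in> E"
  "x \<in> E \<Longrightarrow> inverse x \<in> E"
  using subfield by (auto simp: is_subfield_def)

lemma E_minus [simp]: "x \<in> E \<Longrightarrow> - x \<in> E"
  using E_closed(3)[of 0 x] by simp

lemma E_add [simp]: "x \<in> E \<Longrightarrow> y \<in> E \<Longrightarrow> x + y \<in> E"
  using E_closed(3)[of x "- y"] by simp

lemma E_divide [simp]: "x \<in> E \<Longrightarrow> y \<in> E \<Longrightarrow> x / y \<in> E"
  by (simp add: divide_inverse)

lemma E_power [simp]: "x \<in> E \<Longrightarrow> x ^ n \<in> E"
  by (induction n) auto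

lemma E_power_int [simp]: "x \<in> E \<Longrightarrow> x powi k \<in> E"
  by (simp add: power_int_def)

lemma cj_add [simp]: "cj (x + y) = cj x + cj y"
  using ram by (auto simp: ramified_quadratic_def)

lemma cj_mult [simp]: "cj (x * y) = cj x * cj y"
  using ram by (auto simp: ramified_quadratic_def)

lemma cj_E [simp]: "x \<in> E \<Longrightarrow> cj x = x"
  using ram by (auto simp: ramified_quadratic_def)

lemma cj_0 [simp]: "cj 0 = 0" and cj_1 [simp]: "cj 1 = 1"
  by auto

lemma cj_minus [simp]: "cj (- x) = - cj x"
  by (metis add.right_inverse add_eq_0_iff cj_0 cj_add)

lemma cj_diff [simp]: "cj (x - y) = cj x - cj y"
  using cj_add[of x "- y"] by (simp del: cj_add)

lemma cj_eq_0 [simp]: "cj x = 0 \<longleftrightarrow> x = 0"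
  by (metis cj_0 cj_1 cj_mult field_class.field_inverse mult_zero_right zero_neq_one)

lemma cj_inverse [simp]: "cj (inverse x) = inverse (cj x)"
proof (cases "x = 0")
  case False
  then have "cj x * cj (inverse x) = 1"
    by (metis cj_1 cj_mult right_inverse)
  then show ?thesis
    by (metis inverse_unique)
qed simp

lemma cj_divide [simp]: "cj (x / y) = cj x / cj y"
  by (simp add: divide_inverse)

lemma cj_power [simp]: "cj (x ^ n) = cj x ^ n"
  by (induction n) auto

section \<open>Value groups and the decomposition over the base field\<close>

lemma pi_nonzero [simp]: "\<pi> \<noteq> 0" and av_pi: "0 < av \<pi>" "av \<pi> < 1"
  using unif(1) by (auto simp: is_uniformizer_def)

text \<open>The floor of the logarithm gives \<open>k\<close> such that \<open>x / t powi k\<close>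
  has absolute value above \<open>av t\<close> and at most 1; maximality of \<open>av t\<close>
  below 1 leaves only the value 1.\<close>

lemma uniformizer_powers:
  assumes t: "is_uniformizer D t" and D: "\<And>x k. x \<in> D \<Longrightarrow> x * t powi k \<in> D"
    and x: "x \<in> D" "x \<noteq> (0::'a)"
  shows "\<exists>k::int. av x = av t powi k"
proof -
  have t0: "t \<noteq> 0" "av t < 1" and max: "\<And>y. y \<in> D \<Longrightarrow> av y < 1 \<Longrightarrow> av y \<le> av t"
    using t by (auto simp: is_uniformizer_def)
  have at: "0 < av t" using t0 by simp
  define k where "k = \<lfloor>log (av t) (av x)\<rfloor>"
  have k1: "real_of_int k \<le> log (av t) (av x)" and k2: "log (av t) (av x) < real_of_int k + 1"
    by (auto simp: k_def)
  have xp: "av x = av t powr log (av t) (av x)"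
    using t0 x by simp
  \<comment> \<open>The base is below 1, so inequalities between exponents reverse.\<close>
  have "av x \<le> av t powr real_of_int k"
    by (subst xp) (use k1 at t0 in \<open>simp add: powr_le_cancel_iff powr_mono'\<close>)
  then have up: "av x \<le> av t powi k"
    using at by (simp add: powr_real_of_int')
  have "av t powr (real_of_int k + 1) < av x"
    by (subst xp) (use k2 at t0 in \<open>simp add: powr_less_mono'\<close>)
  then have lo: "av t powi k * av t < av x"
    using at by (simp add: powr_add powr_real_of_int')
  define y where "y = x * t powi (-k)"
  have yD: "y \<in> D" using D x by (simp add: y_def)
  have ay: "av y = av x / av t powi k"
    by (simp add: y_def power_int_minus divide_inverse)
  have pk: "av t powi k > 0" using at by simp
  have "av y \<le> 1" "av t < av y"
    using up lo pk unfolding ay by (auto simp: field_simps)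
  then have "av y = 1"
    using max[OF yD] by fastforce
  then show ?thesis
    using pk unfolding ay by (intro exI[of _ k]) (simp add: field_simps)
qed

lemma av_eq_pi_powi: "(x::'a) \<noteq> 0 \<Longrightarrow> \<exists>k::int. av x = av \<pi> powi k"
  by (rule uniformizer_powers[OF unif(1)]) auto

lemma pi_powi_inj: "av \<pi> powi j = av \<pi> powi k \<Longrightarrow> j = (k::int)"
  using av_pi by (metis linorder_less_linear power_int_strict_decreasing less_irrefl)

lemma value_groups_differ: "av ` (UNIV - {0} :: 'a set) \<noteq> av ` (E - {0})"
  using ram by (simp add: ramified_quadratic_def)

text \<open>An element of \<open>E\<close> of odd valuation, divided by a power of
  \<open>\<pi>\<^sup>2\<close>, would have the absolute value of \<open>\<pi>\<close>. Its powers
  would then realise every value of the large field, contradicting ramification.\<close>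

lemma av_E_even:
  assumes "x \<in> E" "x \<noteq> 0"
  shows "\<exists>k::int. av x = (av \<pi>)\<^sup>2 powi k"
proof -
  obtain k where k: "av x = av \<pi> powi k"
    using av_eq_pi_powi assms by blast
  have eq: "(av \<pi>)\<^sup>2 powi j = av \<pi> powi (2 * j)" for j :: int
    by (metis power_int_mult power_int_numeral)
  show ?thesis
  proof (cases "even k")
    case True
    then show ?thesis using k eq by (metis evenE)
  next
    case False
    then obtain j where j: "k = 2 * j + 1" by (metis oddE)
    define y where "y = x * (\<pi>\<^sup>2) powi (- j)"
    have y: "y \<in> E" "y \<noteq> 0" using assms unif(2) by (auto simp: y_def)
    have "av y = av \<pi> powi k * av \<pi> powi (2 * - j)"
      unfolding y_def av_mult av_power_int av_power eq k ..
    also have "\<dots> = av \<pi>"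
      using av_pi by (simp add: j flip: power_int_add)
    finally have ay: "av y = av \<pi>" .
    have "av z \<in> av ` (E - {0})" if z: "z \<noteq> 0" for z :: 'a
    proof -
      obtain l where "av z = av \<pi> powi l"
        using av_eq_pi_powi z by blast
      then have "av z = av (y powi l)"
        by (simp add: ay)
      then show ?thesis using y by (intro image_eqI[of _ _ "y powi l"]) auto
    qed
    then have "av ` (UNIV - {0} :: 'a set) = av ` (E - {0})"
      by blast
    then show ?thesis using value_groups_differ by simp
  qed
qed

text \<open>Valuations are even on \<open>E\<close> and odd on multiples of \<open>\<pi>\<close> by
  \<open>E\<close>, so the two summands of \<open>u + v * \<pi>\<close> can never cancel.\<close>

lemma av_E_neq:
  assumes "u \<in> E" "v \<in> E" "v \<noteq> 0"
  shows "av u \<noteq> av (v * \<pi>)"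
proof
  assume eq: "av u = av (v * \<pi>)"
  then have "u \<noteq> 0" using assms by auto
  obtain j k where "av u = (av \<pi>)\<^sup>2 powi j" "av v = (av \<pi>)\<^sup>2 powi k"
    using av_E_even assms \<open>u \<noteq> 0\<close> by meson
  then have "av \<pi> powi (2 * j) = av \<pi> powi (2 * k) * av \<pi>"
    using eq by (metis av_mult power_int_mult power_int_numeral)
  also have "\<dots> = av \<pi> powi (2 * k + 1)"
    using av_pi by (simp add: power_int_add)
  finally have "2 * j = 2 * k + 1"
    by (rule pi_powi_inj)
  then show False by presburger
qed

lemma pi_notin_E: "\<pi> \<notin> E"
  using av_E_neq[of \<pi> 1] by auto

text \<open>The given generator \<open>t\<close> is exchanged for \<open>\<pi>\<close>, whose
  coefficient at \<open>t\<close> is nonzero because \<open>\<pi>\<close> is not in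
  \<open>E\<close>.\<close>

lemma decomp: "\<exists>u\<in>E. \<exists>v\<in>E. x = u + v * \<pi>"
proof -
  obtain t where t: "\<And>x. \<exists>u\<in>E. \<exists>v\<in>E. x = u + v * t"
    using ram by (auto simp: ramified_quadratic_def)
  obtain u v where uv: "u \<in> E" "v \<in> E" "\<pi> = u + v * t" using t by blast
  then have v: "v \<noteq> 0" using pi_notin_E by auto
  obtain u' v' where uv': "u' \<in> E" "v' \<in> E" "x = u' + v' * t" using t by blast
  have "x = (u' - v' * u / v) + (v' / v) * \<pi>"
    using v by (simp add: uv(3) uv'(3) field_simps)
  moreover have "u' - v' * u / v \<in> E" "v' / v \<in> E"
    using uv uv' by auto
  ultimately show ?thesis by blast
qed

text \<open>The square of \<open>\<pi>\<close> is fixed, so only a sign is open; a plus sign would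
  make \<open>cj\<close> the identity by the decomposition over \<open>E\<close>.\<close>

lemma cj_pi [simp]: "cj \<pi> = - \<pi>"
proof -
  have "(cj \<pi>)\<^sup>2 = \<pi>\<^sup>2"
    by (metis cj_power cj_E unif(2))
  then consider "cj \<pi> = \<pi>" | "cj \<pi> = - \<pi>"
    by (auto simp: power2_eq_iff)
  then show ?thesis
  proof cases
    case 1
    then have "cj x = x" for x
      using decomp[of x] by auto
    then show ?thesis
      using ram by (auto simp: ramified_quadratic_def)
  qed
qed

lemma av_decomp:
  assumes "u \<in> E" "v \<in> E"
  shows "av (u + v * \<pi>) = max (av u) (av (v * \<pi>))"
proof (cases "v = 0")
  case False
  then consider "av u < av (v * \<pi>)" | "av (v * \<pi>) < av u"
    using av_E_neq[OF assms] by linarith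
  then show ?thesis
    by cases (use av_add_eq[of u "v * \<pi>"] av_add_eq[of "v * \<pi>" u] in \<open>auto simp: add.commute\<close>)
qed simp

text \<open>By \<open>av_decomp\<close> both sides are the same maximum, which does not see the sign
  of \<open>v\<close>.\<close>

lemma av_cj [simp]: "av (cj x) = av x"
proof -
  obtain u v where "u \<in> E" "v \<in> E" "x = u + v * \<pi>" using decomp by blast
  then show ?thesis
    using av_decomp[of u v] av_decomp[of u "- v"] by simp
qed

lemma cj_cj [simp]: "cj (cj x) = x"
  using decomp[of x] by auto

lemma cj_fixed: "cj x = x \<Longrightarrow> x \<in> E"
proof -
  obtain u v where uv: "u \<in> E" "v \<in> E" "x = u + v * \<pi>" using decomp by blast
  assume "cj x = x"
  then have "2 * (v * \<pi>) = 0" using uv by (simp add: algebra_simps)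
  then show ?thesis using uv by simp
qed

lemma cj_anti: "x + cj x = 0 \<longleftrightarrow> x \<in> (\<lambda>x. \<pi> * x) ` E"
proof
  obtain u v where uv: "u \<in> E" "v \<in> E" "x = u + v * \<pi>" using decomp by blast
  assume "x + cj x = 0"
  then have "2 * u = 0" using uv by (simp add: algebra_simps)
  then show "x \<in> (\<lambda>x. \<pi> * x) ` E" using uv by (auto simp: mult.commute)
qed auto

lemma nm_E [simp]: "nm cj x \<in> E"
  by (rule cj_fixed) (simp add: nm_def mult.commute)

lemma nm_mult: "nm cj (x * y) = nm cj x * nm cj y"
  by (simp add: nm_def)

lemma nm_inverse: "nm cj (inverse x) = inverse (nm cj x)"
  by (simp add: nm_def)

lemma nm_eq_0 [simp]: "nm cj x = 0 \<longleftrightarrow> x = 0"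
  by (simp add: nm_def)

lemma av_nm [simp]: "av (nm cj x) = (av x)\<^sup>2"
  by (simp add: nm_def power2_eq_square)

lemma norm_oneD:
  assumes "x \<in> norm_one cj"
  shows "x \<noteq> 0" "av x = 1" "x * cj x = 1" "inverse x = cj x" "inverse (cj x) = x"
proof -
  show 1: "x * cj x = 1" using assms by (simp add: norm_one_def nm_def)
  then show "x \<noteq> 0" by auto
  have "(av x)\<^sup>2 = 1" using 1 by (metis av_nm av_one nm_def)
  then show "av x = 1" by (metis av_nonneg abs_of_nonneg abs_square_eq_1)
  show "inverse x = cj x" using 1 by (metis inverse_unique)
  show "inverse (cj x) = x" using 1 by (metis inverse_unique mult.commute)
qed

text \<open>For norm-one \<open>x\<close> the product of \<open>x\<close> and
  \<open>cj (1 + x)\<close> is again \<open>1 + x\<close>, which gives the usual witness. It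
  vanishes at \<open>x = - 1\<close>, where the trace-zero element \<open>\<pi>\<close> takes
  over.\<close>

lemma hilbert90:
  assumes "x \<in> norm_one cj"
  shows "\<exists>y. y \<noteq> 0 \<and> y / cj y = x"
proof (cases "x = - 1")
  case True
  then show ?thesis by (intro exI[of _ \<pi>]) simp
next
  case False
  then have "1 + x \<noteq> 0" by (metis add.inverse_unique)
  moreover have "x * cj (1 + x) = 1 + x"
    using norm_oneD[OF assms] by (simp add: algebra_simps)
  ultimately show ?thesis
    by (intro exI[of _ "1 + x"]) (metis cj_eq_0 nonzero_eq_divide_eq)
qed

lemma small_element: "r > 0 \<Longrightarrow> \<exists>b::'a. b \<noteq> 0 \<and> av b < r"
  using real_arch_pow_inv[of r "av \<pi>"] av_pi by (metis av_power pi_nonzero power_not_zero)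

text \<open>Values on \<open>E\<close> are powers of \<open>(av \<pi>)\<^sup>2\<close>, so none lies
  strictly between this number and 1.\<close>

lemma unif_E: "is_uniformizer E (\<pi>\<^sup>2)"
  unfolding is_uniformizer_def
proof (intro conjI ballI impI)
  fix x assume x: "x \<in> E" "av x < 1"
  show "av x \<le> av (\<pi>\<^sup>2)"
  proof (cases "x = 0")
    case False
    then obtain k where k: "av x = (av \<pi>)\<^sup>2 powi k" using av_E_even x by blast
    have q: "0 < (av \<pi>)\<^sup>2" "(av \<pi>)\<^sup>2 < 1"
      using av_pi by (auto simp: power_less_one_iff)
    have "k \<ge> 1"
    proof (rule ccontr)
      assume "\<not> k \<ge> 1"
      then have "(av \<pi>)\<^sup>2 powi k \<ge> (av \<pi>)\<^sup>2 powi 0"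
        using q by (intro power_int_decreasing) auto
      then show False using x k by simp
    qed
    then have "(av \<pi>)\<^sup>2 powi k \<le> (av \<pi>)\<^sup>2 powi 1"
      using q by (intro power_int_decreasing) auto
    then show ?thesis using k by simp
  qed simp
qed (use unif av_pi in \<open>auto simp: power_less_one_iff\<close>)

end

subsection \<open>The quadratic character and the Haar measure\<close>

locale orbital_setting = ramified_extension p E cj \<pi>
  for p :: nat and E :: "'a::{field_char_0,metric_space} set" and cj :: "'a \<Rightarrow> 'a" and \<pi> :: 'a +
  fixes \<psi> :: "'a \<Rightarrow> complex" and \<mu> :: "'a measure"
  assumes eta: "extends_quad_char E cj \<psi>"
    and mu: "haar_on (E - {0}) \<mu>" "emeasure \<mu> {x \<in> E. av x = 1} = 1"
begin

abbreviation \<eta> :: "'a \<Rightarrow> complex" where "\<eta> \<equiv> quad_char cj"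
abbreviation nab :: "'a \<Rightarrow> real" where "nab \<equiv> nabs E"

lemma psi_mult: "x \<noteq> 0 \<Longrightarrow> y \<noteq> 0 \<Longrightarrow> \<psi> (x * y) = \<psi> x * \<psi> y"
  using eta by (auto simp: extends_quad_char_def)

lemma psi_E: "x \<in> E \<Longrightarrow> x \<noteq> 0 \<Longrightarrow> \<psi> x = \<eta> x"
  using eta by (auto simp: extends_quad_char_def)

lemma eta_mult: "x \<in> E \<Longrightarrow> x \<noteq> 0 \<Longrightarrow> y \<in> E \<Longrightarrow> y \<noteq> 0 \<Longrightarrow> \<eta> (x * y) = \<eta> x * \<eta> y"
  using psi_mult[of x y] by (simp add: psi_E)

lemma eta_cases: "\<eta> x = 1 \<or> \<eta> x = - 1"
  by (simp add: quad_char_def)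

lemma eta_sq [simp]: "\<eta> x * \<eta> x = 1"
  using eta_cases[of x] by auto

lemma norm_eta [simp]: "norm (\<eta> x) = 1"
  using eta_cases[of x] by auto

lemma eta_nm: "z \<noteq> 0 \<Longrightarrow> \<eta> (nm cj z) = 1"
  by (auto simp: quad_char_def)

lemma eta_1 [simp]: "\<eta> 1 = 1"
  using eta_nm[of 1] by (simp add: nm_def)

lemma eta_inverse: "x \<in> E \<Longrightarrow> x \<noteq> 0 \<Longrightarrow> \<eta> (inverse x) = \<eta> x"
  using eta_mult[of x "inverse x"] eta_cases[of x] eta_cases[of "inverse x"] by auto

lemma eta_divide: "x \<in> E \<Longrightarrow> x \<noteq> 0 \<Longrightarrow> y \<in> E \<Longrightarrow> y \<noteq> 0 \<Longrightarrow> \<eta> (x / y) = \<eta> x * \<eta> y"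
  by (simp add: divide_inverse eta_mult eta_inverse)

lemma psi_nonzero: "x \<noteq> 0 \<Longrightarrow> \<psi> x \<noteq> 0"
  using psi_mult[of x "inverse x"] psi_E[of 1] by auto

text \<open>The image of a small ball around 1 is closed under squaring, and squaring expands distances
  from 1 in the disc of radius 1/2 by a factor of at least 3/2.\<close>

lemma psi_trivial_near_1: "\<exists>r>0. \<forall>x. av (x - 1) < r \<longrightarrow> \<psi> x = 1"
proof -
  have "continuous_on (UNIV - {0}) \<psi>"
    using eta by (simp add: extends_quad_char_def)
  then obtain d where d: "d > 0" "\<And>x. x \<noteq> 0 \<Longrightarrow> dist x 1 < d \<Longrightarrow> dist (\<psi> x) (\<psi> 1) < 1/2"
    unfolding continuous_on_iff by (metis DiffI UNIV_I half_gt_zero singletonD zero_less_one zero_neq_one)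
  have psi1: "\<psi> 1 = 1" using psi_E[of 1] by simp
  have near: "norm (\<psi> x - 1) < 1/2" if "av (x - 1) < min d 1" for x
  proof -
    have "x \<noteq> 0" using that by auto
    then show ?thesis using d(2)[of x] that psi1 by (simp add: dist_av dist_norm)
  qed
  have "\<psi> x = 1" if x: "av (x - 1) < min d 1" for x
  proof -
    have nonzero: "x \<noteq> 0" using x by auto
    have iter: "av (x ^ (2 ^ n) - 1) < min d 1 \<and> norm (\<psi> (x ^ (2 ^ n)) - 1) \<ge> (3/2) ^ n * norm (\<psi> x - 1)" for n
    proof (induction n)
      case (Suc n)
      define y where "y = x ^ (2 ^ n)"
      have y: "av (y - 1) < min d 1" "norm (\<psi> y - 1) \<ge> (3/2) ^ n * norm (\<psi> x - 1)"
        using Suc by (auto simp: y_def)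
      have yy: "x ^ (2 ^ Suc n) = y * y"
        by (simp add: y_def power_mult power2_eq_square mult.commute[of 2])
      have "av y = 1" using av_close[of y 1] y by simp
      then have "av (y * y - y) < min d 1"
        using y(1) by (metis av_mult mult.commute mult_1 mult.right_neutral right_diff_distrib)
      then have "av (y * y - 1) < min d 1"
        using y(1) av_diff_less by blast
      \<comment> \<open>The factor 3/2 comes from a difference of squares:
        \<open>\<psi> y + 1\<close> stays within 1/2 of 2.\<close>
      moreover have "norm (\<psi> (y * y) - 1) \<ge> (3/2) * norm (\<psi> y - 1)"
      proof -
        have "\<psi> (y * y) - 1 = (\<psi> y + 1) * (\<psi> y - 1)"
          using nonzero by (simp add: y_def psi_mult algebra_simps)
        moreover have "norm (\<psi> y + 1) \<ge> 3/2"
          using near[OF y(1)] norm_triangle_ineq2[of 2 "1 - \<psi> y"] by (simp add: norm_minus_commute add.commute)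
        ultimately show ?thesis
          using mult_right_mono[of "3/2" "norm (\<psi> y + 1)" "norm (\<psi> y - 1)"] by (simp add: norm_mult)
      qed
      ultimately show ?case
        using y(2) unfolding yy by auto
    qed (use x in auto)
    show ?thesis
    proof (rule ccontr)
      assume "\<psi> x \<noteq> 1"
      then obtain n where "1 / norm (\<psi> x - 1) < (3/2) ^ n"
        using real_arch_pow[of "3/2"] by auto
      then have "1 < (3/2) ^ n * norm (\<psi> x - 1)"
        using \<open>\<psi> x \<noteq> 1\<close> by (simp add: field_simps)
      then show False
        using iter[of n] near[of "x ^ (2 ^ n)"] by linarith
    qed
  qed
  then show ?thesis
    using d(1) by (intro exI[of _ "min d 1"]) auto
qed

section \<open>Measurability and invariance on the multiplicative group\<close>

lemma sets_mu: "sets \<mu> = sets (restrict_space borel (E - {0}))"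
  using mu by (simp add: haar_on_def)

lemma space_mu [simp]: "space \<mu> = E - {0}"
  using sets_eq_imp_space_eq[OF sets_mu] by (simp add: space_restrict_space)

lemma continuous_measurable:
  assumes "continuous_on (E - {0}) f"
  shows "f \<in> borel_measurable \<mu>"
  using borel_measurable_continuous_on_restrict[OF assms] measurable_cong_sets[OF sets_mu refl] by blast

lemma eta_measurable [measurable]: "\<eta> \<in> borel_measurable \<mu>"
proof -
  have "continuous_on (E - {0}) \<psi>"
    using eta by (auto simp: extends_quad_char_def elim: continuous_on_subset)
  then have "continuous_on (E - {0}) \<eta>"
    by (rule continuous_on_cong[THEN iffD1, rotated 2]) (auto simp: psi_E)
  then show ?thesis by (rule continuous_measurable)
qed

text \<open>The codomain is arbitrary so that predicates count as locally constant too; this yields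
  measurable sets as well as measurable integrands.\<close>

definition loc_const :: "('a \<Rightarrow> 'b) \<Rightarrow> bool" where
  "loc_const f \<longleftrightarrow> (\<forall>x\<in>E - {0}. \<exists>d>0. \<forall>y\<in>E - {0}. av (y - x) < d \<longrightarrow> f y = f x)"

lemma loc_constI:
  assumes "\<And>x. x \<in> E \<Longrightarrow> x \<noteq> 0 \<Longrightarrow> \<exists>d>0. \<forall>y\<in>E. y \<noteq> 0 \<longrightarrow> av (y - x) < d \<longrightarrow> f y = f x"
  shows "loc_const f"
  using assms unfolding loc_const_def by (metis DiffE singletonI)

lemma loc_const_measurable:
  fixes f :: "'a \<Rightarrow> complex"
  assumes "loc_const f"
  shows "f \<in> borel_measurable \<mu>"
proof (rule continuous_measurable)
  show "continuous_on (E - {0}) f"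
    using assms unfolding continuous_on_iff loc_const_def by (metis dist_av dist_self)
qed

lemma loc_const_combine:
  assumes "loc_const f" "loc_const g"
  shows "loc_const (\<lambda>h. F (f h) (g h))"
proof (rule loc_constI)
  fix x assume x: "x \<in> E" "x \<noteq> 0"
  then have x': "x \<in> E - {0}" by simp
  obtain d where d: "d > 0" "\<forall>y\<in>E - {0}. av (y - x) < d \<longrightarrow> f y = f x"
    using assms(1) x' unfolding loc_const_def by blast
  obtain e where e: "e > 0" "\<forall>y\<in>E - {0}. av (y - x) < e \<longrightarrow> g y = g x"
    using assms(2) x' unfolding loc_const_def by blast
  have "F (f y) (g y) = F (f x) (g x)" if "y \<in> E" "y \<noteq> 0" "av (y - x) < min d e" for y
  proof -
    have "f y = f x" "g y = g x" using d(2) e(2) that by auto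
    then show ?thesis by simp
  qed
  moreover have "min d e > 0" using d(1) e(1) by simp
  ultimately show "\<exists>d>0. \<forall>y\<in>E. y \<noteq> 0 \<longrightarrow> av (y - x) < d \<longrightarrow> F (f y) (g y) = F (f x) (g x)"
    by blast
qed

text \<open>The ball of radius \<open>av x\<close> around \<open>x\<close> lies in a single level
  set of \<open>av\<close>, so any \<open>F\<close> is allowed.\<close>

lemma loc_const_av: "loc_const (\<lambda>h. F (av h))"
proof (rule loc_constI)
  fix x assume x: "x \<in> E" "x \<noteq> 0"
  have "\<forall>y\<in>E. y \<noteq> 0 \<longrightarrow> av (y - x) < av x \<longrightarrow> F (av y) = F (av x)" "av x > 0"
    using x by (metis av_close, simp)
  then show "\<exists>d>0. \<forall>y\<in>E. y \<noteq> 0 \<longrightarrow> av (y - x) < d \<longrightarrow> F (av y) = F (av x)"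
    by blast
qed

lemma loc_const_scale:
  assumes "loc_const f" "c \<in> E" "c \<noteq> 0"
  shows "loc_const (\<lambda>h. f (c * h))"
proof (rule loc_constI)
  fix x assume x: "x \<in> E" "x \<noteq> 0"
  then obtain d where d: "d > 0" "\<And>y. y \<in> E - {0} \<Longrightarrow> av (y - c * x) < d \<Longrightarrow> f y = f (c * x)"
    using assms unfolding loc_const_def by (metis DiffI E_closed(4) mult_eq_0_iff singletonD)
  have "f (c * y) = f (c * x)" if "y \<in> E" "y \<noteq> 0" "av (y - x) < d / av c" for y
  proof -
    have "av (c * y - c * x) = av c * av (y - x)"
      by (simp only: right_diff_distrib[symmetric] av_mult)
    also have "\<dots> < d"
      using that assms by (simp add: pos_less_divide_eq mult.commute)
    finally have "av (c * y - c * x) < d" .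
    then show ?thesis using d(2) that assms by simp
  qed
  then show "\<exists>d>0. \<forall>y\<in>E. y \<noteq> 0 \<longrightarrow> av (y - x) < d \<longrightarrow> f (c * y) = f (c * x)"
  proof (intro exI conjI)
    show "d / av c > 0" using d(1) assms by simp
  qed blast
qed

lemma loc_const_inverse:
  assumes "loc_const f"
  shows "loc_const (\<lambda>h. f (inverse h))"
proof (rule loc_constI)
  fix x assume x: "x \<in> E" "x \<noteq> 0"
  then obtain d where d: "d > 0"
    "\<And>y. y \<in> E - {0} \<Longrightarrow> av (y - inverse x) < d \<Longrightarrow> f y = f (inverse x)"
    using assms unfolding loc_const_def
    by (metis DiffI E_closed(5) inverse_nonzero_iff_nonzero singletonD)
  have "f (inverse y) = f (inverse x)"
    if y: "y \<in> E" "y \<noteq> 0" and lt: "av (y - x) < min (av x) (d * (av x)\<^sup>2)" for y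
  proof -
    \<comment> \<open>Within \<open>av x\<close> of \<open>x\<close> the absolute value is constant,
      so inversion divides the distance to \<open>x\<close> by \<open>(av x)\<^sup>2\<close>; this
      explains the second bound in the radius.\<close>
    have "av y = av x" using lt av_close[of y x] by simp
    moreover have "inverse y - inverse x = (x - y) / (y * x)"
      using x y by (simp add: field_simps)
    ultimately have "av (inverse y - inverse x) = av (y - x) / (av x)\<^sup>2"
      by (simp only: av_divide av_mult power2_eq_square av_diff_commute[of x y])
    then have "av (inverse y - inverse x) < d"
      using lt x by (simp add: pos_divide_less_eq)
    then show ?thesis using d(2) y by simp
  qed
  then show "\<exists>d>0. \<forall>y\<in>E. y \<noteq> 0 \<longrightarrow> av (y - x) < d \<longrightarrow> f (inverse y) = f (inverse x)"
  proof (intro exI conjI)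
    show "min (av x) (d * (av x)\<^sup>2) > 0" using d(1) x by simp
  qed blast
qed

lemma loc_const_sets:
  assumes "loc_const P"
  shows "{h \<in> E - {0}. P h} \<in> sets \<mu>"
proof -
  have "(\<lambda>h. if P h then 1 else 0 :: complex) \<in> borel_measurable \<mu>"
    by (rule loc_const_measurable, rule loc_const_combine[OF assms assms, of "\<lambda>x y. if x then 1 else 0"])
  from measurable_sets[OF this, of "{1}"] show ?thesis
    by (rule back_subst[of "\<lambda>A. A \<in> sets \<mu>"]) (auto split: if_splits)
qed

lemma scale_measurable:
  assumes "c \<in> E" "c \<noteq> 0"
  shows "(\<lambda>x. c * x) \<in> measurable \<mu> \<mu>"
proof -
  have "continuous_on (E - {0}) (\<lambda>x. c * x)"
    unfolding continuous_on_iff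
  proof (intro ballI allI impI)
    fix x e :: real and y :: 'a assume "e > 0"
    have "dist (c * x') (c * y) = av c * dist x' y" for x'
      by (simp only: dist_av right_diff_distrib[symmetric] av_mult)
    then show "\<exists>d>0. \<forall>x'\<in>E - {0}. dist x' y < d \<longrightarrow> dist (c * x') (c * y) < e"
      using \<open>e > 0\<close> assms by (intro exI[of _ "e / av c"]) (simp add: pos_less_divide_eq mult.commute)
  qed
  then have "(\<lambda>x. c * x) \<in> borel_measurable \<mu>"
    by (rule continuous_measurable)
  then have "(\<lambda>x. c * x) \<in> measurable \<mu> (restrict_space borel (E - {0}))"
    by (rule measurable_restrict_space2[rotated]) (use assms in auto)
  then show ?thesis
    using measurable_cong_sets[OF refl sets_mu] by blast
qed

lemma emeasure_scale:
  "c \<in> E \<Longrightarrow> c \<noteq> 0 \<Longrightarrow> A \<in> sets \<mu> \<Longrightarrow> emeasure \<mu> ((\<lambda>x. c * x) ` A) = emeasure \<mu> A"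
  using mu by (simp add: haar_on_def)

lemma integral_scale:
  fixes f :: "'a \<Rightarrow> complex"
  assumes c: "c \<in> E" "c \<noteq> 0" and f: "f \<in> borel_measurable \<mu>"
  shows "(\<integral>h. f (c * h) \<partial>\<mu>) = (\<integral>h. f h \<partial>\<mu>)"
proof -
  \<comment> \<open>Invariance is given for images, whereas \<open>distr\<close> speaks of
    preimages; a preimage under multiplication by \<open>c\<close> is an image under multiplication
    by its inverse.\<close>
  have "distr \<mu> \<mu> (\<lambda>x. c * x) = \<mu>"
  proof (rule measure_eqI)
    fix A assume "A \<in> sets (distr \<mu> \<mu> (\<lambda>x. c * x))"
    then have A: "A \<in> sets \<mu>" by simp
    then have AE: "A \<subseteq> E - {0}" using sets.sets_into_space[OF A] by simp
    have "(\<lambda>x. c * x) -` A \<inter> space \<mu> = (\<lambda>x. inverse c * x) ` A"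
    proof (intro equalityI subsetI)
      fix x assume "x \<in> (\<lambda>x. c * x) -` A \<inter> space \<mu>"
      then show "x \<in> (\<lambda>x. inverse c * x) ` A"
        using c by (intro image_eqI[of _ _ "c * x"]) auto
    qed (use c AE in \<open>auto simp: mult.assoc[symmetric]\<close>)
    then show "emeasure (distr \<mu> \<mu> (\<lambda>x. c * x)) A = emeasure \<mu> A"
      using A c by (simp add: emeasure_distr scale_measurable emeasure_scale)
  qed simp
  then show ?thesis
    using integral_distr[OF scale_measurable[OF c] f] by simp
qed

lemma emeasure_level:
  assumes "c \<in> E" "c \<noteq> 0"
  shows "emeasure \<mu> {h \<in> E - {0}. av h = av c} = 1"
proof -
  have "{h \<in> E - {0}. av h = av c} = (\<lambda>x. c * x) ` {x \<in> E. av x = 1}"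
  proof (intro equalityI subsetI)
    fix x assume "x \<in> {h \<in> E - {0}. av h = av c}"
    then show "x \<in> (\<lambda>x. c * x) ` {x \<in> E. av x = 1}"
      using assms by (intro image_eqI[of _ _ "x / c"]) auto
  qed (use assms in auto)
  moreover have "{x \<in> E. av x = 1} = {x \<in> E - {0}. av x = 1}" by auto
  ultimately show ?thesis
    using emeasure_scale[OF assms loc_const_sets[OF loc_const_av[of "\<lambda>r. r = 1"]]] mu(2) by simp
qed

section \<open>The residue field\<close>

lemma av_sum_less:
  "finite B \<Longrightarrow> r > 0 \<Longrightarrow> (\<And>b. b \<in> B \<Longrightarrow> av (f b) < r) \<Longrightarrow> av (\<Sum>b\<in>B. f b :: 'a) < r"
proof (induction B rule: finite_induct)
  case (insert b B)
  then show ?case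
    using av_add_le[of "f b" "sum f B"] by (fastforce simp: max_def split: if_splits)
qed simp

text \<open>Rational combinations of the finite spanning set, with coefficients approximating those
  of \<open>x\<close>, come within distance 1 of \<open>x\<close>, which is all that residue classes
  see.\<close>

lemma countable_approx: "\<exists>C. countable C \<and> C \<subseteq> E \<and> (\<forall>x\<in>E. \<exists>c\<in>C. av (x - c) < 1)"
proof -
  obtain B where B: "finite B" "B \<subseteq> E" "closure \<rat> \<subseteq> E"
    "\<And>x. x \<in> E \<Longrightarrow> \<exists>c. (\<forall>b\<in>B. c b \<in> closure \<rat>) \<and> x = (\<Sum>b\<in>B. c b * b)"
    using ext unfolding finite_ext_Qp_def by blast
  define C where "C = (\<lambda>r. \<Sum>b\<in>B. r b * b) ` (PiE B (\<lambda>_. \<rat>))"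
  have "countable C"
    unfolding C_def using B(1) by (intro countable_image countable_PiE) (auto intro: countable_rat)
  moreover have "C \<subseteq> E"
  proof -
    have sumE: "sum f A \<in> E" if "\<And>a. a \<in> A \<Longrightarrow> f a \<in> E" for f :: "'a \<Rightarrow> 'a" and A
      using that by (induction A rule: infinite_finite_induct) auto
    have "\<rat> \<subseteq> E" using B(3) closure_subset by blast
    then have "(\<Sum>b\<in>B. r b * b) \<in> E" if "\<forall>b\<in>B. r b \<in> \<rat>" for r
      using B(2) that by (intro sumE) (meson E_closed(4) subsetD)
    then show ?thesis by (auto simp: C_def PiE_iff)
  qed
  moreover have "\<exists>c\<in>C. av (x - c) < 1" if x: "x \<in> E" for x
  proof -
    obtain c where c: "\<And>b. b \<in> B \<Longrightarrow> c b \<in> closure \<rat>" "x = (\<Sum>b\<in>B. c b * b)"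
      using B(4)[OF x] by blast
    \<comment> \<open>Adding 1 to \<open>av b\<close> keeps the bound positive when
      \<open>b = 0\<close>.\<close>
    have "\<exists>r\<in>\<rat>. av (c b - r) < 1 / (av b + 1)" if "b \<in> B" for b
    proof -
      have "0 < 1 / (av b + 1)" by (simp add: add_nonneg_pos)
      then show ?thesis
        using c(1)[OF that] unfolding closure_approachable by (metis av_diff_commute dist_av)
    qed
    then obtain r where r: "\<And>b. b \<in> B \<Longrightarrow> r b \<in> \<rat> \<and> av (c b - r b) < 1 / (av b + 1)"
      by metis
    have "av (x - (\<Sum>b\<in>B. restrict r B b * b)) = av (\<Sum>b\<in>B. (c b - r b) * b)"
      by (simp add: c(2) sum_subtractf algebra_simps)
    also have "\<dots> < 1"
    proof (rule av_sum_less[OF B(1)])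
      fix b assume "b \<in> B"
      then have *: "av (c b - r b) * (av b + 1) < 1"
        using r[of b] by (simp add: pos_less_divide_eq add_nonneg_pos)
      have "av (c b - r b) * av b \<le> av (c b - r b) * (av b + 1)"
        by (intro mult_left_mono) auto
      then show "av ((c b - r b) * b) < 1" using * by simp
    qed simp
    finally show ?thesis
      using r unfolding C_def
      by (intro bexI[of _ "\<Sum>b\<in>B. restrict r B b * b"] image_eqI[of _ _ "restrict r B"]) auto
  qed
  ultimately show ?thesis by blast
qed

text \<open>For \<open>x\<close> in \<open>E\<close> of absolute value at most 1 this is its coset
  modulo the maximal ideal.\<close>

definition residue_class :: "'a \<Rightarrow> 'a set" where
  "residue_class x = {z \<in> E. av (z - x) < 1}"

lemma residue_class_eq_iff:
  assumes "x \<in> E"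
  shows "residue_class x = residue_class y \<longleftrightarrow> av (x - y) < 1"
proof
  assume "residue_class x = residue_class y"
  moreover have "x \<in> residue_class x" using assms by (simp add: residue_class_def)
  ultimately show "av (x - y) < 1" by (simp add: residue_class_def)
next
  assume "av (x - y) < 1"
  then show "residue_class x = residue_class y"
    unfolding residue_class_def by (metis (lifting) av_diff_commute av_diff_less)
qed

text \<open>The residue field is countable, since \<open>E\<close> is spanned by finitely many elements over the
  closure of \<open>\<rat>\<close>.  The unit classes are translates of each other and have total volume 1, so there
  are only finitely many of them.\<close>

lemma finite_unit_classes: "finite (residue_class ` {x \<in> E. av x = 1})" (is "finite ?V")
proof -
  obtain C where C: "countable C" "C \<subseteq> E" "\<And>x. x \<in> E \<Longrightarrow> \<exists>c\<in>C. av (x - c) < 1"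
    using countable_approx by blast
  have "?V \<subseteq> residue_class ` C"
  proof
    fix V assume "V \<in> ?V"
    then obtain x where x: "x \<in> E" "V = residue_class x" by blast
    with C(3) obtain c where "c \<in> C" "av (x - c) < 1" by blast
    then show "V \<in> residue_class ` C" using residue_class_eq_iff x by blast
  qed
  then have cV: "countable ?V"
    using C(1) countable_image countable_subset by metis
  have unit: "av z = 1" if "av x = 1" "av (z - x) < 1" for x z :: 'a
    using av_close[of z x] that by simp
  have sets1: "residue_class 1 \<in> sets \<mu>"
  proof -
    have "residue_class 1 = {h \<in> E - {0}. av (h - 1) < 1}"
      by (auto simp: residue_class_def)
    moreover have "loc_const (\<lambda>h. av (h - 1) < 1)"
    proof (rule loc_constI)
      fix x :: 'a
      have "av (y - 1) < 1 \<longleftrightarrow> av (x - 1) < 1" if "av (y - x) < 1" for y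
        using av_diff_less[of y x 1 1] av_diff_less[of x y 1 1] that
        by (auto simp: av_diff_commute[of x y])
      then show "\<exists>d>0. \<forall>y\<in>E. y \<noteq> 0 \<longrightarrow> av (y - x) < d \<longrightarrow> (av (y - 1) < 1) = (av (x - 1) < 1)"
        using zero_less_one by blast
    qed
    ultimately show ?thesis using loc_const_sets by simp
  qed
  have img: "residue_class x = (\<lambda>z. x * z) ` residue_class 1" if x: "x \<in> E" "av x = 1" for x
  proof (intro equalityI subsetI)
    fix z assume z: "z \<in> residue_class x"
    have x0: "x \<noteq> 0" using x by auto
    then have "z / x - 1 = (z - x) / x" by (simp add: diff_divide_distrib)
    then have "av (z / x - 1) = av (z - x)" by (metis av_divide div_by_1 x(2))
    then have "av (z / x - 1) < 1" using z by (simp add: residue_class_def)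
    then show "z \<in> (\<lambda>z. x * z) ` residue_class 1"
      using z x x0 by (intro image_eqI[of _ _ "z / x"]) (auto simp: residue_class_def)
  next
    fix z assume "z \<in> (\<lambda>z. x * z) ` residue_class 1"
    then obtain w where w: "w \<in> E" "av (w - 1) < 1" "z = x * w" by (auto simp: residue_class_def)
    then have "z - x = x * (w - 1)" by (simp add: right_diff_distrib)
    then have "av (z - x) = av (w - 1)" by (metis av_mult mult_1 x(2))
    then show "z \<in> residue_class x" using w x by (simp add: residue_class_def)
  qed
  have em: "emeasure \<mu> V = emeasure \<mu> (residue_class 1)" and sV: "V \<in> sets \<mu>" if V: "V \<in> ?V" for V
  proof -
    obtain x where x: "x \<in> E" "av x = 1" "V = residue_class x" using V by blast
    then have x0: "x \<noteq> 0" by auto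
    then show "emeasure \<mu> V = emeasure \<mu> (residue_class 1)"
      using emeasure_scale[OF x(1) _ sets1] unfolding x(3) img[OF x(1,2)] by blast
    have "V = (\<lambda>z. inverse x * z) -` residue_class 1 \<inter> space \<mu>"
    proof (intro equalityI subsetI)
      fix z assume z: "z \<in> V"
      then have "z \<in> E" "z \<noteq> 0" using x unit[of x z] by (auto simp: residue_class_def)
      then show "z \<in> (\<lambda>z. inverse x * z) -` residue_class 1 \<inter> space \<mu>"
        using z x0 unfolding x(3) img[OF x(1,2)] by (auto simp: mult.assoc[symmetric])
    next
      fix z assume "z \<in> (\<lambda>z. inverse x * z) -` residue_class 1 \<inter> space \<mu>"
      then show "z \<in> V"
        using x0 unfolding x(3) img[OF x(1,2)] by (intro image_eqI[of _ _ "inverse x * z"]) auto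
    qed
    then show "V \<in> sets \<mu>"
      using measurable_sets[OF scale_measurable sets1, of "inverse x"] x x0 by simp
  qed
  have disj: "disjoint_family_on (\<lambda>V. V) ?V"
  proof -
    have "residue_class x = residue_class y"
      if "x \<in> E" "z \<in> residue_class x" "z \<in> residue_class y" for x y z
      using that residue_class_eq_iff[of x y] av_diff_less[of x z 1 y]
      by (simp add: residue_class_def av_diff_commute)
    then have "V \<inter> W = {}" if "V \<in> ?V" "W \<in> ?V" "V \<noteq> W" for V W
      using that by blast
    then show ?thesis
      by (simp add: disjoint_family_on_def)
  qed
  have un: "(\<Union>V\<in>?V. V) = {x \<in> E. av x = 1}"
  proof (intro equalityI subsetI)
    fix z assume "z \<in> (\<Union>V\<in>?V. V)"
    then obtain x where "x \<in> E" "av x = 1" "z \<in> residue_class x" by blast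
    then show "z \<in> {x \<in> E. av x = 1}" using unit[of x z] by (simp add: residue_class_def)
  next
    fix z assume "z \<in> {x \<in> E. av x = 1}"
    then show "z \<in> (\<Union>V\<in>?V. V)" by (auto simp: residue_class_def intro!: exI[of _ z])
  qed
  have "1 = emeasure \<mu> (\<Union>V\<in>?V. V)"
    using mu(2) un by simp
  \<comment> \<open>Finiteness is not known yet, so the sum over the classes is an integral against
    counting measure; their countability is what permits additivity.\<close>
  also have "\<dots> = (\<integral>\<^sup>+V. emeasure \<mu> V \<partial>count_space ?V)"
    using cV disj sV by (intro emeasure_UN_countable) auto
  also have "\<dots> = (\<integral>\<^sup>+V. emeasure \<mu> (residue_class 1) \<partial>count_space ?V)"
    by (intro nn_integral_cong em) simp
  also have "\<dots> = emeasure \<mu> (residue_class 1) * emeasure (count_space ?V) ?V"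
    using nn_integral_const[of "count_space ?V"] by simp
  finally have eq: "1 = emeasure \<mu> (residue_class 1) * emeasure (count_space ?V) ?V" .
  show ?thesis
  proof (rule ccontr)
    \<comment> \<open>With infinitely many classes the product would be 0 or infinite, never
      1.\<close>
    assume "infinite ?V"
    then have "emeasure (count_space ?V) ?V = \<infinity>" by simp
    then show False
      using eq by (cases "emeasure \<mu> (residue_class 1) = 0") (auto simp: ennreal_mult_top)
  qed
qed

text \<open>As \<open>card\<close> is 0 on infinite sets, positivity says that the residue field is
  finite: every class other than that of 0 is a unit class. The normalized absolute value would
  otherwise degenerate.\<close>

lemma residue_card_pos: "residue_card E > 0"
proof -
  let ?R = "{(x, y). x \<in> int_ring E \<and> y \<in> int_ring E \<and> av (x - y) < 1}"
  have cls: "?R `` {x} = residue_class x" if x: "x \<in> int_ring E" for x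
  proof -
    have "av z \<le> 1" if "av (x - z) < 1" for z
      using x that av_diff_le[of x "x - z"] by (auto simp: int_ring_def)
    then show ?thesis
      using x by (auto simp: residue_class_def int_ring_def av_diff_commute)
  qed
  have "int_ring E // ?R \<subseteq> insert (residue_class 0) (residue_class ` {x \<in> E. av x = 1})"
  proof
    fix V assume "V \<in> int_ring E // ?R"
    then obtain x where x: "x \<in> int_ring E" "V = residue_class x"
      using cls by (auto simp: quotient_def)
    show "V \<in> insert (residue_class 0) (residue_class ` {x \<in> E. av x = 1})"
    proof (cases "av x = 1")
      case False
      then have "av (x - 0) < 1" "x \<in> E" using x(1) by (auto simp: int_ring_def)
      then show ?thesis using residue_class_eq_iff[of x 0] x(2) by simp
    qed (use x in \<open>auto simp: int_ring_def\<close>)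
  qed
  then have "finite (int_ring E // ?R)"
    using finite_unit_classes finite_subset by blast
  moreover have "int_ring E // ?R \<noteq> {}"
    by (auto simp: quotient_def int_ring_def intro!: exI[of _ 0])
  ultimately show ?thesis
    unfolding residue_card_def by (simp add: card_gt_0_iff)
qed

text \<open>Squaring identifies the distinct classes of 1 and -1, hence cannot be onto on the finite set
  of unit classes.\<close>

lemma nonsquare_unit: "\<exists>v\<in>E. av v = 1 \<and> (\<forall>u\<in>E. av u = 1 \<longrightarrow> \<not> av (v - u\<^sup>2) < 1)"
proof -
  let ?V = "residue_class ` {x \<in> E. av x = 1}"
  \<comment> \<open>This is squaring on classes, defined through an arbitrary representative; the
    next claim shows that the choice does not matter.\<close>
  define g where "g V = residue_class ((SOME x. x \<in> V)\<^sup>2)" for V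
  have g: "g (residue_class u) = residue_class (u\<^sup>2)" if u: "u \<in> E" "av u = 1" for u
  proof -
    define s where "s = (SOME x. x \<in> residue_class u)"
    have "u \<in> residue_class u" using u by (simp add: residue_class_def)
    then have "s \<in> residue_class u" unfolding s_def by (rule someI)
    then have s: "s \<in> E" "av (s - u) < 1" by (auto simp: residue_class_def)
    have "av s = 1" using av_close[of s u] s u by simp
    then have "av (s + u) \<le> 1" using av_add_le[of s u] u by simp
    moreover have "s\<^sup>2 - u\<^sup>2 = (s - u) * (s + u)" by (simp add: power2_eq_square algebra_simps)
    ultimately have "av (s\<^sup>2 - u\<^sup>2) < 1"
      using s(2) mult_le_cancel_left1[of "av (s - u)" "av (s + u)"] mult_left_mono[of "av (s + u)" 1 "av (s - u)"]
      by simp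
    then show ?thesis
      using residue_class_eq_iff[of "s\<^sup>2" "u\<^sup>2"] s(1) by (simp add: g_def s_def)
  qed
  have "g (residue_class 1) = g (residue_class (- 1))"
    using g[of 1] g[of "- 1"] by simp
  moreover have "residue_class 1 \<noteq> residue_class (- 1)"
    using residue_class_eq_iff[of 1 "- 1"] by simp
  moreover have "residue_class 1 \<in> ?V" "residue_class (- 1) \<in> ?V"
    by auto
  ultimately have noninj: "\<not> inj_on g ?V"
    using inj_onD[of g ?V "residue_class 1" "residue_class (- 1)"] by blast
  have "g ` ?V \<noteq> ?V"
  proof
    assume eq: "g ` ?V = ?V"
    have "inj_on g ?V"
      by (rule eq_card_imp_inj_on[OF finite_unit_classes]) (simp only: eq)
    with noninj show False by contradiction
  qed
  moreover have "g ` ?V \<subseteq> ?V"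
  proof (rule image_subsetI)
    fix V assume "V \<in> ?V"
    then obtain u where "u \<in> E" "av u = 1" "V = residue_class u" by blast
    then show "g V \<in> ?V" using g[of u] by simp
  qed
  ultimately obtain v where v: "v \<in> E" "av v = 1" "residue_class v \<notin> g ` ?V"
    by auto
  have "\<not> av (v - u\<^sup>2) < 1" if u: "u \<in> E" "av u = 1" for u
  proof
    assume "av (v - u\<^sup>2) < 1"
    then have "residue_class v = g (residue_class u)"
      using residue_class_eq_iff v(1) g[OF u] by simp
    then show False using v(3) u by blast
  qed
  then show ?thesis using v by blast
qed

text \<open>Norms of units are squares modulo the maximal ideal, because \<open>u + w\<pi>\<close> has norm
  \<open>u\<^sup>2 - w\<^sup>2\<pi>\<^sup>2\<close>.\<close>

lemma nonnorm_unit: "\<exists>v\<in>E. av v = 1 \<and> \<eta> v = - 1"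
proof -
  obtain v where v: "v \<in> E" "av v = 1" "\<And>u. u \<in> E \<Longrightarrow> av u = 1 \<Longrightarrow> \<not> av (v - u\<^sup>2) < 1"
    using nonsquare_unit by blast
  have "v \<noteq> nm cj x" for x
  proof
    assume eq: "v = nm cj x"
    obtain u w where uw: "u \<in> E" "w \<in> E" "x = u + w * \<pi>" using decomp by blast
    have "(av x)\<^sup>2 = 1" using v(2) eq by simp
    then have "av x = 1" by (metis av_nonneg abs_of_nonneg abs_square_eq_1)
    then have mx: "max (av u) (av (w * \<pi>)) = 1" using av_decomp uw by simp
    \<comment> \<open>Parity of valuations again: the \<open>\<pi>\<close>-part of a unit is not a
      unit, so \<open>u\<close> must be one.\<close>
    have "av (w * \<pi>) \<noteq> 1" using av_E_neq[of 1 w] uw by (cases "w = 0") auto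
    then have "av u = 1" "av (w * \<pi>) < 1" using mx by (auto simp: max_def split: if_splits)
    moreover have "v - u\<^sup>2 = - ((w * \<pi>) * (w * \<pi>))"
      using uw by (simp add: eq nm_def power2_eq_square algebra_simps)
    then have "av (v - u\<^sup>2) = (av (w * \<pi>))\<^sup>2"
      by (simp only: av_minus av_mult power2_eq_square)
    ultimately show False using v(3)[of u] uw(1) by (simp only: power_less_one_iff av_nonneg) simp
  qed
  then show ?thesis
    using v by (intro bexI[of _ v]) (auto simp: quad_char_def)
qed

subsection \<open>Multiplicative integrals over the base field\<close>

lemma pi2: "0 < (av \<pi>)\<^sup>2" "(av \<pi>)\<^sup>2 < 1"
  using av_pi by (auto simp: power_less_one_iff)

text \<open>All uniformizers of \<open>E\<close> share one absolute value, and its powers are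
  distinct, so the definite description in \<open>valuation\<close> has exactly one
  solution.\<close>

lemma nabs_powi:
  assumes "x \<noteq> 0" "av x = (av \<pi>)\<^sup>2 powi k"
  shows "nab x = real (residue_card E) powi (- k)"
proof -
  have av_unif: "av t = (av \<pi>)\<^sup>2" if "is_uniformizer E t" for t
    using that unif_E unfolding is_uniformizer_def by (metis av_power order_antisym)
  have "valuation E x = k"
    unfolding valuation_def
  proof (rule the_equality)
    show "\<exists>t. is_uniformizer E t \<and> av x = av t powi k"
      using unif_E assms by (intro exI[of _ "\<pi>\<^sup>2"]) simp
    fix j assume "\<exists>t. is_uniformizer E t \<and> av x = av t powi j"
    then have "(av \<pi>)\<^sup>2 powi j = (av \<pi>)\<^sup>2 powi k"
      using av_unif assms(2) by metis
    then show "j = k"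
      using pi2 by (metis linorder_less_linear power_int_strict_decreasing less_irrefl)
  qed
  then show ?thesis
    using assms(1) by (simp add: nabs_def)
qed

lemma nab_pos [simp]: "x \<in> E \<Longrightarrow> x \<noteq> 0 \<Longrightarrow> nab x > 0"
  using av_E_even[of x] nabs_powi[of x] residue_card_pos by auto

lemma nab_mult: 
  assumes "x \<in> E" "x \<noteq> 0" "y \<in> E" "y \<noteq> 0"
  shows "nab (x * y) = nab x * nab y"
proof -
  obtain j k where jk: "av x = (av \<pi>)\<^sup>2 powi j" "av y = (av \<pi>)\<^sup>2 powi k"
    using av_E_even assms by meson
  have "av (x * y) = (av \<pi>)\<^sup>2 powi (j + k)"
    using pi2 by (simp add: jk power_int_add)
  then show ?thesis
    using assms jk residue_card_pos nabs_powi[of x j] nabs_powi[of y k] nabs_powi[of "x * y" "j + k"]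
    by (simp add: power_int_add mult.commute flip: power_int_add)
qed

lemma nab_1 [simp]: "nab 1 = 1"
  using nab_mult[of 1 1] nab_pos[OF E_closed(2) one_neq_zero] by (simp del: nab_pos)

lemma nab_inverse:
  assumes "x \<in> E" "x \<noteq> 0"
  shows "nab (inverse x) = inverse (nab x)"
proof -
  have "nab x * nab (inverse x) = 1"
    using nab_mult[of x "inverse x"] assms by simp
  then show ?thesis by (simp add: inverse_unique)
qed

lemma nab_cong: "x \<in> E \<Longrightarrow> x \<noteq> 0 \<Longrightarrow> y \<noteq> 0 \<Longrightarrow> av x = av y \<Longrightarrow> nab x = nab y"
  using av_E_even[of x] nabs_powi[of x] nabs_powi[of y] by metis

text \<open>The value group is discrete: exponents of \<open>(av \<pi>)\<^sup>2\<close> are squeezed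
  between two logarithms. As this base is below 1, the outer radius bounds them from below.\<close>

lemma finite_shell:
  assumes "r > 0"
  shows "finite (av ` {h \<in> E - {0}. r \<le> av h \<and> av h \<le> R})"
proof -
  let ?t = "(av \<pi>)\<^sup>2"
  let ?K = "{\<lfloor>log ?t R\<rfloor>..\<lceil>log ?t r\<rceil>}"
  have "av ` {h \<in> E - {0}. r \<le> av h \<and> av h \<le> R} \<subseteq> (\<lambda>k. ?t powi k) ` ?K"
  proof (rule image_subsetI)
    fix h assume h: "h \<in> {h \<in> E - {0}. r \<le> av h \<and> av h \<le> R}"
    then obtain k where k: "av h = ?t powi k" using av_E_even by auto
    have "log ?t (av h) = real_of_int k"
    proof -
      have "?t \<noteq> 1" using pi2 by linarith
      moreover have "?t powr real_of_int k = ?t powi k"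
        using pi2 by (intro powr_real_of_int') auto
      ultimately show ?thesis
        using log_powr_cancel[OF pi2(1), of "real_of_int k"] k by simp
    qed
    moreover have "ln r \<le> ln (av h)" "ln (av h) \<le> ln R" "ln ?t \<le> 0"
      using h assms pi2 by auto
    then have "log ?t (av h) \<le> log ?t r" "log ?t R \<le> log ?t (av h)"
      unfolding log_def by (auto intro: divide_right_mono_neg)
    ultimately have "real_of_int k \<le> log ?t r" "log ?t R \<le> real_of_int k"
      by simp_all
    then have "k \<in> ?K"
      by (simp only: atLeastAtMost_iff) linarith
    then show "av h \<in> (\<lambda>k. ?t powi k) ` ?K" using k by blast
  qed
  then show ?thesis by (rule finite_subset) simp
qed

text \<open>A shell is a finite union of level sets, each a translate of the units and hence of
  volume 1.\<close>

lemma emeasure_shell: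
  assumes "r > 0"
  shows "emeasure \<mu> {h \<in> E - {0}. r \<le> av h \<and> av h \<le> R} < \<infinity>"
proof -
  let ?A = "av ` {h \<in> E - {0}. r \<le> av h \<and> av h \<le> R}"
  have lev: "{h \<in> E - {0}. av h = a} \<in> sets \<mu>" for a
    by (rule loc_const_sets[OF loc_const_av])
  have "emeasure \<mu> {h \<in> E - {0}. r \<le> av h \<and> av h \<le> R} \<le> emeasure \<mu> (\<Union>a\<in>?A. {h \<in> E - {0}. av h = a})"
    using lev finite_shell[OF assms] by (intro emeasure_mono sets.finite_UN) auto
  also have "\<dots> \<le> (\<Sum>a\<in>?A. emeasure \<mu> {h \<in> E - {0}. av h = a})"
    using lev finite_shell[OF assms] by (intro emeasure_subadditive_finite) auto
  also have "\<dots> = (\<Sum>a\<in>?A. 1)"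
  proof (rule sum.cong[OF refl])
    fix a assume "a \<in> ?A"
    then obtain c where "c \<in> E" "c \<noteq> 0" "a = av c" by blast
    then show "emeasure \<mu> {h \<in> E - {0}. av h = a} = 1" using emeasure_level by blast
  qed
  also have "\<dots> < \<infinity>"
    by (simp add: of_nat_less_top)
  finally show ?thesis .
qed

text \<open>These play the role of smooth compactly supported functions on the multiplicative group.
  Boundedness and a support between two positive radii give integrability at once, since shells have
  finite volume.\<close>

definition shell_fun :: "('a \<Rightarrow> complex) \<Rightarrow> bool" where
  "shell_fun f \<longleftrightarrow> loc_const f \<and> (\<exists>B. \<forall>h\<in>E - {0}. norm (f h) \<le> B) \<and>
     (\<exists>r>0. \<exists>R. \<forall>h\<in>E - {0}. f h \<noteq> 0 \<longrightarrow> r \<le> av h \<and> av h \<le> R)"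

text \<open>A zeta integral in the style of Tate, for the character \<open>\<eta>\<close> twisted by
  a complex power of \<open>nab\<close>.\<close>

definition mellin :: "('a \<Rightarrow> complex) \<Rightarrow> complex \<Rightarrow> complex" where
  "mellin f s = (\<integral>h. f h * \<eta> h * (complex_of_real (nab h) powr s) \<partial>\<mu>)"

lemma shell_scale:
  assumes f: "shell_fun f" and c: "c \<in> E" "c \<noteq> 0"
  shows "shell_fun (\<lambda>h. f (c * h))"
proof -
  obtain B r R where *: "\<And>h. h \<in> E - {0} \<Longrightarrow> norm (f h) \<le> B" "r > 0"
    "\<And>h. h \<in> E - {0} \<Longrightarrow> f h \<noteq> 0 \<Longrightarrow> r \<le> av h \<and> av h \<le> R"
    using f unfolding shell_fun_def by blast
  have "r / av c \<le> av h \<and> av h \<le> R / av c" if "h \<in> E - {0}" "f (c * h) \<noteq> 0" for h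
    using *(3)[of "c * h"] that c by (simp add: field_simps)
  moreover have "norm (f (c * h)) \<le> B" if "h \<in> E - {0}" for h
    using *(1)[of "c * h"] that c by simp
  moreover have "r / av c > 0" using *(2) c by simp
  moreover have "loc_const (\<lambda>h. f (c * h))"
    using f c by (simp add: shell_fun_def loc_const_scale)
  ultimately show ?thesis
    unfolding shell_fun_def by blast
qed

text \<open>On a shell \<open>nab\<close> takes finitely many values, so grouping the integrand by
  the value \<open>v\<close> turns the integral into a finite exponential sum in \<open>s\<close>,
  which can be differentiated term by term.\<close>

lemma mellin_expand:
  assumes f: "shell_fun f"
  obtains V a where "finite V" "\<And>v. v \<in> V \<Longrightarrow> v > (0::real)"
    "\<And>s. integrable \<mu> (\<lambda>h. f h * \<eta> h * (complex_of_real (nab h) powr s))"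
    "\<And>s. mellin f s = (\<Sum>v\<in>V. complex_of_real v powr s * a v)"
proof -
  obtain B r R where *: "\<And>h. h \<in> E - {0} \<Longrightarrow> norm (f h) \<le> B" "r > 0"
    "\<And>h. h \<in> E - {0} \<Longrightarrow> f h \<noteq> 0 \<Longrightarrow> r \<le> av h \<and> av h \<le> R"
    and lc: "loc_const f"
    using f unfolding shell_fun_def by blast
  define A where "A = av ` {h \<in> E - {0}. r \<le> av h \<and> av h \<le> R}"
  have finA: "finite A" unfolding A_def by (rule finite_shell[OF *(2)])
  \<comment> \<open>\<open>N\<close> reads off \<open>nab\<close> from \<open>av\<close> alone,
    through an arbitrary element of the given absolute value.\<close>
  define N where "N b = nab (SOME h. h \<in> E - {0} \<and> av h = b)" for b
  have N: "N (av h) = nab h" if "h \<in> E - {0}" for h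
  proof -
    have "(SOME x. x \<in> E - {0} \<and> av x = av h) \<in> E - {0} \<and> av (SOME x. x \<in> E - {0} \<and> av x = av h) = av h"
      by (rule someI[of "\<lambda>x. x \<in> E - {0} \<and> av x = av h" h]) (use that in simp)
    then show ?thesis unfolding N_def using that by (intro nab_cong) auto
  qed
  define V where "V = N ` A"
  have finV: "finite V" using finA by (simp add: V_def)
  have Vpos: "v > 0" if "v \<in> V" for v
    using that N by (auto simp: V_def A_def)
  define g where "g v h = f h * \<eta> h * (if N (av h) = v then 1 else 0)" for v h
  have int: "integrable \<mu> (g v)" for v
  proof (rule integrableI_bounded_set[where A = "{h \<in> E - {0}. r \<le> av h \<and> av h \<le> R}" and B = B])
    show "{h \<in> E - {0}. r \<le> av h \<and> av h \<le> R} \<in> sets \<mu>"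
      by (rule loc_const_sets[OF loc_const_av])
    have "(\<lambda>h. if N (av h) = v then 1 else 0 :: complex) \<in> borel_measurable \<mu>"
      by (rule loc_const_measurable[OF loc_const_av])
    moreover have "f \<in> borel_measurable \<mu>"
      using lc by (rule loc_const_measurable)
    ultimately show "g v \<in> borel_measurable \<mu>"
      unfolding g_def by measurable
    show "emeasure \<mu> {h \<in> E - {0}. r \<le> av h \<and> av h \<le> R} < \<infinity>"
      by (rule emeasure_shell[OF *(2)])
    have B: "norm (f h) \<le> B \<and> B \<ge> 0" if "h \<in> E - {0}" for h
      using *(1)[OF that] norm_ge_zero order_trans by blast
    show "AE h in \<mu>. h \<in> {h \<in> E - {0}. r \<le> av h \<and> av h \<le> R} \<longrightarrow> norm (g v h) \<le> B"
      using B by (intro AE_I2) (auto simp: g_def norm_mult)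
    show "AE h in \<mu>. h \<notin> {h \<in> E - {0}. r \<le> av h \<and> av h \<le> R} \<longrightarrow> g v h = 0"
      using *(3) by (intro AE_I2) (auto simp: g_def)
  qed
  have eq: "f h * \<eta> h * (complex_of_real (nab h) powr s) = (\<Sum>v\<in>V. complex_of_real v powr s * g v h)"
    if h: "h \<in> space \<mu>" for h s
  proof (cases "f h = 0")
    case False
    then have V: "nab h \<in> V" and Nh: "N (av h) = nab h"
      using *(3) N h by (auto simp: V_def A_def image_iff intro!: bexI[of _ h]) 
    have "(\<Sum>v\<in>V. complex_of_real v powr s * g v h) =
        (\<Sum>v\<in>V. if nab h = v then complex_of_real v powr s * (f h * \<eta> h) else 0)"
      by (intro sum.cong refl) (auto simp: g_def Nh)
    also have "\<dots> = complex_of_real (nab h) powr s * (f h * \<eta> h)"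
      using V finV by simp
    finally show ?thesis by (simp add: mult.commute)
  qed (simp add: g_def)
  have int': "integrable \<mu> (\<lambda>h. f h * \<eta> h * (complex_of_real (nab h) powr s))" for s
    by (subst Bochner_Integration.integrable_cong[OF refl eq]) (auto intro!: int)
  have exp: "mellin f s = (\<Sum>v\<in>V. complex_of_real v powr s * integral\<^sup>L \<mu> (g v))" for s
    unfolding mellin_def by (subst Bochner_Integration.integral_cong[OF refl eq]) (auto simp: int)
  show ?thesis
    by (rule that[OF finV Vpos int' exp])
qed

lemma mellin_differentiable:
  assumes "shell_fun f"
  shows "\<exists>D. (mellin f has_field_derivative D) (at 0)"
proof -
  obtain V a where V: "finite V" "\<And>v. v \<in> V \<Longrightarrow> v > (0::real)"
    "\<And>s. mellin f s = (\<Sum>v\<in>V. complex_of_real v powr s * a v)"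
    using mellin_expand[OF assms] by metis
  have "mellin f = (\<lambda>s. \<Sum>v\<in>V. complex_of_real v powr s * a v)"
    using V(3) by blast
  moreover have "((\<lambda>s. \<Sum>v\<in>V. complex_of_real v powr s * a v) has_field_derivative
      (\<Sum>v\<in>V. Ln (complex_of_real v) * complex_of_real v powr 0 * a v)) (at 0)"
    using V(2) by (intro DERIV_sum DERIV_cmult_right has_field_derivative_powr_right) force
  ultimately show ?thesis by metis
qed

lemma mellin_add:
  assumes "shell_fun f" "shell_fun g"
  shows "mellin (\<lambda>h. f h + g h) s = mellin f s + mellin g s"
proof -
  have "integrable \<mu> (\<lambda>h. f h * \<eta> h * (complex_of_real (nab h) powr s))"
    "integrable \<mu> (\<lambda>h. g h * \<eta> h * (complex_of_real (nab h) powr s))"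
    using mellin_expand assms by metis+
  then show ?thesis
    by (simp add: mellin_def distrib_right flip: Bochner_Integration.integral_add)
qed

lemma mellin_measurable:
  assumes "shell_fun f"
  shows "(\<lambda>h. f h * \<eta> h * (complex_of_real (nab h) powr s)) \<in> borel_measurable \<mu>"
  by (rule borel_measurable_integrable) (use mellin_expand assms in metis)

text \<open>Invariance applied to the whole integrand expresses \<open>mellin f s\<close> through
  the scaled integral; as \<open>\<eta> c\<close> squares to 1, the relation can be
  inverted.\<close>

lemma mellin_scale:
  assumes f: "shell_fun f" and c: "c \<in> E" "c \<noteq> 0"
  shows "mellin (\<lambda>h. f (c * h)) s = \<eta> c * complex_of_real (nab c) powr (- s) * mellin f s"
proof -
  let ?F = "\<lambda>h. f h * \<eta> h * (complex_of_real (nab h) powr s)"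
  have "?F (c * h) = \<eta> c * complex_of_real (nab c) powr s * (f (c * h) * \<eta> h * (complex_of_real (nab h) powr s))"
    if "h \<in> space \<mu>" for h
    using that c nab_pos[of h] nab_pos[of c]
    by (simp add: eta_mult nab_mult powr_times_real less_imp_le)
  then have "(\<integral>h. ?F (c * h) \<partial>\<mu>) = \<eta> c * complex_of_real (nab c) powr s * mellin (\<lambda>h. f (c * h)) s"
    using Bochner_Integration.integral_cong[OF refl, of \<mu> "\<lambda>h. ?F (c * h)"
        "\<lambda>h. \<eta> c * complex_of_real (nab c) powr s * (f (c * h) * \<eta> h * (complex_of_real (nab h) powr s))"]
    unfolding mellin_def by (simp only: integral_mult_right_zero)
  then have eq: "mellin f s = \<eta> c * complex_of_real (nab c) powr s * mellin (\<lambda>h. f (c * h)) s"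
    using integral_scale[OF c mellin_measurable[OF f, of s]] by (simp add: mellin_def)
  have "\<eta> c * complex_of_real (nab c) powr (- s) * mellin f s =
    (\<eta> c * \<eta> c) * (complex_of_real (nab c) powr (- s) * complex_of_real (nab c) powr s) * mellin (\<lambda>h. f (c * h)) s"
    by (subst eq) (simp only: mult_ac)
  also have "complex_of_real (nab c) powr (- s) * complex_of_real (nab c) powr s = 1"
    using nab_pos[OF c] by (simp flip: powr_add)
  finally show ?thesis by simp
qed

text \<open>Translation by a unit with \<open>\<eta> v = - 1\<close> changes neither a radial
  function nor \<open>nab\<close>, yet flips the sign of the integral.\<close>

lemma mellin_radial:
  assumes f: "shell_fun f" and rad: "\<And>x y. x \<in> E - {0} \<Longrightarrow> y \<in> E - {0} \<Longrightarrow> av x = av y \<Longrightarrow> f x = f y"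
  shows "mellin f s = 0"
proof -
  obtain v where v: "v \<in> E" "av v = 1" "\<eta> v = - 1"
    using nonnorm_unit by blast
  then have v0: "v \<noteq> 0" by auto
  have "nab v = 1" using nab_cong[of v 1] v v0 by simp
  moreover have "mellin (\<lambda>h. f (v * h)) s = mellin f s"
    unfolding mellin_def
  proof (rule Bochner_Integration.integral_cong[OF refl])
    fix h assume "h \<in> space \<mu>"
    then have "f (v * h) = f h" using v v0 by (intro rad) auto
    then show "f (v * h) * \<eta> h * complex_of_real (nab h) powr s = f h * \<eta> h * complex_of_real (nab h) powr s"
      by simp
  qed
  ultimately have "mellin f s = - mellin f s"
    using mellin_scale[OF f v(1) v0, of s] v by simp
  then show ?thesis by simp
qed

end

subsection \<open>Germs of orbital integrals\<close>

lemma mat2_entries [simp]: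
  "mat2 a b c d $ 1 $ 1 = a" "mat2 a b c d $ 1 $ 2 = b"
  "mat2 a b c d $ 2 $ 1 = c" "mat2 a b c d $ 2 $ 2 = d"
  by (auto simp: mat2_def)

lemma mat2_eqI:
  fixes g :: "'a::zero^2^2"
  shows "g $ 1 $ 1 = a \<Longrightarrow> g $ 1 $ 2 = b \<Longrightarrow> g $ 2 $ 1 = c \<Longrightarrow> g $ 2 $ 2 = d \<Longrightarrow> g = mat2 a b c d"
  by (simp add: vec_eq_iff forall_2)

lemma mat2_eq_iff [simp]:
  "mat2 a b c d = mat2 a' b' c' d' \<longleftrightarrow> a = a' \<and> b = b' \<and> c = c' \<and> d = d'"
  by (metis mat2_entries)

lemma mat2_mult:
  "mat2 a b c d ** mat2 a' b' c' d' =
     mat2 (a * a' + b * c') (a * b' + b * d') (c * a' + d * c') (c * b' + d * d' :: 'a::comm_semiring_1)"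
  by (rule mat2_eqI) (simp_all add: matrix_matrix_mult_def sum_2)

lemma dconj_mat2:
  "h \<noteq> 0 \<Longrightarrow> dconj h (mat2 a b c d) = mat2 a (inverse h * b) (c * h) d"
  by (simp add: dconj_def diag2_def mat2_mult)

lemma dist_entry_le:
  fixes g g' :: "'a::metric_space^2^2"
  shows "dist (g $ i $ j) (g' $ i $ j) \<le> dist g g'"
  by (meson dist_vec_nth_le order_trans)

text \<open>The Euclidean distance is at most the sum of the four entrywise distances; hence the
  divisions by 4 further on.\<close>

lemma dist_mat2_less:
  assumes "dist a a' < r" "dist b b' < r" "dist c c' < r" "dist d d' < r"
  shows "dist (mat2 a b c d) (mat2 a' b' c' d') < 4 * r"
proof -
  have row: "dist (x :: 'a ^ 2) y \<le> dist (x $ 1) (y $ 1) + dist (x $ 2) (y $ 2)" for x y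
    unfolding dist_vec_def using L2_set_le_sum[of UNIV "\<lambda>i. dist (x $ i) (y $ i)"] by (simp add: sum_2)
  have "dist (mat2 a b c d) (mat2 a' b' c' d') \<le>
      dist (mat2 a b c d $ 1) (mat2 a' b' c' d' $ 1) + dist (mat2 a b c d $ 2) (mat2 a' b' c' d' $ 2)"
    unfolding dist_vec_def[of "mat2 a b c d"]
    using L2_set_le_sum[of UNIV "\<lambda>i. dist (mat2 a b c d $ i) (mat2 a' b' c' d' $ i)"] by (simp add: sum_2)
  then show ?thesis
    using row[of "mat2 a b c d $ 1" "mat2 a' b' c' d' $ 1"] row[of "mat2 a b c d $ 2" "mat2 a' b' c' d' $ 2"] assms
    by simp
qed

text \<open>The radius is a Lebesgue number for a cover of the compact set by open sets on which
  \<open>f\<close> is constant. If neither point lies in the compact set, both values are 0.\<close>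

lemma Cc_smooth_uniform:
  fixes f :: "'b::metric_space \<Rightarrow> complex"
  assumes "Cc_smooth X f"
  shows "\<exists>e>0. \<forall>x\<in>X. \<forall>y\<in>X. dist x y < e \<longrightarrow> f x = f y"
proof -
  obtain K where K: "compact K" "K \<subseteq> X" "\<And>x. x \<in> X - K \<Longrightarrow> f x = 0"
    using assms unfolding Cc_smooth_def by blast
  let ?G = "{U. open U \<and> (\<exists>c. \<forall>y\<in>U \<inter> X. f y = c)}"
  have "K \<subseteq> \<Union>?G"
  proof
    fix x assume "x \<in> K"
    then obtain U where "open U" "x \<in> U" "\<forall>y\<in>U \<inter> X. f y = f x"
      using K(2) assms unfolding Cc_smooth_def by blast
    then show "x \<in> \<Union>?G" by blast
  qed
  then obtain e where e: "e > 0" "\<And>x. x \<in> K \<Longrightarrow> \<exists>G\<in>?G. ball x e \<subseteq> G"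
    by (rule Heine_Borel_lemma[OF K(1)]) auto
  have near: "f x = f y" if xy: "x \<in> K" "y \<in> X" "dist x y < e" for x y
  proof -
    obtain G c where G: "ball x e \<subseteq> G" "\<And>z. z \<in> G \<inter> X \<Longrightarrow> f z = c"
      using e(2)[OF xy(1)] by blast
    have "x \<in> G \<inter> X" "y \<in> G \<inter> X"
      using G(1) xy K(2) e(1) by auto
    then show ?thesis using G(2) by metis
  qed
  have "f x = f y" if xy: "x \<in> X" "y \<in> X" "dist x y < e" for x y
  proof -
    consider "x \<in> K" | "y \<in> K" | "x \<notin> K" "y \<notin> K" by blast
    then show ?thesis
    proof cases
      case 1
      then show ?thesis using near xy by blast
    next
      case 2
      then have "f y = f x" using xy by (intro near) (auto simp: dist_commute)
      then show ?thesis ..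
    next
      case 3
      then show ?thesis using K(3)[of x] K(3)[of y] xy by simp
    qed
  qed
  then show ?thesis using e(1) by blast
qed

lemma Cc_smooth_bounded:
  fixes f :: "'b::metric_space \<Rightarrow> complex"
  assumes "Cc_smooth X f"
  shows "\<exists>B. \<forall>x\<in>X. norm (f x) \<le> B"
proof -
  obtain K where K: "compact K" "K \<subseteq> X" "\<And>x. x \<in> X - K \<Longrightarrow> f x = 0"
    using assms unfolding Cc_smooth_def by blast
  obtain e where e: "e > 0" "\<And>x y. x \<in> X \<Longrightarrow> y \<in> X \<Longrightarrow> dist x y < e \<Longrightarrow> f x = f y"
    using Cc_smooth_uniform[OF assms] by blast
  have "continuous_on K f"
    unfolding continuous_on_iff
  proof (intro ballI allI impI)
    fix x r assume "x \<in> K" "(0::real) < r"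
    have "\<forall>y\<in>K. dist y x < e \<longrightarrow> dist (f y) (f x) < r"
    proof (intro ballI impI)
      fix y assume "y \<in> K" "dist y x < e"
      then have "f y = f x" using e(2) K(2) \<open>x \<in> K\<close> by blast
      then show "dist (f y) (f x) < r" using \<open>0 < r\<close> by simp
    qed
    then show "\<exists>d>0. \<forall>y\<in>K. dist y x < d \<longrightarrow> dist (f y) (f x) < r"
      using e(1) by blast
  qed
  then have "bounded (f ` K)"
    using K(1) compact_continuous_image compact_imp_bounded by blast
  then obtain B where B: "\<And>x. x \<in> K \<Longrightarrow> norm (f x) \<le> B"
    unfolding bounded_iff by blast
  have "norm (f x) \<le> max B 0" if "x \<in> X" for x
    using B[of x] K(3)[of x] that by (cases "x \<in> K") auto
  then show ?thesis by blast
qed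

lemma Cc_smooth_support:
  fixes f :: "('a::{field_char_0,metric_space})^2^2 \<Rightarrow> complex"
  assumes "Cc_smooth X f"
  shows "\<exists>M>0. \<forall>g\<in>X. f g \<noteq> 0 \<longrightarrow> (\<forall>i j. av (g $ i $ j) \<le> M)"
proof -
  obtain K where K: "compact K" "K \<subseteq> X" "\<And>x. x \<in> X - K \<Longrightarrow> f x = 0"
    using assms unfolding Cc_smooth_def by blast
  obtain M where M: "\<And>g. g \<in> K \<Longrightarrow> dist (0 :: 'a^2^2) g \<le> M"
    using compact_imp_bounded[OF K(1)] unfolding bounded_any_center[where a = 0] by blast
  have "av (g $ i $ j) \<le> max M 1" if "g \<in> X" "f g \<noteq> 0" for g :: "'a^2^2" and i j
  proof -
    have "g \<in> K" using K(3)[of g] that by blast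
    then show ?thesis
      using M[of g] dist_entry_le[of g i j 0] by (simp add: av_def dist_commute)
  qed
  then show ?thesis by (intro exI[of _ "max M 1"]) auto
qed

context orbital_setting
begin

section \<open>The germ expansion\<close>

lemma shell_add:
  assumes "shell_fun f" "shell_fun g"
  shows "shell_fun (\<lambda>h. f h + g h)"
proof -
  obtain B r R where f: "\<And>h. h \<in> E - {0} \<Longrightarrow> norm (f h) \<le> B" "r > 0"
    "\<And>h. h \<in> E - {0} \<Longrightarrow> f h \<noteq> 0 \<Longrightarrow> r \<le> av h \<and> av h \<le> R"
    using assms(1) unfolding shell_fun_def by blast
  obtain B' r' R' where g: "\<And>h. h \<in> E - {0} \<Longrightarrow> norm (g h) \<le> B'" "r' > 0"
    "\<And>h. h \<in> E - {0} \<Longrightarrow> g h \<noteq> 0 \<Longrightarrow> r' \<le> av h \<and> av h \<le> R'"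
    using assms(2) unfolding shell_fun_def by blast
  have "norm (f h + g h) \<le> B + B'" if "h \<in> E - {0}" for h
    using f(1)[OF that] g(1)[OF that] by (rule norm_triangle_mono)
  moreover have "min r r' \<le> av h \<and> av h \<le> max R R'" if "h \<in> E - {0}" "f h + g h \<noteq> 0" for h
    using f(3)[OF that(1)] g(3)[OF that(1)] that(2) by (cases "f h = 0") auto
  moreover have "min r r' > 0" using f(2) g(2) by simp
  moreover have "loc_const f" "loc_const g"
    using assms by (simp_all add: shell_fun_def)
  then have "loc_const (\<lambda>h. f h + g h)"
    by (rule loc_const_combine)
  ultimately show ?thesis
    unfolding shell_fun_def by blast
qed

text \<open>\<open>A\<close> and \<open>B\<close> are determined by the restrictions
  \<open>Q\<close> and \<open>P\<close> of \<open>f\<close> to the lower and upper triangular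
  elements over the diagonal one, hence by degenerate orbits and not by the given one. The scale
  \<open>\<beta>\<close> is unrestricted because a substitution in \<open>h\<close> absorbs it;
  \<open>x\<close> and \<open>y\<close> are multiplicative errors that the uniform local constancy
  of \<open>f\<close> swallows.\<close>

lemma orbital_germ:
  fixes f :: "'a^2^2 \<Rightarrow> complex"
  assumes f: "Cc_smooth X f" and b0: "b0 \<noteq> 0" and c0: "c0 \<noteq> 0"
    and PX: "\<And>x. x \<in> E \<Longrightarrow> mat2 a0 (b0 * x) 0 d0 \<in> X"
    and QX: "\<And>z. z \<in> E \<Longrightarrow> mat2 a0 0 (c0 * z) d0 \<in> X"
  obtains \<rho> A B where "0 < \<rho>" "\<rho> \<le> 1"
    "\<exists>D. (A has_field_derivative D) (at 0)" "\<exists>D. (B has_field_derivative D) (at 0)"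
    "\<And>a d \<beta> \<delta> x y s. \<lbrakk>\<beta> \<in> E - {0}; \<delta> \<in> E - {0}; av (a - a0) < \<rho>; av (d - d0) < \<rho>;
        av x < \<rho>; av y < \<rho>; av \<delta> < \<rho>;
        \<And>h. h \<in> E - {0} \<Longrightarrow> dconj h (mat2 a (b0 * \<beta> * (1 + x)) (c0 * (\<delta> / \<beta>) * (1 + y)) d) \<in> X\<rbrakk>
      \<Longrightarrow> Orb_s E cj \<mu> (mat2 a (b0 * \<beta> * (1 + x)) (c0 * (\<delta> / \<beta>) * (1 + y)) d) f s =
          \<eta> \<beta> * complex_of_real (nab \<beta>) powr s *
            (\<eta> \<delta> * complex_of_real (nab \<delta>) powr (- s) * A s + B s)"
proof -
  obtain e0 where e0: "e0 > 0" "\<And>x y. x \<in> X \<Longrightarrow> y \<in> X \<Longrightarrow> dist x y < e0 \<Longrightarrow> f x = f y"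
    using Cc_smooth_uniform[OF f] by blast
  obtain M where M: "M > 0" "\<And>g i j. g \<in> X \<Longrightarrow> f g \<noteq> 0 \<Longrightarrow> av (g $ i $ j) \<le> M"
    using Cc_smooth_support[OF f] by blast
  obtain Bd where Bd: "\<And>g. g \<in> X \<Longrightarrow> norm (f g) \<le> Bd"
    using Cc_smooth_bounded[OF f] by blast
  define e where "e = e0 / 4"
  have e: "e > 0" using e0 by (simp add: e_def)
  have close: "f (mat2 a b c d) = f (mat2 a' b' c' d')"
    if "mat2 a b c d \<in> X" "mat2 a' b' c' d' \<in> X"
      "av (a - a') < e" "av (b - b') < e" "av (c - c') < e" "av (d - d') < e" for a b c d a' b' c' d'
    using e0(2)[OF that(1,2)] dist_mat2_less[of a a' e b b' c c' d d'] that(3-)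
    by (simp add: dist_av e_def)
  \<comment> \<open>Below \<open>\<epsilon>\<close> a coordinate cannot be told from 0: after
    multiplication by \<open>b0\<close> or \<open>c0\<close> it is still under
    \<open>e\<close>.\<close>
  define \<epsilon> where "\<epsilon> = e / (2 * (av b0 + av c0))"
  have s0: "av b0 > 0" "av c0 > 0" using b0 c0 by auto
  have \<epsilon>: "\<epsilon> > 0" unfolding \<epsilon>_def using e s0 by (intro divide_pos_pos mult_pos_pos add_pos_pos) auto
  have be: "av b0 * \<epsilon> < e" "av c0 * \<epsilon> < e"
  proof -
    have "2 * av b0 / (2 * (av b0 + av c0)) * e < 1 * e" "2 * av c0 / (2 * (av b0 + av c0)) * e < 1 * e"
      using s0 e by (intro mult_strict_right_mono; simp add: divide_less_eq add_pos_pos)+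
    moreover have "av b0 * \<epsilon> \<le> 2 * av b0 / (2 * (av b0 + av c0)) * e"
      "av c0 * \<epsilon> \<le> 2 * av c0 / (2 * (av b0 + av c0)) * e"
      unfolding \<epsilon>_def using s0 e by (simp_all add: divide_simps add_pos_pos)
    ultimately show "av b0 * \<epsilon> < e" "av c0 * \<epsilon> < e" by linarith+
  qed
  \<comment> \<open>Beyond \<open>R\<close> the corresponding entry exceeds the support bound
    \<open>M\<close>, so \<open>f\<close> vanishes.\<close>
  define R where "R = M / av b0 + M / av c0"
  have R: "R > 0" using M(1) s0 by (simp add: R_def add_pos_pos)
  have bR: "av b0 * R \<ge> M" "av c0 * R \<ge> M"
    using M(1) s0 by (auto simp: R_def field_simps)
  \<comment> \<open>The bound 1 keeps \<open>1 + x\<close> and \<open>1 + y\<close> of absolute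
    value 1, \<open>e\<close> controls the diagonal, \<open>\<epsilon>\<^sup>2\<close> prevents both
    coordinates from exceeding \<open>\<epsilon>\<close>, and the last term bounds the error of
    dropping \<open>1 + x\<close> or \<open>1 + y\<close> at coordinates of size up to
    \<open>R\<close>.\<close>
  define \<rho> where "\<rho> = min (min 1 e) (min (\<epsilon>\<^sup>2) (e / ((av b0 + av c0) * R + 1)))"
  have bRp: "(av b0 + av c0) * R > 0" using R s0 by (simp add: add_pos_pos)
  have \<rho>: "\<rho> > 0" "\<rho> \<le> 1" "\<rho> \<le> e" "\<rho> \<le> \<epsilon>\<^sup>2" "\<rho> \<le> e / ((av b0 + av c0) * R + 1)"
    using e \<epsilon> bRp by (auto simp: \<rho>_def)
  have "(av b0 + av c0) * R * \<rho> < e"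
  proof -
    have "((av b0 + av c0) * R + 1) * \<rho> \<le> e"
      using \<rho>(5) bRp by (simp add: pos_le_divide_eq mult.commute)
    then show ?thesis using \<rho>(1) by (simp add: algebra_simps)
  qed
  then have "av b0 * R * \<rho> + av c0 * R * \<rho> < e"
    by (simp only: distrib_right)
  moreover have "av b0 * R * \<rho> > 0" "av c0 * R * \<rho> > 0"
    using R \<rho>(1) s0 by (auto intro!: mult_pos_pos)
  ultimately have bR\<rho>: "av b0 * R * \<rho> < e" "av c0 * R * \<rho> < e"
    by linarith+
  define P where "P x = f (mat2 a0 (b0 * x) 0 d0)" for x
  define Q where "Q z = f (mat2 a0 0 (c0 * z) d0)" for z
  have P_close: "P x = P y" if "x \<in> E" "y \<in> E" "av (x - y) \<le> \<epsilon>" for x y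
  proof -
    have "av (b0 * x - b0 * y) = av b0 * av (x - y)" by (simp only: right_diff_distrib[symmetric] av_mult)
    also have "\<dots> \<le> av b0 * \<epsilon>" using that by (intro mult_left_mono) auto
    finally show ?thesis
      unfolding P_def using that be e by (intro close PX) auto
  qed
  have Q_close: "Q x = Q y" if "x \<in> E" "y \<in> E" "av (x - y) \<le> \<epsilon>" for x y
  proof -
    have "av (c0 * x - c0 * y) = av c0 * av (x - y)" by (simp only: right_diff_distrib[symmetric] av_mult)
    also have "\<dots> \<le> av c0 * \<epsilon>" using that by (intro mult_left_mono) auto
    finally show ?thesis
      unfolding Q_def using that be e by (intro close QX) auto
  qed
  have bM: "M < av b0 * av x" if "R < av x" for x :: 'a
    using bR(1) mult_strict_left_mono[OF that s0(1)] by linarith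
  have cM: "M < av c0 * av x" if "R < av x" for x :: 'a
    using bR(2) mult_strict_left_mono[OF that s0(2)] by linarith
  have P_supp: "P x = 0" if "x \<in> E" "R < av x" for x
    using M(2)[OF PX[OF that(1)], of 1 2] bM[OF that(2)] by (force simp: P_def)
  have Q_supp: "Q x = 0" if "x \<in> E" "R < av x" for x
    using M(2)[OF QX[OF that(1)], of 2 1] cM[OF that(2)] by (force simp: Q_def)
  have PQ0: "P 0 = Q 0" by (simp add: P_def Q_def)
  have P_bd: "norm (P x) \<le> Bd" and Q_bd: "norm (Q x) \<le> Bd" if "x \<in> E" for x
    using Bd PX QX that by (auto simp: P_def Q_def)
  have Bd0: "Bd \<ge> 0" using P_bd[of 0] norm_ge_zero order_trans by (metis E_closed(1))
  have lcP: "loc_const P"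
  proof (rule loc_constI)
    fix x assume x: "x \<in> E" "x \<noteq> 0"
    have "\<forall>y\<in>E. y \<noteq> 0 \<longrightarrow> av (y - x) < \<epsilon> \<longrightarrow> P y = P x" using P_close x(1) by force
    then show "\<exists>d>0. \<forall>y\<in>E. y \<noteq> 0 \<longrightarrow> av (y - x) < d \<longrightarrow> P y = P x" using \<epsilon> by blast
  qed
  have lcQ: "loc_const Q"
  proof (rule loc_constI)
    fix x assume x: "x \<in> E" "x \<noteq> 0"
    have "\<forall>y\<in>E. y \<noteq> 0 \<longrightarrow> av (y - x) < \<epsilon> \<longrightarrow> Q y = Q x" using Q_close x(1) by force
    then show "\<exists>d>0. \<forall>y\<in>E. y \<noteq> 0 \<longrightarrow> av (y - x) < d \<longrightarrow> Q y = Q x" using \<epsilon> by blast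
  qed
  \<comment> \<open>Cutting \<open>Q\<close> and \<open>P\<close> off near 0 turns them into shell
    functions. \<open>FB\<close> inverts its argument because conjugation divides the upper right
    entry by \<open>h\<close>.\<close>
  define FA where "FA h = (if av h > \<epsilon> then Q h else 0)" for h
  define FB where "FB h = (if av (inverse h) > \<epsilon> then P (inverse h) else 0)" for h
  have shA: "shell_fun FA"
    unfolding shell_fun_def
  proof (intro conjI)
    show "loc_const FA"
      unfolding FA_def by (rule loc_const_combine[OF loc_const_av[of "\<lambda>r. r > \<epsilon>"] lcQ, of "\<lambda>c z. if c then z else 0"])
    show "\<exists>B. \<forall>h\<in>E - {0}. norm (FA h) \<le> B"
      using Q_bd Bd0 by (intro exI[of _ Bd]) (auto simp: FA_def)
    have "\<forall>h\<in>E - {0}. FA h \<noteq> 0 \<longrightarrow> \<epsilon> \<le> av h \<and> av h \<le> R"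
      using Q_supp by (force simp: FA_def split: if_splits)
    then show "\<exists>r>0. \<exists>R. \<forall>h\<in>E - {0}. FA h \<noteq> 0 \<longrightarrow> r \<le> av h \<and> av h \<le> R"
      using \<epsilon> by blast
  qed
  have shB: "shell_fun FB"
    unfolding shell_fun_def
  proof (intro conjI)
    show "loc_const FB"
      unfolding FB_def
      by (rule loc_const_inverse, rule loc_const_combine[OF loc_const_av[of "\<lambda>r. r > \<epsilon>"] lcP, of "\<lambda>c z. if c then z else 0"])
    show "\<exists>B. \<forall>h\<in>E - {0}. norm (FB h) \<le> B"
      using P_bd Bd0 by (intro exI[of _ Bd]) (auto simp: FB_def)
    have "inverse R \<le> av h \<and> av h \<le> inverse \<epsilon>" if h: "h \<in> E - {0}" "FB h \<noteq> 0" for h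
    proof -
      have "\<epsilon> < inverse (av h)" "inverse (av h) \<le> R"
        using h P_supp[of "inverse h"] by (auto simp: FB_def not_less[symmetric] split: if_splits)
      moreover have "av h > 0" using h by simp
      ultimately show ?thesis
        using le_imp_inverse_le[of "inverse (av h)" R] less_imp_inverse_less[of \<epsilon> "inverse (av h)"] \<epsilon> by simp
    qed
    then show "\<exists>r>0. \<exists>R. \<forall>h\<in>E - {0}. FB h \<noteq> 0 \<longrightarrow> r \<le> av h \<and> av h \<le> R"
      using R positive_imp_inverse_positive by blast
  qed
  show thesis
  proof (rule that[OF \<rho>(1,2) mellin_differentiable[OF shA] mellin_differentiable[OF shB]])
    fix a d \<beta> \<delta> x y :: 'a and s :: complex
    assume \<beta>: "\<beta> \<in> E - {0}" and \<delta>: "\<delta> \<in> E - {0}" and ad: "av (a - a0) < \<rho>" "av (d - d0) < \<rho>"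
      and xy: "av x < \<rho>" "av y < \<rho>" and \<delta>\<rho>: "av \<delta> < \<rho>"
    let ?g = "mat2 a (b0 * \<beta> * (1 + x)) (c0 * (\<delta> / \<beta>) * (1 + y)) d"
    assume gX: "\<And>h. h \<in> E - {0} \<Longrightarrow> dconj h ?g \<in> X"
    \<comment> \<open>The middle range, where both coordinates look like 0 and \<open>f\<close> has
      the common value \<open>P 0 = Q 0\<close>.\<close>
    define C where "C h = (if av (\<delta> / \<beta>) * av h \<le> \<epsilon> \<and> av \<beta> / av h \<le> \<epsilon> then P 0 else 0)" for h :: 'a
    have av1: "av (1 + x) = 1" "av (1 + y) = 1"
      using av_add_eq[of x 1] av_add_eq[of y 1] xy \<rho>(2) by (auto simp: add.commute)
    have split: "f (dconj h ?g) = FA ((\<delta> / \<beta>) * h) + FB (inverse \<beta> * h) + C h" if h: "h \<in> E - {0}" for h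
    proof -
      define x' where "x' = inverse h * \<beta>"
      define z where "z = (\<delta> / \<beta>) * h"
      have x'z: "x' \<in> E" "z \<in> E" "av x' * av z = av \<delta>"
        using h \<beta> \<delta> by (auto simp: x'_def z_def field_simps)
      have form: "dconj h ?g = mat2 a (b0 * x' * (1 + x)) (c0 * z * (1 + y)) d"
        using h by (simp add: dconj_mat2 x'_def z_def mult_ac)
      have mX: "mat2 a (b0 * x' * (1 + x)) (c0 * z * (1 + y)) d \<in> X"
        using gX[OF h] form by simp
      \<comment> \<open>A negligible \<open>z\<close> lets the lower left entry be replaced by 0.
        For large \<open>x'\<close> both sides vanish, as \<open>1 + x\<close> does not change the
        size of the entry; otherwise the factor costs less than \<open>e\<close>.\<close>
      have fP: "f (dconj h ?g) = P x'" if z: "av z \<le> \<epsilon>"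
      proof (cases "R < av x'")
        case True
        then have "f (dconj h ?g) = 0"
          using M(2)[OF mX, of 1 2] bM[OF True] av1 unfolding form by (force simp del: distrib_left)
        then show ?thesis using P_supp[OF x'z(1) True] by simp
      next
        case False
        have "b0 * x' * (1 + x) - b0 * x' = b0 * x' * x" by (simp add: algebra_simps)
        then have "av (b0 * x' * (1 + x) - b0 * x') = av b0 * av x' * av x" by simp
        also have "\<dots> \<le> av b0 * R * \<rho>" using False xy R by (intro mult_mono) auto
        finally have "av (b0 * x' * (1 + x) - b0 * x') < e" using bR\<rho> by simp
        moreover have "av (c0 * z * (1 + y) - 0) \<le> av c0 * \<epsilon>"
          using z av1 by (simp add: mult_left_mono)
        then have "av (c0 * z * (1 + y) - 0) < e" using be by linarith
        ultimately show ?thesis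
          unfolding form P_def using ad \<rho>(3) by (intro close mX PX x'z) auto
      qed
      have fQ: "f (dconj h ?g) = Q z" if x': "av x' \<le> \<epsilon>"
      proof (cases "R < av z")
        case True
        then have "f (dconj h ?g) = 0"
          using M(2)[OF mX, of 2 1] cM[OF True] av1 unfolding form by (force simp del: distrib_left)
        then show ?thesis using Q_supp[OF x'z(2) True] by simp
      next
        case False
        have "c0 * z * (1 + y) - c0 * z = c0 * z * y" by (simp add: algebra_simps)
        then have "av (c0 * z * (1 + y) - c0 * z) = av c0 * av z * av y" by simp
        also have "\<dots> \<le> av c0 * R * \<rho>" using False xy R by (intro mult_mono) auto
        finally have "av (c0 * z * (1 + y) - c0 * z) < e" using bR\<rho> by simp
        moreover have "av (b0 * x' * (1 + x) - 0) \<le> av b0 * \<epsilon>"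
          using x' av1 by (simp add: mult_left_mono)
        then have "av (b0 * x' * (1 + x) - 0) < e" using be by linarith
        ultimately show ?thesis
          unfolding form Q_def using ad \<rho>(3) by (intro close mX QX x'z) auto
      qed
      have FAz: "FA ((\<delta> / \<beta>) * h) = (if av z > \<epsilon> then Q z else 0)"
        by (simp add: FA_def z_def)
      have "inverse (inverse \<beta> * h) = x'" using h \<beta> by (simp add: x'_def field_simps)
      then have FBx: "FB (inverse \<beta> * h) = (if av x' > \<epsilon> then P x' else 0)"
        by (simp only: FB_def)
      have "av x' = av \<beta> / av h" "av z = av (\<delta> / \<beta>) * av h"
        by (simp_all add: x'_def z_def divide_inverse)
      then have Ch: "C h = (if av z \<le> \<epsilon> \<and> av x' \<le> \<epsilon> then P 0 else 0)"
        by (simp only: C_def)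
      \<comment> \<open>The product of the two coordinates has the size of \<open>\<delta>\<close>,
        which is below \<open>\<epsilon>\<^sup>2\<close>.\<close>
      have not_both: "\<not> (\<epsilon> < av z \<and> \<epsilon> < av x')"
      proof
        assume "\<epsilon> < av z \<and> \<epsilon> < av x'"
        then have "\<epsilon> * \<epsilon> < av x' * av z" using \<epsilon> by (intro mult_strict_mono) auto
        then show False using x'z(3) \<delta>\<rho> \<rho>(4) by (simp add: power2_eq_square)
      qed
      consider "\<epsilon> < av z" "av x' \<le> \<epsilon>" | "av z \<le> \<epsilon>" "\<epsilon> < av x'" | "av z \<le> \<epsilon>" "av x' \<le> \<epsilon>"
        using not_both unfolding not_less[symmetric] by blast
      then show ?thesis
      proof cases
        case 1
        then show ?thesis unfolding FAz FBx Ch fQ[OF 1(2)] by simp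
      next
        case 2
        then show ?thesis unfolding FAz FBx Ch fP[OF 2(1)] by simp
      next
        case 3
        then have "P x' = P 0" using P_close[OF x'z(1) E_closed(1)] by simp
        then show ?thesis unfolding FAz FBx Ch fP[OF 3(1)] using 3 by simp
      qed
    qed
    have shC: "shell_fun C"
      unfolding shell_fun_def
    proof (intro conjI)
      show "loc_const C"
        unfolding C_def by (rule loc_const_av[of "\<lambda>r. if av (\<delta> / \<beta>) * r \<le> \<epsilon> \<and> av \<beta> / r \<le> \<epsilon> then P 0 else 0"])
      show "\<exists>B. \<forall>h\<in>E - {0}. norm (C h) \<le> B"
        by (intro exI[of _ "norm (P 0)"]) (auto simp: C_def)
      have "av \<beta> / \<epsilon> \<le> av h \<and> av h \<le> \<epsilon> / av (\<delta> / \<beta>)" if h: "h \<in> E - {0}" "C h \<noteq> 0" for h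
      proof -
        have "av (\<delta> / \<beta>) * av h \<le> \<epsilon>" "av \<beta> / av h \<le> \<epsilon>"
          using h by (auto simp: C_def split: if_splits)
        moreover have "av h > 0" "av (\<delta> / \<beta>) > 0" using h \<beta> \<delta> by auto
        ultimately show ?thesis using \<epsilon> by (auto simp: pos_le_divide_eq pos_divide_le_eq mult.commute simp del: av_divide)
      qed
      moreover have "av \<beta> / \<epsilon> > 0" using \<epsilon> \<beta> by simp
      ultimately show "\<exists>r>0. \<exists>R. \<forall>h\<in>E - {0}. C h \<noteq> 0 \<longrightarrow> r \<le> av h \<and> av h \<le> R"
        by blast
    qed
    have C0: "mellin C s = 0"
      by (rule mellin_radial[OF shC]) (simp add: C_def)
    have \<delta>\<beta>: "\<delta> / \<beta> \<in> E" "\<delta> / \<beta> \<noteq> 0" "inverse \<beta> \<in> E" "inverse \<beta> \<noteq> 0" using \<beta> \<delta> by auto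
    have sh1: "shell_fun (\<lambda>h. FA ((\<delta> / \<beta>) * h))" by (rule shell_scale[OF shA \<delta>\<beta>(1,2)])
    have sh2: "shell_fun (\<lambda>h. FB (inverse \<beta> * h))" by (rule shell_scale[OF shB \<delta>\<beta>(3,4)])
    have Bg: "Orb_s E cj \<mu> ?g f s = mellin (\<lambda>h. FA ((\<delta> / \<beta>) * h) + FB (inverse \<beta> * h) + C h) s"
      unfolding Orb_s_def mellin_def by (rule Bochner_Integration.integral_cong[OF refl]) (simp only: split space_mu)
    have sh12: "shell_fun (\<lambda>h. FA ((\<delta> / \<beta>) * h) + FB (inverse \<beta> * h))"
      by (rule shell_add[OF sh1 sh2])
    have "Orb_s E cj \<mu> ?g f s = mellin (\<lambda>h. FA ((\<delta> / \<beta>) * h)) s + mellin (\<lambda>h. FB (inverse \<beta> * h)) s"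
      unfolding Bg by (simp only: mellin_add[OF sh12 shC] mellin_add[OF sh1 sh2] C0 add_0_right)
    \<comment> \<open>Scaling by \<open>\<delta> / \<beta>\<close> and by the inverse of
      \<open>\<beta>\<close> produces the same factor in \<open>\<beta>\<close> in both terms and
      leaves \<open>\<delta>\<close> only in the first.\<close>
    also have "\<dots> = \<eta> (\<delta> / \<beta>) * complex_of_real (nab (\<delta> / \<beta>)) powr (- s) * mellin FA s
        + \<eta> (inverse \<beta>) * complex_of_real (nab (inverse \<beta>)) powr (- s) * mellin FB s"
      by (simp only: mellin_scale[OF shA \<delta>\<beta>(1,2)] mellin_scale[OF shB \<delta>\<beta>(3,4)])
    also have "\<eta> (\<delta> / \<beta>) = \<eta> \<delta> * \<eta> \<beta>" using \<beta> \<delta> by (intro eta_divide) auto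
    also have "\<eta> (inverse \<beta>) = \<eta> \<beta>" using \<beta> by (intro eta_inverse) auto
    also have i: "complex_of_real (nab (inverse \<beta>)) powr (- s) = complex_of_real (nab \<beta>) powr s"
    proof -
      have "nab \<beta> > 0" using \<beta> by simp
      then show ?thesis using \<beta>
        by (simp add: nab_inverse powr_def Ln_of_real ln_inverse flip: of_real_inverse)
    qed
    also have "complex_of_real (nab (\<delta> / \<beta>)) powr (- s) =
        complex_of_real (nab \<delta>) powr (- s) * complex_of_real (nab \<beta>) powr s"
    proof -
      have "nab (\<delta> / \<beta>) = nab \<delta> * nab (inverse \<beta>)"
        using \<beta> \<delta> nab_mult[of \<delta> "inverse \<beta>"] by (simp add: divide_inverse)
      then have "complex_of_real (nab (\<delta> / \<beta>)) powr (- s) =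
          complex_of_real (nab \<delta>) powr (- s) * complex_of_real (nab (inverse \<beta>)) powr (- s)"
        using \<beta> \<delta> nab_pos[of \<delta>] nab_pos[of "inverse \<beta>"] by (simp add: powr_times_real less_imp_le)
      then show ?thesis by (simp only: i)
    qed
    finally show "Orb_s E cj \<mu> ?g f s = \<eta> \<beta> * complex_of_real (nab \<beta>) powr s *
        (\<eta> \<delta> * complex_of_real (nab \<delta>) powr (- s) * mellin FA s + mellin FB s)"
      by (simp add: algebra_simps)
  qed
qed

text \<open>In the product rule the power of \<open>nab \<beta>\<close> contributes a multiple of
  the value at 0, which vanishes by \<open>zero\<close>; only the sign \<open>\<eta> \<beta>\<close>
  remains. The same equation rewrites the coefficient of the logarithm as
  \<open>B 0\<close>.\<close>

lemma germ_derivative: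
  assumes orb: "\<And>s. Orb_s E cj \<mu> g f s = \<eta> \<beta> * complex_of_real (nab \<beta>) powr s *
            (\<eta> \<delta> * complex_of_real (nab \<delta>) powr (- s) * A s + B s)"
    and A: "(A has_field_derivative A') (at 0)" and B: "(B has_field_derivative B') (at 0)"
    and \<beta>: "\<beta> \<in> E - {0}" and \<delta>: "\<delta> \<in> E - {0}" and zero: "\<eta> \<delta> * A 0 + B 0 = 0"
  shows "dOrb E cj \<mu> g f = \<eta> \<beta> * (B 0 * complex_of_real (ln (nab \<delta>)) + (\<eta> \<delta> * A' + B'))"
proof -
  have \<beta>0: "complex_of_real (nab \<beta>) \<noteq> 0" and \<delta>0: "complex_of_real (nab \<delta>) \<noteq> 0" and pos: "nab \<delta> > 0"
    using nab_pos[of \<beta>] nab_pos[of \<delta>] \<beta> \<delta> by (auto simp del: nab_pos)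
  have "((\<lambda>s. \<eta> \<beta> * complex_of_real (nab \<beta>) powr s *
        (\<eta> \<delta> * complex_of_real (nab \<delta>) powr (- s) * A s + B s)) has_field_derivative
      \<eta> \<beta> * Ln (complex_of_real (nab \<beta>)) * (\<eta> \<delta> * A 0 + B 0) +
      \<eta> \<beta> * (\<eta> \<delta> * (- Ln (complex_of_real (nab \<delta>)) * A 0 + A') + B')) (at 0)"
    using \<beta>0 \<delta>0 by (auto intro!: derivative_eq_intros A B simp: algebra_simps powr_def)
  then have "(Orb_s E cj \<mu> g f has_field_derivative
      \<eta> \<beta> * (\<eta> \<delta> * (- Ln (complex_of_real (nab \<delta>)) * A 0 + A') + B')) (at 0)"
    unfolding orb[abs_def] by (simp add: zero orb[abs_def])
  then have "dOrb E cj \<mu> g f = \<eta> \<beta> * (\<eta> \<delta> * (- Ln (complex_of_real (nab \<delta>)) * A 0 + A') + B')"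
    unfolding dOrb_def by (rule DERIV_imp_deriv)
  moreover have "B 0 = - (\<eta> \<delta> * A 0)" using zero by (simp add: eq_neg_iff_add_eq_0 add.commute)
  then have "\<eta> \<delta> * (- Ln (complex_of_real (nab \<delta>)) * A 0 + A') + B' =
      Ln (complex_of_real (nab \<delta>)) * B 0 + (\<eta> \<delta> * A' + B')"
    by (simp add: algebra_simps)
  ultimately show ?thesis
    using pos by (simp add: Ln_of_real mult.commute)
qed

end

subsection \<open>The symmetric spaces and the unitary groups\<close>

lemma cj_mat_mat2: "cj_mat cj (mat2 a b c d) = mat2 (cj a) (cj b) (cj c) (cj d)"
  by (rule mat2_eqI) (simp_all add: cj_mat_def)

lemma S_space_iff:
  "mat2 a b c d \<in> S_space cj \<longleftrightarrow> a * cj a + b * cj c = 1 \<and> a * cj b + b * cj d = 0 \<and>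
     c * cj a + d * cj c = 0 \<and> c * cj b + d * cj d = 1"
proof -
  have "mat 1 = (mat2 1 0 0 1 :: 'a^2^2)"
    by (rule mat2_eqI) (simp_all add: mat_def)
  then show ?thesis
    by (simp add: S_space_def cj_mat_mat2 mat2_mult)
qed

lemma s_lie_iff:
  "mat2 a b c d \<in> s_lie cj \<longleftrightarrow> a + cj a = 0 \<and> b + cj b = 0 \<and> c + cj c = 0 \<and> d + cj d = 0"
  by (auto simp: s_lie_def cj_mat_mat2 vec_eq_iff forall_2)

lemma det_mat2: "det (mat2 a b c d) = a * d - b * (c :: 'a::comm_ring_1)"
  by (simp add: det_2)

lemma col_det_mat2: "col_det (mat2 a b c d) = - b"
  by (simp add: col_det_def det_2 transpose_def matrix_vector_mult_def sum_2 Let_def)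

lemma mat2_mult_vec:
  "(mat2 a b c d *v x) $ 1 = a * x $ 1 + b * x $ 2"
  "(mat2 a b c d *v x) $ 2 = c * x $ 1 + d * (x $ 2 :: 'a::semiring_1)"
  by (simp_all add: matrix_vector_mult_def sum_2)

lemma mat2_exhaust:
  fixes g :: "'a::zero^2^2"
  obtains a b c d where "g = mat2 a b c d"
  using mat2_eqI[OF refl refl refl refl, of g] by blast

context ramified_extension
begin

text \<open>In the basis \<open>(w, u)\<close> the form is diagonal with entries
  \<open>hf w w\<close> and -1; if the first were 0, then \<open>w\<close> would lie in the
  radical.\<close>

lemma form_coord:
  assumes hf: "hermitian_form cj hf" and b: "adapted_basis hf w u"
  shows "hf (coord w u x) (coord w u y) = hf w w * (x $ 1) * cj (y $ 1) - (x $ 2) * cj (y $ 2)"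
    and "hf w w \<in> E" and "hf w w \<noteq> 0"
proof -
  note H = hf[unfolded hermitian_form_def]
  have add: "hf (x + y) z = hf x z + hf y z" for x y z
    using H[THEN conjunct1] by blast
  have scale: "hf (c *s x) y = c * hf x y" for x y c
    using H[THEN conjunct2, THEN conjunct1] by blast
  have herm: "hf y x = cj (hf x y)" for x y
    using H[THEN conjunct2, THEN conjunct2, THEN conjunct1] by blast
  have nondeg: "\<And>x. (\<forall>y. hf x y = 0) \<Longrightarrow> x = 0"
    using H[THEN conjunct2, THEN conjunct2, THEN conjunct2] by blast
  have uu: "hf u u = - 1" and w0: "w \<noteq> 0" and perp: "{x. hf x u = 0} = range (\<lambda>c. c *s w)"
    using b by (auto simp: adapted_basis_def)
  have "1 *s w \<in> {x. hf x u = 0}" unfolding perp by blast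
  then have wu: "hf w u = 0" by simp
  have uw: "hf u w = 0" using herm[of u w] wu by simp
  have addr: "hf x (y + z) = hf x y + hf x z" and scaler: "hf x (c *s y) = cj c * hf x y" for x y z c
  proof -
    show "hf x (y + z) = hf x y + hf x z"
      using herm[of x "y + z"] herm[of x y] herm[of x z] add[of y z x] by simp
    show "hf x (c *s y) = cj c * hf x y"
      using herm[of x "c *s y"] herm[of x y] scale[of c y x] by simp
  qed
  show "hf (coord w u x) (coord w u y) = hf w w * (x $ 1) * cj (y $ 1) - (x $ 2) * cj (y $ 2)"
    by (simp add: coord_def add addr scale scaler uu wu uw algebra_simps)
  show "hf w w \<in> E" by (rule cj_fixed) (rule herm[symmetric])
  show "hf w w \<noteq> 0"
  proof
    assume ww: "hf w w = 0"
    have "hf w y = 0" for y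
    proof -
      \<comment> \<open>Since \<open>hf u u = - 1\<close>, adding \<open>hf y u *s u\<close>
        projects \<open>y\<close> onto the orthogonal complement of \<open>u\<close>.\<close>
      have "hf (y + hf y u *s u) u = 0"
        by (simp add: add scale uu)
      then obtain c where "y + hf y u *s u = c *s w" using perp by blast
      then have "hf w (y + hf y u *s u) = 0" by (simp add: scaler ww)
      then show ?thesis by (simp add: addr scaler wu)
    qed
    then show False using nondeg w0 by blast
  qed
qed

lemma coord_surj:
  assumes hf: "hermitian_form cj hf" and b: "adapted_basis hf w u"
  shows "\<exists>x. y = coord w u x"
proof -
  have "hf (y + hf y u *s u) u = 0"
  proof -
    note H = hf[unfolded hermitian_form_def]
    have "hf (y + hf y u *s u) u = hf y u + hf (hf y u *s u) u"
      using H[THEN conjunct1] by blast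
    moreover have "hf (hf y u *s u) u = hf y u * hf u u"
      using H[THEN conjunct2, THEN conjunct1] by blast
    ultimately show ?thesis using b by (simp add: adapted_basis_def)
  qed
  then obtain c where "y + hf y u *s u = c *s w"
    using b unfolding adapted_basis_def by blast
  then have "y = c *s w + (- hf y u) *s u"
    by (simp add: vec_eq_iff eq_diff_eq)
  then have "y = coord w u (vector [c, - hf y u])"
    unfolding coord_def vector_2 .
  then show ?thesis by blast
qed

text \<open>Isotropy of the vector with coordinates \<open>x\<close> reads
  \<open>hf w w * nm cj (x $ 1) = nm cj (x $ 2)\<close>. Splitness is thus recorded by the sign
  \<open>\<eta> (hf w w)\<close>, which later separates the two sides.\<close>

lemma split_form_iff:
  assumes hf: "hermitian_form cj hf" and b: "adapted_basis hf w u"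
  shows "split_form hf \<longleftrightarrow> hf w w \<in> nm cj ` (UNIV - {0})"
proof
  assume "split_form hf"
  then obtain y where y: "y \<noteq> 0" "hf y y = 0" by (auto simp: split_form_def)
  then obtain x where x: "y = coord w u x" using coord_surj[OF assms] by blast
  have eq: "hf w w * nm cj (x $ 1) = nm cj (x $ 2)"
    using y(2) form_coord(1)[OF assms, of x x] by (simp add: x nm_def mult.assoc)
  have "x $ 1 \<noteq> 0"
  proof
    assume "x $ 1 = 0"
    then have "y = 0" using eq by (simp add: x coord_def nm_def)
    then show False using y by simp
  qed
  then have "hf w w = nm cj (x $ 2) / nm cj (x $ 1)"
    by (subst eq[symmetric]) simp
  then have "hf w w = nm cj (x $ 2 / x $ 1)"
    by (simp only: divide_inverse nm_mult nm_inverse)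
  then show "hf w w \<in> nm cj ` (UNIV - {0})"
    using form_coord(3)[OF assms] by (intro image_eqI[of _ _ "x $ 2 / x $ 1"]) auto
next
  assume "hf w w \<in> nm cj ` (UNIV - {0})"
  then obtain z where z: "hf w w = nm cj z" by blast
  have "hf (coord w u (vector [1, z])) (coord w u (vector [1, z])) = 0"
    by (subst form_coord(1)[OF assms]) (simp add: z nm_def)
  moreover have "coord w u (vector [1, z]) \<noteq> 0"
  proof
    assume 0: "coord w u (vector [1, z]) = 0"
    have "hf w w * 1 * cj 1 - 0 * cj z = hf (coord w u (vector [1, 0])) (coord w u (vector [1, z]))"
      by (subst form_coord(1)[OF assms]) simp
    also have "\<dots> = hf (coord w u (vector [1, 0])) (coord w u 0)"
      unfolding 0 by (simp add: coord_def)
    also have "\<dots> = 0" by (subst form_coord(1)[OF assms]) simp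
    finally show False using form_coord(3)[OF assms] by simp
  qed
  ultimately show "split_form hf" by (auto simp: split_form_def)
qed

lemma U_group_iff:
  assumes hf: "hermitian_form cj hf" and b: "adapted_basis hf w u"
  defines "\<delta> \<equiv> hf w w"
  shows "mat2 a b c d \<in> U_group hf w u \<longleftrightarrow>
     \<delta> * a * cj a - c * cj c = \<delta> \<and> \<delta> * a * cj b - c * cj d = 0 \<and> \<delta> * b * cj b - d * cj d = - 1"
    (is "?g \<in> _ \<longleftrightarrow> ?R")
proof -
  have iff: "?g \<in> U_group hf w u \<longleftrightarrow> (\<forall>(x :: 'a^2) (y :: 'a^2).
      \<delta> * (a * x $ 1 + b * x $ 2) * cj (a * y $ 1 + b * y $ 2) - (c * x $ 1 + d * x $ 2) * cj (c * y $ 1 + d * y $ 2)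
      = \<delta> * x $ 1 * cj (y $ 1) - x $ 2 * cj (y $ 2))"
    unfolding U_group_def mem_Collect_eq form_coord(1)[OF hf b] mat2_mult_vec \<delta>_def ..
  have \<delta>: "cj \<delta> = \<delta>" using form_coord(2)[OF hf b] by (simp add: \<delta>_def)
  show ?thesis
  proof
    assume "?g \<in> U_group hf w u"
    then have *: "\<delta> * (a * x $ 1 + b * x $ 2) * cj (a * y $ 1 + b * y $ 2) - (c * x $ 1 + d * x $ 2) * cj (c * y $ 1 + d * y $ 2)
      = \<delta> * x $ 1 * cj (y $ 1) - x $ 2 * cj (y $ 2)" for x y :: "'a^2"
      using iff by blast
    show ?R
      using *[of "vector [1, 0]" "vector [1, 0]"] *[of "vector [1, 0]" "vector [0, 1]"]
        *[of "vector [0, 1]" "vector [0, 1]"] by simp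
  next
    assume R: ?R
    \<comment> \<open>The remaining entry of the Gram matrix is the conjugate of the second
      condition.\<close>
    have 3: "\<delta> * b * cj a - d * cj c = 0"
    proof -
      have "cj (\<delta> * a * cj b - c * cj d) = 0" using R by simp
      then show ?thesis by (simp add: \<delta> mult_ac)
    qed
    have "\<delta> * (a * x1 + b * x2) * (cj a * y1 + cj b * y2) - (c * x1 + d * x2) * (cj c * y1 + cj d * y2)
        = \<delta> * x1 * y1 - x2 * y2" for x1 x2 y1 y2
    proof -
      have "\<delta> * (a * x1 + b * x2) * (cj a * y1 + cj b * y2) - (c * x1 + d * x2) * (cj c * y1 + cj d * y2)
        = (\<delta> * a * cj a - c * cj c) * (x1 * y1) + (\<delta> * a * cj b - c * cj d) * (x1 * y2)
        + (\<delta> * b * cj a - d * cj c) * (x2 * y1) + (\<delta> * b * cj b - d * cj d) * (x2 * y2)"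
        by (simp add: algebra_simps)
      also have "\<dots> = \<delta> * (x1 * y1) - x2 * y2" using R 3 by simp
      finally show ?thesis by (simp add: mult.assoc)
    qed
    then show "?g \<in> U_group hf w u" unfolding iff by simp
  qed
qed

lemma u_lie_iff:
  assumes hf: "hermitian_form cj hf" and b: "adapted_basis hf w u"
  defines "\<delta> \<equiv> hf w w"
  shows "mat2 a b c d \<in> u_lie hf w u \<longleftrightarrow> a + cj a = 0 \<and> c = \<delta> * cj b \<and> d + cj d = 0"
    (is "?g \<in> _ \<longleftrightarrow> ?R")
proof -
  have iff: "?g \<in> u_lie hf w u \<longleftrightarrow> (\<forall>(x :: 'a^2) (y :: 'a^2).
      \<delta> * (a * x $ 1 + b * x $ 2) * cj (y $ 1) - (c * x $ 1 + d * x $ 2) * cj (y $ 2) +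
      (\<delta> * x $ 1 * cj (a * y $ 1 + b * y $ 2) - x $ 2 * cj (c * y $ 1 + d * y $ 2)) = 0)"
    unfolding u_lie_def mem_Collect_eq form_coord(1)[OF hf b] mat2_mult_vec \<delta>_def ..
  have \<delta>: "cj \<delta> = \<delta>" and \<delta>0: "\<delta> \<noteq> 0" using form_coord(2,3)[OF hf b] by (simp_all add: \<delta>_def)
  show ?thesis
  proof
    assume "?g \<in> u_lie hf w u"
    then have *: "\<delta> * (a * x $ 1 + b * x $ 2) * cj (y $ 1) - (c * x $ 1 + d * x $ 2) * cj (y $ 2) +
      (\<delta> * x $ 1 * cj (a * y $ 1 + b * y $ 2) - x $ 2 * cj (c * y $ 1 + d * y $ 2)) = 0" for x y :: "'a^2"
      using iff by blast
    have "\<delta> * (a + cj a) = 0"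
      using *[of "vector [1, 0]" "vector [1, 0]"] by (simp add: algebra_simps)
    moreover have "c = \<delta> * cj b"
      using *[of "vector [1, 0]" "vector [0, 1]"] by (simp add: algebra_simps)
    moreover have "- (d + cj d) = 0"
      using *[of "vector [0, 1]" "vector [0, 1]"] by simp
    ultimately show ?R using \<delta>0 by (metis mult_eq_0_iff neg_equal_0_iff_equal)
  next
    assume R: ?R
    then have a: "cj a = - a" and d: "cj d = - d" and c: "c = \<delta> * cj b"
      by (auto simp: add_eq_0_iff)
    then have "cj c = \<delta> * b" by (simp add: \<delta>)
    then show "?g \<in> u_lie hf w u"
      unfolding iff by (simp add: a d c \<delta> algebra_simps)
  qed
qed

end

context orbital_setting
begin

text \<open>The coordinates used in the germ expansion: the off-diagonal entries of \<open>\<gamma>\<close> are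
  \<open>b0 * \<beta>\<close> and \<open>c0 * \<Delta> \<gamma> / \<beta>\<close> up to factors close to 1, and the transfer factor is \<open>\<kappa> * \<eta> \<beta>\<close>.
  No condition is put on the size of \<open>\<beta>\<close>, as it only shifts the orbit.\<close>

definition near_diag where
  "near_diag \<omega> \<kappa> a0 d0 b0 c0 \<Delta> \<rho> \<gamma> \<longleftrightarrow> (\<exists>a d \<beta> x y. \<beta> \<in> E - {0} \<and> \<Delta> \<gamma> \<in> E - {0} \<and>
     \<gamma> = mat2 a (b0 * \<beta> * (1 + x)) (c0 * (\<Delta> \<gamma> / \<beta>) * (1 + y)) d \<and>
     av (a - a0) < \<rho> \<and> av (d - d0) < \<rho> \<and> av x < \<rho> \<and> av y < \<rho> \<and> av (\<Delta> \<gamma>) < \<rho> \<and>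
     \<omega> \<gamma> = \<kappa> * \<eta> \<beta>)"

text \<open>Norm-one elements have absolute value 1, so conjugation by them keeps the size of every
  entry and one radius serves all \<open>h\<close>; the integrands then agree pointwise.\<close>

lemma Orb_u_near_diag:
  fixes f :: "'a^2^2 \<Rightarrow> complex"
  assumes f: "Cc_smooth Y f" and \<nu>: "space \<nu> = norm_one cj"
    and Y: "\<And>g h. g \<in> Y \<Longrightarrow> h \<in> norm_one cj \<Longrightarrow> dconj h g \<in> Y" and diag: "diag2 a0 d0 \<in> Y"
  shows "\<exists>r>0. \<forall>g\<in>Y. dist g (diag2 a0 d0) < r \<longrightarrow> Orb_u \<nu> g f = Orb_u \<nu> (diag2 a0 d0) f"
proof -
  obtain e where e: "e > 0" "\<And>x y. x \<in> Y \<Longrightarrow> y \<in> Y \<Longrightarrow> dist x y < e \<Longrightarrow> f x = f y"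
    using Cc_smooth_uniform[OF f] by blast
  have "Orb_u \<nu> g f = Orb_u \<nu> (diag2 a0 d0) f" if g: "g \<in> Y" "dist g (diag2 a0 d0) < e / 4" for g
    unfolding Orb_u_def
  proof (rule Bochner_Integration.integral_cong[OF refl])
    fix h assume "h \<in> space \<nu>"
    then have h: "h \<in> norm_one cj" by (simp add: \<nu>)
    obtain a b c d where gm: "g = mat2 a b c d" by (rule mat2_exhaust)
    have "av (a - a0) < e / 4" "av b < e / 4" "av c < e / 4" "av (d - d0) < e / 4"
      using dist_entry_le[of g 1 1 "diag2 a0 d0"] dist_entry_le[of g 1 2 "diag2 a0 d0"]
        dist_entry_le[of g 2 1 "diag2 a0 d0"] dist_entry_le[of g 2 2 "diag2 a0 d0"] g(2)
      by (auto simp: gm diag2_def dist_av)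
    then have "dist (mat2 a (inverse h * b) (c * h) d) (mat2 a0 (inverse h * 0) (0 * h) d0) < 4 * (e / 4)"
      using norm_oneD(2)[OF h] by (intro dist_mat2_less) (simp_all add: dist_av)
    then have "dist (dconj h g) (dconj h (diag2 a0 d0)) < 4 * (e / 4)"
      by (simp only: dconj_mat2[OF norm_oneD(1)[OF h]] gm diag2_def)
    then show "f (dconj h g) = f (dconj h (diag2 a0 d0))"
      using e(2) Y[OF _ h] g(1) diag by simp
  qed
  then show ?thesis using e(1) by (intro exI[of _ "e / 4"]) auto
qed

text \<open>\<open>sign\<close> says that matching into \<open>Y j\<close> fixes
  \<open>\<eta> (\<Delta> \<gamma>)\<close>, and \<open>test\<close> supplies matched pairs for both
  indices, from which transfer yields equations for \<open>A 0\<close> and \<open>B 0\<close>. In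
  \<open>test\<close> only \<open>g\<close> has to approach the diagonal element:
  \<open>\<gamma>\<close> may have a large \<open>\<beta>\<close>.\<close>

lemma germ_expansion:
  fixes f' :: "'a^2^2 \<Rightarrow> complex" and Y :: "nat \<Rightarrow> ('a^2^2) set"
  assumes f': "Cc_smooth X f'" and f: "\<And>j. j \<in> {0, 1} \<Longrightarrow> Cc_smooth (Y j) (f j)"
    and tr: "transfers E cj \<mu> \<nu> \<omega> X Y f' f" and \<nu>: "space \<nu> = norm_one cj"
    and b0: "b0 \<noteq> 0" and c0: "c0 \<noteq> 0" and \<kappa>: "\<kappa> \<noteq> 0"
    and PX: "\<And>x. x \<in> E \<Longrightarrow> mat2 a0 (b0 * x) 0 d0 \<in> X"
    and QX: "\<And>z. z \<in> E \<Longrightarrow> mat2 a0 0 (c0 * z) d0 \<in> X"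
    and Xconj: "\<And>\<gamma> h. \<gamma> \<in> X \<Longrightarrow> h \<in> E - {0} \<Longrightarrow> dconj h \<gamma> \<in> X"
    and Yconj: "\<And>j g h. j \<in> {0, 1} \<Longrightarrow> g \<in> Y j \<Longrightarrow> h \<in> norm_one cj \<Longrightarrow> dconj h g \<in> Y j"
    and Ydiag: "\<And>j. j \<in> {0, 1} \<Longrightarrow> diag2 a0 d0 \<in> Y j"
    and near: "\<And>\<rho>. \<rho> > 0 \<Longrightarrow> \<exists>r>0. \<forall>\<gamma>\<in>X. rs \<gamma> \<longrightarrow> dist \<gamma> (diag2 a0 d0) < r \<longrightarrow>
        near_diag \<omega> \<kappa> a0 d0 b0 c0 \<Delta> \<rho> \<gamma>"
    and sign: "\<And>j \<gamma> g. j \<in> {0, 1} \<Longrightarrow> \<gamma> \<in> X \<Longrightarrow> g \<in> Y j \<Longrightarrow> matches \<gamma> g \<Longrightarrow> \<eta> (\<Delta> \<gamma>) = sg j"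
    and test: "\<And>j \<rho> r. j \<in> {0, 1} \<Longrightarrow> \<rho> > 0 \<Longrightarrow> r > 0 \<Longrightarrow> \<exists>\<gamma>\<in>X. \<exists>g\<in>Y j. matches \<gamma> g \<and>
        near_diag \<omega> \<kappa> a0 d0 b0 c0 \<Delta> \<rho> \<gamma> \<and> dist g (diag2 a0 d0) < r"
    and i: "i \<in> {0, 1}" and opp: "sg (1 - i) = - sg i" and vanish: "\<And>g. g \<in> Y i \<Longrightarrow> f i g = 0"
  shows "\<exists>U C. openin (top_of_set X) U \<and> diag2 a0 d0 \<in> U \<and>
     (\<forall>\<gamma>\<in>U \<inter> matched X (Y i). \<omega> \<gamma> * dOrb E cj \<mu> \<gamma> f' =
        1 / 2 * Orb_u \<nu> (diag2 a0 d0) (f (1 - i)) * complex_of_real (ln (nab (\<Delta> \<gamma>))) + C)"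
proof -
  obtain \<rho> A B where \<rho>: "0 < \<rho>" "\<rho> \<le> 1"
    and dA: "\<exists>D. (A has_field_derivative D) (at 0)" and dB: "\<exists>D. (B has_field_derivative D) (at 0)"
    and orb: "\<And>a d \<beta> \<delta> x y s. \<lbrakk>\<beta> \<in> E - {0}; \<delta> \<in> E - {0}; av (a - a0) < \<rho>; av (d - d0) < \<rho>;
        av x < \<rho>; av y < \<rho>; av \<delta> < \<rho>;
        \<And>h. h \<in> E - {0} \<Longrightarrow> dconj h (mat2 a (b0 * \<beta> * (1 + x)) (c0 * (\<delta> / \<beta>) * (1 + y)) d) \<in> X\<rbrakk>
      \<Longrightarrow> Orb_s E cj \<mu> (mat2 a (b0 * \<beta> * (1 + x)) (c0 * (\<delta> / \<beta>) * (1 + y)) d) f' s =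
          \<eta> \<beta> * complex_of_real (nab \<beta>) powr s *
            (\<eta> \<delta> * complex_of_real (nab \<delta>) powr (- s) * A s + B s)"
    using orbital_germ[OF f' b0 c0 PX QX] by blast
  obtain A' B' where A': "(A has_field_derivative A') (at 0)" and B': "(B has_field_derivative B') (at 0)"
    using dA dB by blast
  have germ: "\<exists>\<beta>\<in>E - {0}. \<Delta> \<gamma> \<in> E - {0} \<and> \<omega> \<gamma> = \<kappa> * \<eta> \<beta> \<and> (\<forall>s. Orb_s E cj \<mu> \<gamma> f' s =
      \<eta> \<beta> * complex_of_real (nab \<beta>) powr s * (\<eta> (\<Delta> \<gamma>) * complex_of_real (nab (\<Delta> \<gamma>)) powr (- s) * A s + B s))"
    if \<gamma>: "\<gamma> \<in> X" "near_diag \<omega> \<kappa> a0 d0 b0 c0 \<Delta> \<rho> \<gamma>" for \<gamma>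
  proof -
    obtain a d \<beta> x y where *: "\<beta> \<in> E - {0}" "\<Delta> \<gamma> \<in> E - {0}"
      and \<gamma>m: "\<gamma> = mat2 a (b0 * \<beta> * (1 + x)) (c0 * (\<Delta> \<gamma> / \<beta>) * (1 + y)) d"
      and small: "av (a - a0) < \<rho>" "av (d - d0) < \<rho>" "av x < \<rho>" "av y < \<rho>" "av (\<Delta> \<gamma>) < \<rho>"
      and om: "\<omega> \<gamma> = \<kappa> * \<eta> \<beta>"
      using \<gamma>(2) unfolding near_diag_def by blast
    have "dconj h (mat2 a (b0 * \<beta> * (1 + x)) (c0 * (\<Delta> \<gamma> / \<beta>) * (1 + y)) d) \<in> X" if "h \<in> E - {0}" for h
      using Xconj[OF \<gamma>(1) that] \<gamma>m by metis
    from orb[OF * small this] \<gamma>m show ?thesis using * om by metis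
  qed
  have orb_value: "Orb_u \<nu> g (f j) = \<kappa> * (sg j * A 0 + B 0)"
    if j: "j \<in> {0, 1}" and m: "matches \<gamma> g" "\<gamma> \<in> X" "g \<in> Y j"
      and nr: "near_diag \<omega> \<kappa> a0 d0 b0 c0 \<Delta> \<rho> \<gamma>" for j \<gamma> g
  proof -
    obtain \<beta> where \<beta>: "\<beta> \<in> E - {0}" "\<Delta> \<gamma> \<in> E - {0}" "\<omega> \<gamma> = \<kappa> * \<eta> \<beta>"
      and o: "Orb_s E cj \<mu> \<gamma> f' 0 = \<eta> \<beta> * complex_of_real (nab \<beta>) powr 0 *
        (\<eta> (\<Delta> \<gamma>) * complex_of_real (nab (\<Delta> \<gamma>)) powr (- 0) * A 0 + B 0)"
      using germ[OF m(2) nr] by blast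
    have "nab \<beta> > 0" "nab (\<Delta> \<gamma>) > 0" using \<beta> by auto
    then have "Orb_s E cj \<mu> \<gamma> f' 0 = \<eta> \<beta> * (sg j * A 0 + B 0)"
      using o sign[OF j m(2,3,1)] by simp
    moreover have "Orb_u \<nu> g (f j) = \<omega> \<gamma> * Orb_s E cj \<mu> \<gamma> f' 0"
      using tr j m unfolding transfers_def by blast
    ultimately have "Orb_u \<nu> g (f j) = \<kappa> * (\<eta> \<beta> * \<eta> \<beta>) * (sg j * A 0 + B 0)"
      using \<beta>(3) by simp
    then show ?thesis by simp
  qed
  \<comment> \<open>As \<open>f i\<close> vanishes on all of \<open>Y i\<close>, a single matched
    pair gives the relation.\<close>
  have zero: "sg i * A 0 + B 0 = 0"
  proof -
    obtain \<gamma> g where *: "\<gamma> \<in> X" "g \<in> Y i" "matches \<gamma> g" "near_diag \<omega> \<kappa> a0 d0 b0 c0 \<Delta> \<rho> \<gamma>"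
      using test[OF i \<rho>(1) zero_less_one] by blast
    have "Orb_u \<nu> g (f i) = (\<integral>h. 0 \<partial>\<nu>)"
      unfolding Orb_u_def
    proof (rule Bochner_Integration.integral_cong[OF refl])
      fix h assume "h \<in> space \<nu>"
      then show "f i (dconj h g) = 0" using vanish Yconj[OF i *(2)] by (simp add: \<nu>)
    qed
    then show ?thesis using orb_value[OF i *(3,1,2,4)] \<kappa> by simp
  qed
  \<comment> \<open>A pair on the other side gives \<open>\<kappa> * (- sg i * A 0 + B 0)\<close>,
    and the relation just found makes both terms equal to \<open>B 0\<close>. The factor 1/2 of the
    formula originates here.\<close>
  have diag: "Orb_u \<nu> (diag2 a0 d0) (f (1 - i)) = 2 * \<kappa> * B 0"
  proof -
    have j: "1 - i \<in> {0, 1}" using i by auto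
    obtain r where r: "r > 0"
      "\<And>g. g \<in> Y (1 - i) \<Longrightarrow> dist g (diag2 a0 d0) < r \<Longrightarrow> Orb_u \<nu> g (f (1 - i)) = Orb_u \<nu> (diag2 a0 d0) (f (1 - i))"
      using Orb_u_near_diag[OF f[OF j] \<nu> Yconj[OF j] Ydiag[OF j]] by blast
    obtain \<gamma> g where *: "\<gamma> \<in> X" "g \<in> Y (1 - i)" "matches \<gamma> g" "near_diag \<omega> \<kappa> a0 d0 b0 c0 \<Delta> \<rho> \<gamma>"
      and dg: "dist g (diag2 a0 d0) < r"
      using test[OF j \<rho>(1) r(1)] by blast
    have "Orb_u \<nu> (diag2 a0 d0) (f (1 - i)) = \<kappa> * (- sg i * A 0 + B 0)"
      using orb_value[OF j *(3,1,2,4)] r(2)[OF *(2) dg] opp by simp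
    also have "- sg i * A 0 = B 0" using zero by (simp add: neg_eq_iff_add_eq_0)
    finally show ?thesis by simp
  qed
  obtain r where r: "r > 0"
    "\<And>\<gamma>. \<gamma> \<in> X \<Longrightarrow> rs \<gamma> \<Longrightarrow> dist \<gamma> (diag2 a0 d0) < r \<Longrightarrow> near_diag \<omega> \<kappa> a0 d0 b0 c0 \<Delta> \<rho> \<gamma>"
    using near[OF \<rho>(1)] by blast
  \<comment> \<open>The constant does not depend on \<open>\<gamma>\<close> because the sign of
    \<open>\<Delta> \<gamma>\<close> does not; the two factors \<open>\<eta> \<beta>\<close>, one
    from the transfer factor and one from the orbital integral, cancel.\<close>
  have "\<omega> \<gamma> * dOrb E cj \<mu> \<gamma> f' = 1 / 2 * Orb_u \<nu> (diag2 a0 d0) (f (1 - i)) *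
      complex_of_real (ln (nab (\<Delta> \<gamma>))) + \<kappa> * (sg i * A' + B')"
    if \<gamma>: "\<gamma> \<in> (X \<inter> ball (diag2 a0 d0) r) \<inter> matched X (Y i)" for \<gamma>
  proof -
    obtain g where g: "g \<in> Y i" "matches \<gamma> g" "\<gamma> \<in> X" "rs \<gamma>"
      using \<gamma> by (auto simp: matched_def)
    have "dist \<gamma> (diag2 a0 d0) < r" using \<gamma> by (simp add: dist_commute)
    then obtain \<beta> where \<beta>: "\<beta> \<in> E - {0}" "\<Delta> \<gamma> \<in> E - {0}" "\<omega> \<gamma> = \<kappa> * \<eta> \<beta>"
      and o: "\<And>s. Orb_s E cj \<mu> \<gamma> f' s = \<eta> \<beta> * complex_of_real (nab \<beta>) powr s *
        (\<eta> (\<Delta> \<gamma>) * complex_of_real (nab (\<Delta> \<gamma>)) powr (- s) * A s + B s)"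
      using germ[OF g(3) r(2)[OF g(3,4)]] by blast
    have sgn: "\<eta> (\<Delta> \<gamma>) = sg i" by (rule sign[OF i g(3,1,2)])
    have "dOrb E cj \<mu> \<gamma> f' = \<eta> \<beta> * (B 0 * complex_of_real (ln (nab (\<Delta> \<gamma>))) + (\<eta> (\<Delta> \<gamma>) * A' + B'))"
      by (rule germ_derivative[OF o A' B' \<beta>(1,2)]) (simp add: sgn zero)
    then have "\<omega> \<gamma> * dOrb E cj \<mu> \<gamma> f' = \<kappa> * (\<eta> \<beta> * \<eta> \<beta>) * (B 0 * complex_of_real (ln (nab (\<Delta> \<gamma>))) + (sg i * A' + B'))"
      unfolding \<beta>(3) sgn by simp
    then show ?thesis unfolding diag by (simp add: algebra_simps)
  qed
  moreover have "openin (top_of_set X) (X \<inter> ball (diag2 a0 d0) r)"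
    by (simp add: openin_open_Int)
  moreover have "diag2 a0 d0 \<in> X \<inter> ball (diag2 a0 d0) r"
    using PX[of 0] r(1) by (simp add: diag2_def)
  ultimately show ?thesis by blast
qed

section \<open>Germ coordinates near a diagonal element\<close>

lemma rs_mat2: "rs (mat2 a b c d) \<longleftrightarrow> b \<noteq> 0 \<and> c \<noteq> 0"
  by (simp add: rs_def)

lemma near_diagI:
  assumes "\<beta> \<in> E - {0}" "\<delta> \<in> E - {0}" "\<Delta> \<gamma> = \<delta>"
    "\<gamma> = mat2 a (b0 * \<beta> * (1 + x)) (c0 * (\<delta> / \<beta>) * (1 + y)) d"
    "av (a - a0) < \<rho>" "av (d - d0) < \<rho>" "av x < \<rho>" "av y < \<rho>" "av \<delta> < \<rho>" "\<omega> \<gamma> = \<kappa> * \<eta> \<beta>"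
  shows "near_diag \<omega> \<kappa> a0 d0 b0 c0 \<Delta> \<rho> \<gamma>"
  unfolding near_diag_def assms(3) using assms by blast

lemma S_dconj:
  assumes "\<gamma> \<in> S_space cj" "h \<in> E - {0}"
  shows "dconj h \<gamma> \<in> S_space cj"
proof -
  obtain a b c d where \<gamma>: "\<gamma> = mat2 a b c d" by (rule mat2_exhaust)
  have h: "h \<noteq> 0" "cj h = h" using assms(2) by auto
  have "a * cj (inverse h * b) + inverse h * b * cj d = inverse h * (a * cj b + b * cj d)"
    "c * h * cj a + d * cj (c * h) = h * (c * cj a + d * cj c)"
    "inverse h * b * cj (c * h) = b * cj c" "c * h * cj (inverse h * b) = c * cj b"
    using h by (simp_all add: algebra_simps)
  then show ?thesis
    using assms(1) unfolding \<gamma> dconj_mat2[OF h(1)] S_space_iff by (simp only: mult_zero_right)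
qed

lemma s_lie_dconj:
  assumes "\<gamma> \<in> s_lie cj" "h \<in> E - {0}"
  shows "dconj h \<gamma> \<in> s_lie cj"
proof -
  obtain a b c d where \<gamma>: "\<gamma> = mat2 a b c d" by (rule mat2_exhaust)
  then have "cj b = - b" "cj c = - c" "a + cj a = 0" "d + cj d = 0"
    using assms(1) by (auto simp: s_lie_iff add_eq_0_iff)
  then show ?thesis using assms(2) by (simp add: \<gamma> dconj_mat2 s_lie_iff)
qed

lemma small_multiple:
  fixes \<delta> :: 'a
  assumes "r > 0"
  shows "\<exists>b :: 'a. b \<noteq> 0 \<and> av b < r \<and> av \<delta> * av b < r"
proof -
  have pos: "1 + av \<delta> > 0" by (rule add_pos_nonneg) auto
  obtain b :: 'a where b: "b \<noteq> 0" "av b < r / (1 + av \<delta>)"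
    using small_element[OF divide_pos_pos[OF assms pos]] by blast
  have "av b * (1 + av \<delta>) < r"
    using b(2) by (simp only: pos_less_divide_eq[OF pos])
  then have "av b + av \<delta> * av b < r" by (simp add: algebra_simps)
  moreover have "0 \<le> av \<delta> * av b" "0 \<le> av b" by simp_all
  ultimately show ?thesis using b(1) by (intro exI[of _ b]) linarith
qed

text \<open>The equations of the symmetric space imply that \<open>cj b\<close> times the
  determinant is \<open>- b\<close>, which is also the value of \<open>col_det\<close>.\<close>

lemma omega_S_eq:
  assumes S: "mat2 a b c d \<in> S_space cj" and b: "b \<noteq> 0"
  shows "omega_S \<psi> (mat2 a b c d) = \<psi> (cj b)"
proof -
  have e: "a * cj a + b * cj c = 1" "a * cj b + b * cj d = 0"
    using S by (simp_all add: S_space_iff)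
  have 1: "cj a * a + cj b * c = 1" using arg_cong[OF e(1), of cj] by simp
  have "cj a * b + cj b * d = 0" using arg_cong[OF e(2), of cj] by simp
  then have 2: "cj b * d = - (cj a * b)" by (simp add: eq_neg_iff_add_eq_0 add.commute)
  have "cj b * (a * d - b * c) = a * (cj b * d) - b * (cj b * c)"
    by (simp add: algebra_simps)
  also have "\<dots> = - b * (cj a * a + cj b * c)"
    unfolding 2 by (simp add: algebra_simps)
  finally have "cj b * (a * d - b * c) = - b" using 1 by simp
  moreover from this have "a * d - b * c \<noteq> 0" using b by auto
  ultimately have "inverse (a * d - b * c) * - b = cj b"
    by (simp add: divide_simps mult.commute)
  then show ?thesis by (simp add: omega_S_def det_mat2 col_det_mat2)
qed

text \<open>Comparing \<open>a * cj b + b * cj d = 0\<close> with the equation for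
  \<open>a0\<close>, \<open>d0\<close>, \<open>b0\<close> shows that \<open>b / b0\<close> is almost
  fixed by conjugation. Its component in \<open>E\<close> becomes \<open>\<beta>\<close>, the rest
  goes into \<open>1 + x\<close>. The constant \<open>c0\<close> is the inverse of
  \<open>cj b0\<close> because \<open>1 - nm cj a = cj b * c\<close>.\<close>

lemma S_near_diag:
  assumes a0: "a0 \<in> norm_one cj" and d0: "d0 \<in> norm_one cj"
    and b0: "b0 \<noteq> 0" "a0 * cj b0 + b0 * cj d0 = 0" and \<rho>: "\<rho> > 0"
  shows "\<exists>r>0. \<forall>\<gamma>\<in>S_space cj. rs \<gamma> \<longrightarrow> dist \<gamma> (diag2 a0 d0) < r \<longrightarrow>
    near_diag (omega_S \<psi>) (\<psi> (cj b0)) a0 d0 b0 (inverse (cj b0)) (\<lambda>\<gamma>. 1 - nm cj (\<gamma> $ 1 $ 1)) \<rho> \<gamma>"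
proof -
  obtain r0 where r0: "r0 > 0" "\<And>x. av (x - 1) < r0 \<Longrightarrow> \<psi> x = 1"
    using psi_trivial_near_1 by blast
  \<comment> \<open>The bound \<open>r0\<close> forces \<open>\<psi> (1 - x) = 1\<close>, so the
    transfer factor sees only \<open>b0\<close> and \<open>u\<close>.\<close>
  define r where "r = min (min \<rho> 1) r0"
  have r: "r > 0" "r \<le> \<rho>" "r \<le> 1" "r \<le> r0" using \<rho> r0 by (auto simp: r_def)
  have "near_diag (omega_S \<psi>) (\<psi> (cj b0)) a0 d0 b0 (inverse (cj b0)) (\<lambda>\<gamma>. 1 - nm cj (\<gamma> $ 1 $ 1)) \<rho> \<gamma>"
    if \<gamma>: "\<gamma> \<in> S_space cj" "rs \<gamma>" "dist \<gamma> (diag2 a0 d0) < r" for \<gamma>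
  proof -
    obtain a b c d where g: "\<gamma> = mat2 a b c d" by (rule mat2_exhaust)
    have b: "b \<noteq> 0" and c: "c \<noteq> 0" using \<gamma>(2) by (auto simp: g rs_mat2)
    have small: "av (a - a0) < r" "av b < r" "av c < r" "av (d - d0) < r"
      using dist_entry_le[of \<gamma> 1 1 "diag2 a0 d0"] dist_entry_le[of \<gamma> 1 2 "diag2 a0 d0"]
        dist_entry_le[of \<gamma> 2 1 "diag2 a0 d0"] dist_entry_le[of \<gamma> 2 2 "diag2 a0 d0"] \<gamma>(3)
      by (auto simp: g diag2_def dist_av)
    have e: "a * cj a + b * cj c = 1" "a * cj b + b * cj d = 0"
      using \<gamma>(1) by (simp_all add: g S_space_iff)
    define D where "D = 1 - nm cj a"
    have D: "D = b * cj c" using e(1) by (simp add: D_def nm_def algebra_simps)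
    have DE: "D \<in> E" by (simp add: D_def)
    have D0: "D \<noteq> 0" using b c by (simp add: D)
    have D': "D = cj b * c" using cj_E[OF DE] by (simp add: D)
    have "av D = av b * av c" by (simp add: D)
    also have "\<dots> < r * 1" using small r by (intro mult_strict_mono) auto
    finally have Dr: "av D < \<rho>" using r by simp
    have ad1: "av a0 = 1" "av d0 = 1" using norm_oneD a0 d0 by auto
    have avd: "av d = 1" using av_close[of d d0] small(4) r(3) ad1 by simp
    obtain u v where uv: "u \<in> E" "v \<in> E" "b / b0 = u + v * \<pi>" using decomp by blast
    define \<xi> where "\<xi> = b / b0"
    have \<xi>0: "\<xi> \<noteq> 0" using b b0 by (simp add: \<xi>_def)
    have bx: "b = b0 * \<xi>" using b0 by (simp add: \<xi>_def)
    have cx: "cj \<xi> = u - v * \<pi>" using uv by (simp add: \<xi>_def[symmetric])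
    have "a * cj b0 * cj \<xi> = - (b0 * \<xi> * cj d)" using e(2) by (simp add: bx eq_neg_iff_add_eq_0 mult.assoc)
    moreover have f: "b0 * cj d0 = - (a0 * cj b0)" using b0(2) by (simp add: eq_neg_iff_add_eq_0 add.commute)
    ultimately have "cj b0 * (a * cj d0 * cj \<xi>) = cj b0 * (a0 * cj d * \<xi>)"
    proof -
      have "cj b0 * (a * cj d0 * cj \<xi>) = (a * cj b0 * cj \<xi>) * cj d0" by (simp add: mult_ac)
      also have "\<dots> = - (b0 * cj d0) * \<xi> * cj d"
        unfolding \<open>a * cj b0 * cj \<xi> = _\<close> by (simp add: mult_ac)
      also have "\<dots> = cj b0 * (a0 * cj d * \<xi>)" unfolding f by (simp add: mult_ac)
      finally show ?thesis .
    qed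
    then have rel: "a * cj d0 * cj \<xi> = a0 * cj d * \<xi>" using b0(1) by simp
    \<comment> \<open>The failure of \<open>\<xi>\<close> to be fixed by \<open>cj\<close> is
      controlled by \<open>a - a0\<close> and \<open>d - d0\<close>, relative to the size of
      \<open>\<xi>\<close>.\<close>
    have "a0 * cj d * (\<xi> - cj \<xi>) = (a - a0) * cj d0 * cj \<xi> + a0 * cj (d0 - d) * cj \<xi>"
      using rel by (simp add: algebra_simps)
    then have "av (a0 * cj d * (\<xi> - cj \<xi>)) \<le>
        max (av ((a - a0) * cj d0 * cj \<xi>)) (av (a0 * cj (d0 - d) * cj \<xi>))"
      by (metis av_add_le)
    then have "av (\<xi> - cj \<xi>) \<le> max (av (a - a0) * av \<xi>) (av (d - d0) * av \<xi>)"
      using ad1 avd by (simp del: cj_diff add: av_diff_commute[of d0 d])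
    also have "\<dots> < r * av \<xi>"
      using small \<xi>0 by simp
    finally have "av (\<xi> - cj \<xi>) < r * av \<xi>" .
    \<comment> \<open>The difference sees only the \<open>\<pi>\<close>-component of
      \<open>\<xi>\<close>, and 2 has absolute value 1.\<close>
    moreover have "\<xi> - cj \<xi> = 2 * (v * \<pi>)"
      by (simp add: cx) (simp add: \<xi>_def uv(3))
    ultimately have vr: "av (v * \<pi>) < r * av \<xi>"
      by (metis av_mult av_two mult_1)
    have max\<xi>: "av \<xi> = max (av u) (av (v * \<pi>))"
      using av_decomp[OF uv(1,2)] by (simp only: \<xi>_def uv(3))
    have "r * av \<xi> \<le> av \<xi>" using r(3) by (intro mult_left_le_one_le) (use r in auto)
    then have av\<xi>: "av \<xi> = av u" using vr max\<xi> by linarith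
    then have u0: "u \<noteq> 0" using \<xi>0 by auto
    define x where "x = v * \<pi> / u"
    have x: "av x < r" using vr u0 av\<xi> by (simp add: x_def pos_divide_less_eq)
    have "\<xi> = u + v * \<pi>" by (simp only: \<xi>_def uv(3))
    then have bu: "b = b0 * u * (1 + x)" using u0 by (simp add: bx x_def distrib_left)
    have cjx: "cj x = - x" using uv by (simp add: x_def)
    have one_x: "av (1 - x) = 1"
      using av_add_eq[of "- x" 1] x r(3) by simp
    then have x1: "1 - x \<noteq> 0" by auto
    \<comment> \<open>Since \<open>cj x = - x\<close>, the conjugate of \<open>b\<close> carries the
      factor \<open>1 - x\<close>; dividing \<open>D\<close> by it leaves the inverse of
      \<open>1 - x\<close> in \<open>c\<close>.\<close>
    define y where "y = x / (1 - x)"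
    have y1: "1 + y = inverse (1 - x)" using x1 by (simp add: y_def field_simps)
    have cbu: "cj b = cj b0 * u * (1 - x)" using uv(1) by (simp add: bu cjx)
    have "c = D / cj b" using D' b by simp
    then have cu: "c = inverse (cj b0) * (D / u) * (1 + y)"
      unfolding y1 cbu by (simp add: divide_inverse mult_ac)
    have "\<psi> (1 - x) = 1" using r0(2)[of "1 - x"] x r(4) by simp
    then have "omega_S \<psi> \<gamma> = \<psi> (cj b0) * \<eta> u"
      using \<gamma>(1) b b0(1) u0 x1 omega_S_eq[of a b c d] uv(1)
      unfolding g cbu by (simp add: psi_mult psi_E)
    moreover have "1 - nm cj (\<gamma> $ 1 $ 1) = D" by (simp add: g D_def)
    moreover have "\<gamma> = mat2 a (b0 * u * (1 + x)) (inverse (cj b0) * (D / u) * (1 + y)) d"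
      unfolding g bu[symmetric] cu[symmetric] ..
    moreover have "av y < \<rho>" using x r(2) one_x by (simp add: y_def)
    moreover have "u \<in> E - {0}" "D \<in> E - {0}" using uv(1) u0 DE D0 by auto
    moreover have "av (a - a0) < \<rho>" "av (d - d0) < \<rho>" "av x < \<rho>" using small x r(2) by auto
    ultimately show ?thesis
      using Dr by (intro near_diagI)
  qed
  then show ?thesis using r(1) by blast
qed

text \<open>Off-diagonal entries lie in \<open>\<pi>\<close> times \<open>E\<close>, so no error
  factors occur. Taking the inverse of \<open>\<pi>\<close> as \<open>c0\<close> makes the two
  coordinates multiply to \<open>b * c\<close> exactly.\<close>

lemma lie_near_diag:
  assumes a0: "a0 \<in> (\<lambda>x. \<pi> * x) ` E" and d0: "d0 \<in> (\<lambda>x. \<pi> * x) ` E" and \<rho>: "\<rho> > 0"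
  shows "\<exists>r>0. \<forall>\<gamma>\<in>s_lie cj. rs \<gamma> \<longrightarrow> dist \<gamma> (diag2 a0 d0) < r \<longrightarrow>
    near_diag (omega_s \<psi>) (\<psi> (- \<pi>)) a0 d0 \<pi> (inverse \<pi>) (\<lambda>\<gamma>. \<gamma> $ 1 $ 2 * \<gamma> $ 2 $ 1) \<rho> \<gamma>"
proof -
  define r where "r = min \<rho> 1"
  have r: "r > 0" "r \<le> \<rho>" "r \<le> 1" using \<rho> by (auto simp: r_def)
  have "near_diag (omega_s \<psi>) (\<psi> (- \<pi>)) a0 d0 \<pi> (inverse \<pi>) (\<lambda>\<gamma>. \<gamma> $ 1 $ 2 * \<gamma> $ 2 $ 1) \<rho> \<gamma>"
    if \<gamma>: "\<gamma> \<in> s_lie cj" "rs \<gamma>" "dist \<gamma> (diag2 a0 d0) < r" for \<gamma>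
  proof -
    obtain a b c d where g: "\<gamma> = mat2 a b c d" by (rule mat2_exhaust)
    have b: "b \<noteq> 0" and c: "c \<noteq> 0" using \<gamma>(2) by (auto simp: g rs_mat2)
    have small: "av (a - a0) < r" "av b < r" "av c < r" "av (d - d0) < r"
      using dist_entry_le[of \<gamma> 1 1 "diag2 a0 d0"] dist_entry_le[of \<gamma> 1 2 "diag2 a0 d0"]
        dist_entry_le[of \<gamma> 2 1 "diag2 a0 d0"] dist_entry_le[of \<gamma> 2 2 "diag2 a0 d0"] \<gamma>(3)
      by (auto simp: g diag2_def dist_av)
    obtain \<beta> z where bc: "\<beta> \<in> E" "z \<in> E" "b = \<pi> * \<beta>" "c = \<pi> * z"
      using \<gamma>(1) by (auto simp: g s_lie_iff cj_anti)
    have \<beta>: "\<beta> \<noteq> 0" using b bc by auto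
    have "b * c = \<pi>\<^sup>2 * (\<beta> * z)" by (simp add: bc power2_eq_square mult_ac)
    moreover have "\<pi>\<^sup>2 * (\<beta> * z) \<in> E" using unif(2) bc by simp
    ultimately have DE: "b * c \<in> E" by (simp only:)
    have "av (b * c) = av b * av c" by simp
    also have "\<dots> < r * 1" using small r by (intro mult_strict_mono) auto
    finally have Dr: "av (b * c) < \<rho>" using r by simp
    have "omega_s \<psi> \<gamma> = \<psi> (- \<pi> * \<beta>)"
      by (simp add: omega_s_def g col_det_mat2 bc)
    also have "\<dots> = \<psi> (- \<pi>) * \<psi> \<beta>" using \<beta> by (intro psi_mult) auto
    finally have "omega_s \<psi> \<gamma> = \<psi> (- \<pi>) * \<eta> \<beta>" using \<beta> bc by (simp add: psi_E)
    moreover have "\<gamma> = mat2 a (\<pi> * \<beta> * (1 + 0)) (inverse \<pi> * (b * c / \<beta>) * (1 + 0)) d"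
      using \<beta> by (simp add: g bc)
    moreover have "\<gamma> $ 1 $ 2 * \<gamma> $ 2 $ 1 = b * c" by (simp add: g)
    moreover have "\<beta> \<in> E - {0}" "b * c \<in> E - {0}" using \<beta> bc(1) DE b c by auto
    moreover have "av (a - a0) < \<rho>" "av (d - d0) < \<rho>" "av (0::'a) < \<rho>" using small r(2) \<rho> by auto
    ultimately show ?thesis
      using Dr by (intro near_diagI)
  qed
  then show ?thesis using r(1) by blast
qed

section \<open>Signs and matched pairs for one hermitian space\<close>

context
  fixes hf w u \<delta>
  assumes hf: "hermitian_form cj hf" and b: "adapted_basis hf w u"
  defines "\<delta> \<equiv> hf w w"
begin

lemma delta: "\<delta> \<in> E" "\<delta> \<noteq> 0" "cj \<delta> = \<delta>"
  using form_coord(2,3)[OF hf b] by (auto simp: \<delta>_def)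

lemmas U_iff = U_group_iff[OF hf b, folded \<delta>_def]
lemmas lie_iff = u_lie_iff[OF hf b, folded \<delta>_def]

lemma U_dconj:
  assumes "g \<in> U_group hf w u" "h \<in> norm_one cj"
  shows "dconj h g \<in> U_group hf w u"
proof -
  obtain a b' c d where g: "g = mat2 a b' c d" by (rule mat2_exhaust)
  note h = norm_oneD[OF assms(2)]
  have *: "\<delta> * a * cj a - c * cj c = \<delta>" "\<delta> * a * cj b' - c * cj d = 0" "\<delta> * b' * cj b' - d * cj d = - 1"
    using assms(1) unfolding g U_iff by auto
  have "c * h * cj (c * h) = (h * cj h) * (c * cj c)" by (simp add: mult_ac)
  moreover have "\<delta> * a * cj (inverse h * b') - c * h * cj d = h * (\<delta> * a * cj b' - c * cj d)"
    using h by (simp add: algebra_simps)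
  moreover have "\<delta> * (inverse h * b') * cj (inverse h * b') = (h * cj h) * (\<delta> * b' * cj b')"
    using h by (simp add: mult_ac)
  ultimately show ?thesis
    unfolding g dconj_mat2[OF h(1)] U_iff by (simp only: * h(3) mult_1 mult_zero_right simp_thms)
qed

lemma u_lie_dconj:
  assumes "g \<in> u_lie hf w u" "h \<in> norm_one cj"
  shows "dconj h g \<in> u_lie hf w u"
proof -
  obtain a b' c d where g: "g = mat2 a b' c d" by (rule mat2_exhaust)
  note h = norm_oneD[OF assms(2)]
  show ?thesis
    using assms(1) h unfolding g dconj_mat2[OF h(1)] lie_iff by (simp add: mult_ac)
qed

lemma U_diag: "a0 \<in> norm_one cj \<Longrightarrow> d0 \<in> norm_one cj \<Longrightarrow> diag2 a0 d0 \<in> U_group hf w u"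
  unfolding diag2_def U_iff using norm_oneD(3) by (simp add: mult.assoc)

lemma u_lie_diag:
  "a0 \<in> (\<lambda>x. \<pi> * x) ` E \<Longrightarrow> d0 \<in> (\<lambda>x. \<pi> * x) ` E \<Longrightarrow> diag2 a0 d0 \<in> u_lie hf w u"
  unfolding diag2_def lie_iff by (simp add: cj_anti)

text \<open>Unitarity of the first column reads
  \<open>\<delta> * (1 - nm cj a) = - nm cj (c * t)\<close>, where \<open>c * t\<close> is the lower
  left entry of \<open>g\<close>, and \<open>\<eta>\<close> ignores norms.\<close>

lemma U_sign:
  assumes g: "g \<in> U_group hf w u" and m: "matches \<gamma> g"
  shows "\<eta> (1 - nm cj (\<gamma> $ 1 $ 1)) = \<eta> (- \<delta>)"
proof -
  obtain a b' c d where \<gamma>: "\<gamma> = mat2 a b' c d" by (rule mat2_exhaust)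
  obtain t where t: "t \<noteq> 0" "g = dconj t \<gamma>" and c: "c \<noteq> 0"
    using m by (auto simp: matches_def \<gamma> rs_mat2)
  have "\<delta> * a * cj a - c * t * cj (c * t) = \<delta>"
    using g unfolding t(2) \<gamma> dconj_mat2[OF t(1)] U_iff by blast
  then have "\<delta> * (1 - nm cj a) = - nm cj (c * t)"
    by (simp add: nm_def algebra_simps)
  then have eq: "1 - nm cj a = nm cj (c * t) / (- \<delta>)"
    using delta(2) by (simp add: field_simps)
  have "\<eta> (nm cj (c * t) / (- \<delta>)) = \<eta> (nm cj (c * t)) * \<eta> (- \<delta>)"
    using delta c t(1) by (intro eta_divide) auto
  then show ?thesis using eta_nm[of "c * t"] c t(1) by (simp add: \<gamma> eq)
qed

text \<open>The product of the off-diagonal entries is invariant under the conjugation, and on the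
  unitary Lie algebra it is \<open>\<delta>\<close> times a norm.\<close>

lemma u_lie_sign:
  assumes g: "g \<in> u_lie hf w u" and m: "matches \<gamma> g"
  shows "\<eta> (\<gamma> $ 1 $ 2 * \<gamma> $ 2 $ 1) = \<eta> \<delta>"
proof -
  obtain a b' c d where \<gamma>: "\<gamma> = mat2 a b' c d" by (rule mat2_exhaust)
  obtain t where t: "t \<noteq> 0" "g = dconj t \<gamma>" and b': "b' \<noteq> 0"
    using m by (auto simp: matches_def \<gamma> rs_mat2)
  have "c * t = \<delta> * cj (inverse t * b')"
    using g unfolding t(2) \<gamma> dconj_mat2[OF t(1)] lie_iff by blast
  then have "(inverse t * b') * (c * t) = \<delta> * nm cj (inverse t * b')"
    by (simp add: nm_def mult_ac)
  then have "b' * c = \<delta> * nm cj (inverse t * b')"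
    using t(1) by (simp add: field_simps)
  then show ?thesis
    using delta b' t(1) eta_mult[of \<delta> "nm cj (inverse t * b')"] eta_nm[of "inverse t * b'"] by (simp add: \<gamma>)
qed

text \<open>The element of the unitary group is the Cayley transform of the off-diagonal element of its
  Lie algebra with entries \<open>\<beta>\<close> and \<open>\<delta> * cj \<beta>\<close>, multiplied by \<open>diag2 a0 d0\<close>; thus no square roots
  are needed.\<close>

lemma U_test:
  assumes a0: "a0 \<in> norm_one cj" and d0: "d0 \<in> norm_one cj"
    and b0: "b0 \<noteq> 0" "a0 * cj b0 + b0 * cj d0 = 0" and \<rho>: "\<rho> > 0" and r: "r > 0"
  shows "\<exists>\<gamma>\<in>S_space cj. \<exists>g\<in>U_group hf w u. matches \<gamma> g \<and>
    near_diag (omega_S \<psi>) (\<psi> (cj b0)) a0 d0 b0 (inverse (cj b0)) (\<lambda>\<gamma>. 1 - nm cj (\<gamma> $ 1 $ 1)) \<rho> \<gamma> \<and>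
    dist g (diag2 a0 d0) < r"
proof -
  define \<tau> where "\<tau> = min (min \<rho> (r / 4)) 1"
  have \<tau>: "\<tau> > 0" "\<tau> \<le> \<rho>" "\<tau> \<le> r / 4" "\<tau> \<le> 1" using \<rho> r by (auto simp: \<tau>_def)
  obtain \<beta> :: 'a where \<beta>: "\<beta> \<noteq> 0" and s: "av \<beta> < \<tau>" "av \<delta> * av \<beta> < \<tau>"
    using small_multiple[OF \<tau>(1)] by blast
  define m where "m = \<delta> * nm cj \<beta>"
  have mE: "m \<in> E" and m0: "m \<noteq> 0" using delta \<beta> by (auto simp: m_def)
  have "av m = av \<delta> * av \<beta> * av \<beta>" by (simp add: m_def power2_eq_square)
  also have "\<dots> \<le> av \<delta> * av \<beta> * 1" using s \<tau>(4) by (intro mult_left_mono) auto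
  finally have m: "av m < \<tau>" using s by simp
  have m1: "av (1 - m) = 1" using av_add_eq[of "- m" 1] m \<tau>(4) by simp
  then have m2: "1 - m \<noteq> 0" by auto
  have cm: "cj m = m" using mE by simp
  have c2: "cj 2 = 2" using cj_add[of 1 1] by (simp del: cj_add)
  have mm: "\<delta> * (\<beta> * cj \<beta>) = m" by (simp add: m_def nm_def)
  \<comment> \<open>This is the diagonal part of \<open>(1 + Z) / (1 - Z)\<close>, where
    \<open>Z\<close> has off-diagonal entries \<open>\<beta>\<close> and
    \<open>\<delta> * cj \<beta>\<close> and square \<open>m\<close>.\<close>
  define q where "q = (1 + m) / (1 - m)"
  have qE: "q \<in> E" using mE by (simp add: q_def)
  have cq: "cj q = q" using qE by simp
  have q1: "q - 1 = 2 * m / (1 - m)" using m2 by (simp add: q_def field_simps)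
  have qq: "1 - q * q = - (4 * m / (1 - m)\<^sup>2)"
  proof -
    have "1 - q * q = ((1 - m)\<^sup>2 - (1 + m)\<^sup>2) / (1 - m)\<^sup>2"
      using m2 by (simp add: q_def diff_divide_distrib power2_eq_square)
    also have "(1 - m)\<^sup>2 - (1 + m)\<^sup>2 = - (4 * m)"
      by (simp add: power2_eq_square algebra_simps)
    finally show ?thesis by simp
  qed
  define a where "a = a0 * q"
  define d where "d = d0 * q"
  define D where "D = - (4 * m / (1 - m)\<^sup>2)"
  note A = norm_oneD[OF a0] and Dd = norm_oneD[OF d0]
  have aa: "a * cj a = q * q" "d * cj d = q * q"
    using A(3) Dd(3) by (simp_all add: a_def d_def cq mult_ac)
  have aD: "q * q = 1 - D" using qq by (simp add: D_def algebra_simps)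
  have Dnm: "1 - nm cj a = D" by (simp add: nm_def aa aD)
  have DE: "D \<in> E" and D0: "D \<noteq> 0"
    using E_closed(3)[OF E_closed(2) nm_E, of a] m0 m2 by (simp_all only: Dnm) (simp add: D_def)
  have avD: "av D < \<rho>"
  proof -
    have "av (4::'a) = av (2 * 2 :: 'a)" by simp
    also have "\<dots> = 1" by (simp only: av_mult av_two)
    finally have "av D = av m" using m1 by (simp add: D_def)
    then show ?thesis using m \<tau>(2) by simp
  qed
  have ad: "av (a - a0) < \<tau>" "av (d - d0) < \<tau>"
  proof -
    have "a - a0 = a0 * (q - 1)" "d - d0 = d0 * (q - 1)" by (simp_all add: a_def d_def algebra_simps)
    then have "av (a - a0) = av m" "av (d - d0) = av m"
      using m1 A(2) Dd(2) by (simp_all add: q1)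
    then show "av (a - a0) < \<tau>" "av (d - d0) < \<tau>" using m by simp_all
  qed
  \<comment> \<open>With \<open>b0\<close> itself as an entry this matrix may be far from diagonal,
    but its germ coordinate is 1 and its error factors are trivial. Because \<open>q\<close> lies in
    \<open>E\<close>, the equation for \<open>b0\<close> survives the passage from
    \<open>a0\<close>, \<open>d0\<close> to \<open>a\<close>, \<open>d\<close>.\<close>
  let ?\<gamma> = "mat2 a b0 (inverse (cj b0) * D) d"
  let ?g = "mat2 a (2 * \<beta> * d0 / (1 - m)) (2 * \<delta> * cj \<beta> * a0 / (1 - m)) d"
  have cb: "cj b0 \<noteq> 0" using b0 by simp
  have cD: "cj D = D" using DE by simp
  have rel: "a * cj b0 + b0 * cj d = 0"
  proof -
    have "a * cj b0 + b0 * cj d = q * (a0 * cj b0 + b0 * cj d0)"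
      by (simp add: a_def d_def cq algebra_simps)
    then show ?thesis using b0(2) by simp
  qed
  have rel': "cj a * b0 + cj b0 * d = 0" using arg_cong[OF rel, of cj] by simp
  have S: "?\<gamma> \<in> S_space cj"
    unfolding S_space_iff
  proof (intro conjI)
    show "a * cj a + b0 * cj (inverse (cj b0) * D) = 1"
      using b0(1) by (simp add: aa aD cD mult.assoc[symmetric])
    show "a * cj b0 + b0 * cj d = 0" by (rule rel)
    have "inverse (cj b0) * D * cj a + d * cj (inverse (cj b0) * D) =
      D * (cj a * b0 + cj b0 * d) * inverse (b0 * cj b0)"
      using b0(1) cb by (simp add: cD field_simps)
    then show "inverse (cj b0) * D * cj a + d * cj (inverse (cj b0) * D) = 0"
      by (simp add: rel')
    show "inverse (cj b0) * D * cj b0 + d * cj d = 1"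
      using cb by (simp add: aa aD mult.commute[of _ D] mult.assoc)
  qed
  have U: "?g \<in> U_group hf w u"
    unfolding U_iff
  proof (intro conjI)
    have "2 * \<delta> * cj \<beta> * a0 / (1 - m) * cj (2 * \<delta> * cj \<beta> * a0 / (1 - m)) =
      4 * \<delta> * (\<delta> * (\<beta> * cj \<beta>)) * (a0 * cj a0) / (1 - m)\<^sup>2"
      using delta(3) by (simp add: c2 cm power2_eq_square mult_ac)
    also have "\<dots> = \<delta> * (4 * m / (1 - m)\<^sup>2)" by (simp add: mm A(3))
    also have "\<dots> = - \<delta> * (1 - q * q)" unfolding qq by simp
    finally show "\<delta> * a * cj a - 2 * \<delta> * cj \<beta> * a0 / (1 - m) * cj (2 * \<delta> * cj \<beta> * a0 / (1 - m)) = \<delta>"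
      using aa(1) by (simp add: algebra_simps)
    show "\<delta> * a * cj (2 * \<beta> * d0 / (1 - m)) - 2 * \<delta> * cj \<beta> * a0 / (1 - m) * cj d = 0"
      by (simp add: c2 cm cq a_def d_def mult_ac)
    have "\<delta> * (2 * \<beta> * d0 / (1 - m)) * cj (2 * \<beta> * d0 / (1 - m)) =
      4 * (\<delta> * (\<beta> * cj \<beta>)) * (d0 * cj d0) / (1 - m)\<^sup>2"
      by (simp add: c2 cm power2_eq_square mult_ac)
    also have "\<dots> = 4 * m / (1 - m)\<^sup>2" by (simp add: mm Dd(3))
    also have "\<dots> = - (1 - q * q)" unfolding qq by simp
    finally show "\<delta> * (2 * \<beta> * d0 / (1 - m)) * cj (2 * \<beta> * d0 / (1 - m)) - d * cj d = - 1"
      by (simp add: aa)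
  qed
  have rsg: "rs ?\<gamma>" "rs ?g"
    using b0(1) D0 \<beta> A(1) Dd(1) m2 delta(2) by (auto simp: rs_mat2)
  \<comment> \<open>Forced by the upper right entries; the lower left ones then agree because
    \<open>b0 = - (a0 * d0 * cj b0)\<close>.\<close>
  define t where "t = b0 * (1 - m) / (2 * \<beta> * d0)"
  have t0: "t \<noteq> 0" using b0(1) m2 \<beta> Dd(1) by (simp add: t_def)
  have "?g = dconj t ?\<gamma>"
  proof -
    have t1: "inverse t * b0 = 2 * \<beta> * d0 / (1 - m)"
      using b0(1) by (simp add: t_def)
    have bb: "b0 = - (a0 * d0 * cj b0)"
    proof -
      have "b0 * (cj d0 * d0) + a0 * d0 * cj b0 = d0 * (a0 * cj b0 + b0 * cj d0)"
        by (simp add: algebra_simps)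
      then have "b0 + a0 * d0 * cj b0 = 0" using b0(2) Dd(3) by (simp add: mult.commute)
      then show ?thesis by (simp add: eq_neg_iff_add_eq_0)
    qed
    have t2: "t = - (a0 * cj b0 * (1 - m)) / (2 * \<beta>)"
    proof -
      have "t = (d0 * - (a0 * cj b0 * (1 - m))) / (d0 * (2 * \<beta>))"
        unfolding t_def by (subst bb) (simp add: mult_ac)
      then show ?thesis
        unfolding nonzero_mult_divide_mult_cancel_left[OF Dd(1)] .
    qed
    have cancel: "inverse c * - (4 * (x * (y * z)) / n\<^sup>2) * (- (e * c * n) / (2 * y)) = 2 * x * z * e / n"
      if "c \<noteq> 0" "n \<noteq> 0" "y \<noteq> 0" for c n x y z e :: 'a
      using that by (simp add: field_simps power2_eq_square)
    have "inverse (cj b0) * D * t = inverse (cj b0) * - (4 * (\<delta> * (\<beta> * cj \<beta>)) / (1 - m)\<^sup>2) * (- (a0 * cj b0 * (1 - m)) / (2 * \<beta>))"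
      by (simp only: t2 D_def mm)
    also have "\<dots> = 2 * \<delta> * cj \<beta> * a0 / (1 - m)"
      by (rule cancel[OF cb m2 \<beta>])
    finally show ?thesis
      unfolding dconj_mat2[OF t0] using t1 by simp
  qed
  then have mt: "matches ?\<gamma> ?g" using rsg t0 unfolding matches_def by blast
  have "dist ?g (diag2 a0 d0) < 4 * (r / 4)"
    unfolding diag2_def
  proof (rule dist_mat2_less)
    have "av (2 * \<beta> * d0 / (1 - m)) = av \<beta>" "av (2 * \<delta> * cj \<beta> * a0 / (1 - m)) = av \<delta> * av \<beta>"
      using m1 A(2) Dd(2) by simp_all
    then show "dist (2 * \<beta> * d0 / (1 - m)) 0 < r / 4" "dist (2 * \<delta> * cj \<beta> * a0 / (1 - m)) 0 < r / 4"
      using s \<tau>(3) by (simp_all only: dist_av diff_zero)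
  qed (use ad \<tau>(3) in \<open>simp_all add: dist_av\<close>)
  moreover have "near_diag (omega_S \<psi>) (\<psi> (cj b0)) a0 d0 b0 (inverse (cj b0)) (\<lambda>\<gamma>. 1 - nm cj (\<gamma> $ 1 $ 1)) \<rho> ?\<gamma>"
    by (rule near_diagI[where \<beta> = 1 and \<delta> = D and a = a and d = d and x = 0 and y = 0])
      (use DE D0 avD ad \<tau>(2) \<rho> omega_S_eq[OF S b0(1)] Dnm in simp_all)
  ultimately show ?thesis
    using S U mt by (intro bexI[of _ ?\<gamma>] bexI[of _ ?g]) auto
qed

text \<open>The conditions are linear, so \<open>?g\<close> can keep the diagonal \<open>a0\<close>,
  \<open>d0\<close>; \<open>?\<gamma>\<close> is its rescaling with upper right entry
  \<open>\<pi>\<close> and the same off-diagonal product \<open>m\<close>.\<close>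

lemma u_lie_test:
  assumes a0: "a0 \<in> (\<lambda>x. \<pi> * x) ` E" and d0: "d0 \<in> (\<lambda>x. \<pi> * x) ` E"
    and \<rho>: "\<rho> > 0" and r: "r > 0"
  shows "\<exists>\<gamma>\<in>s_lie cj. \<exists>g\<in>u_lie hf w u. matches \<gamma> g \<and>
    near_diag (omega_s \<psi>) (\<psi> (- \<pi>)) a0 d0 \<pi> (inverse \<pi>) (\<lambda>\<gamma>. \<gamma> $ 1 $ 2 * \<gamma> $ 2 $ 1) \<rho> \<gamma> \<and>
    dist g (diag2 a0 d0) < r"
proof -
  define \<tau> where "\<tau> = min (min \<rho> (r / 4)) 1"
  have \<tau>: "\<tau> > 0" "\<tau> \<le> \<rho>" "\<tau> \<le> r / 4" "\<tau> \<le> 1" using \<rho> r by (auto simp: \<tau>_def)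
  obtain \<beta> :: 'a where \<beta>: "\<beta> \<noteq> 0" and s: "av \<beta> < \<tau>" "av \<delta> * av \<beta> < \<tau>"
    using small_multiple[OF \<tau>(1)] by blast
  define m where "m = \<delta> * nm cj \<beta>"
  have mE: "m \<in> E" and m0: "m \<noteq> 0" using delta \<beta> by (auto simp: m_def)
  have "av m = av \<delta> * av \<beta> * av \<beta>" by (simp add: m_def power2_eq_square)
  also have "\<dots> \<le> av \<delta> * av \<beta> * 1" using s \<tau>(4) by (intro mult_left_mono) auto
  finally have m: "av m < \<rho>" using s \<tau>(2) by simp
  let ?\<gamma> = "mat2 a0 \<pi> (inverse \<pi> * m) d0"
  let ?g = "mat2 a0 \<beta> (\<delta> * cj \<beta>) d0"
  have ad: "a0 + cj a0 = 0" "d0 + cj d0 = 0" using a0 d0 by (simp_all add: cj_anti)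
  have L: "?\<gamma> \<in> s_lie cj" using ad mE by (simp add: s_lie_iff inverse_minus_eq)
  have U: "?g \<in> u_lie hf w u" using ad by (simp add: lie_iff)
  have "?g = dconj (\<pi> / \<beta>) ?\<gamma>"
    using \<beta> by (subst dconj_mat2) (simp_all add: m_def nm_def)
  moreover have "rs ?\<gamma>" "rs ?g" using m0 \<beta> delta(2) by (auto simp: rs_mat2)
  ultimately have mt: "matches ?\<gamma> ?g"
    using \<beta> unfolding matches_def by (metis divide_eq_0_iff pi_nonzero)
  have "dist ?g (diag2 a0 d0) < 4 * (r / 4)"
    unfolding diag2_def by (rule dist_mat2_less) (use s \<tau>(3) r in \<open>simp_all add: dist_av\<close>)
  moreover have "near_diag (omega_s \<psi>) (\<psi> (- \<pi>)) a0 d0 \<pi> (inverse \<pi>) (\<lambda>\<gamma>. \<gamma> $ 1 $ 2 * \<gamma> $ 2 $ 1) \<rho> ?\<gamma>"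
  proof -
    show ?thesis
      by (rule near_diagI[where \<beta> = 1 and \<delta> = m and a = a0 and d = d0 and x = 0 and y = 0])
        (use mE m0 m \<rho> in \<open>simp_all add: omega_s_def col_det_mat2\<close>)
  qed
  ultimately show ?thesis
    using L U mt by (intro bexI[of _ ?\<gamma>] bexI[of _ ?g]) auto
qed

end

text \<open>Hilbert 90 for \<open>- (a0 * d0)\<close> yields \<open>b0\<close>: the condition on
  \<open>b0 / cj b0\<close> says precisely that the upper triangular matrices with diagonal
  \<open>a0\<close>, \<open>d0\<close> and entry in \<open>b0 * E\<close> lie in the symmetric
  space.\<close>

lemma expansion_group:
  fixes hf :: "nat \<Rightarrow> 'a^2 \<Rightarrow> 'a^2 \<Rightarrow> 'a" and w u :: "nat \<Rightarrow> 'a^2"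
    and f :: "nat \<Rightarrow> 'a^2^2 \<Rightarrow> complex"
  defines "Y \<equiv> \<lambda>j. U_group (hf j) (w j) (u j)"
  assumes hf: "\<And>j. j \<in> {0, 1} \<Longrightarrow> hermitian_form cj (hf j)"
    and ab: "\<And>j. j \<in> {0, 1} \<Longrightarrow> adapted_basis (hf j) (w j) (u j)"
    and opp: "\<eta> (hf (1 - i) (w (1 - i)) (w (1 - i))) = - \<eta> (hf i (w i) (w i))"
    and \<nu>: "space \<nu> = norm_one cj"
    and f': "Cc_smooth (S_space cj) f'" and f: "\<And>j. j \<in> {0, 1} \<Longrightarrow> Cc_smooth (Y j) (f j)"
    and tr: "transfers E cj \<mu> \<nu> (omega_S \<psi>) (S_space cj) Y f' f"
    and a0: "a0 \<in> norm_one cj" and d0: "d0 \<in> norm_one cj"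
    and i: "i \<in> {0, 1}" and vanish: "\<And>g. g \<in> Y i \<Longrightarrow> f i g = 0"
  shows "\<exists>U C. openin (top_of_set (S_space cj)) U \<and> diag2 a0 d0 \<in> U \<and>
      (\<forall>\<gamma>\<in>U \<inter> matched (S_space cj) (Y i). omega_S \<psi> \<gamma> * dOrb E cj \<mu> \<gamma> f' =
         1 / 2 * Orb_u \<nu> (diag2 a0 d0) (f (1 - i)) *
           complex_of_real (ln (nab (1 - nm cj (\<gamma> $ 1 $ 1)))) + C)"
proof -
  note A = norm_oneD[OF a0] and D = norm_oneD[OF d0]
  have "- (a0 * d0) * cj (- (a0 * d0)) = (a0 * cj a0) * (d0 * cj d0)"
    by (simp add: mult_ac)
  then have "- (a0 * d0) \<in> norm_one cj"
    unfolding norm_one_def nm_def mem_Collect_eq by (simp only: A(3) D(3) mult_1)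
  then obtain b0 where b0: "b0 \<noteq> 0" "b0 / cj b0 = - (a0 * d0)"
    using hilbert90 by blast
  then have bb: "b0 = - (a0 * d0) * cj b0" by (simp add: nonzero_divide_eq_eq)
  have rel: "a0 * cj b0 + b0 * cj d0 = 0"
  proof -
    have "b0 * cj d0 = - (a0 * d0) * cj b0 * cj d0" by (simp only: bb[symmetric])
    also have "\<dots> = - (a0 * cj b0) * (d0 * cj d0)" by (simp add: mult_ac)
    finally show ?thesis by (simp add: D(3))
  qed
  have rel2: "cj a0 * b0 + cj b0 * d0 = 0" using arg_cong[OF rel, of cj] by simp
  \<comment> \<open>Passing from \<open>\<delta>\<close> to \<open>- \<delta>\<close> multiplies
    both signs by the same factor, so they stay opposite.\<close>
  have sgn: "\<eta> (- hf j (w j) (w j)) = \<eta> (- 1) * \<eta> (hf j (w j) (w j))" if "j \<in> {0, 1}" for j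
    using eta_mult[of "- 1" "hf j (w j) (w j)"] form_coord(2,3)[OF hf[OF that] ab[OF that]] by simp
  show ?thesis
  proof (rule germ_expansion[where \<Delta> = "\<lambda>\<gamma>. 1 - nm cj (\<gamma> $ 1 $ 1)" and Y = Y and \<nu> = \<nu> and i = i,
        OF f' f tr \<nu> b0(1) _ _ _ _ S_dconj _ _ S_near_diag[OF a0 d0 b0(1) rel] _ _ i _ vanish])
    show "inverse (cj b0) \<noteq> 0" "\<psi> (cj b0) \<noteq> 0"
      using b0(1) psi_nonzero by auto
    show "mat2 a0 (b0 * x) 0 d0 \<in> S_space cj" if "x \<in> E" for x
    proof -
      have "a0 * cj (b0 * x) + b0 * x * cj d0 = x * (a0 * cj b0 + b0 * cj d0)"
        using that by (simp add: algebra_simps)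
      then show ?thesis using rel A(3) D(3) by (simp add: S_space_iff)
    qed
    show "mat2 a0 0 (inverse (cj b0) * z) d0 \<in> S_space cj" if "z \<in> E" for z
    proof -
      have "inverse (cj b0) * z * cj a0 + d0 * cj (inverse (cj b0) * z) =
          z * (cj a0 * b0 + cj b0 * d0) * inverse (b0 * cj b0)"
        using that b0(1) by (simp add: field_simps)
      then show ?thesis using rel2 A(3) D(3) by (simp add: S_space_iff)
    qed
    show "dconj h g \<in> Y j" if "j \<in> {0, 1}" "g \<in> Y j" "h \<in> norm_one cj" for j g h
      using U_dconj[OF hf[OF that(1)] ab[OF that(1)]] that(2,3) unfolding Y_def by blast
    show "diag2 a0 d0 \<in> Y j" if "j \<in> {0, 1}" for j
      unfolding Y_def by (rule U_diag[OF hf[OF that] ab[OF that] a0 d0])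
    show "\<eta> (1 - nm cj (\<gamma> $ 1 $ 1)) = \<eta> (- hf j (w j) (w j))"
      if "j \<in> {0, 1}" "\<gamma> \<in> S_space cj" "g \<in> Y j" "matches \<gamma> g" for j \<gamma> g
      using that(3,4) unfolding Y_def by (rule U_sign[OF hf[OF that(1)] ab[OF that(1)]])
    show "\<exists>\<gamma>\<in>S_space cj. \<exists>g\<in>Y j. matches \<gamma> g \<and>
        near_diag (omega_S \<psi>) (\<psi> (cj b0)) a0 d0 b0 (inverse (cj b0)) (\<lambda>\<gamma>. 1 - nm cj (\<gamma> $ 1 $ 1)) \<rho> \<gamma> \<and>
        dist g (diag2 a0 d0) < r" if "j \<in> {0, 1}" "\<rho> > 0" "r > 0" for j \<rho> r
      unfolding Y_def by (rule U_test[OF hf[OF that(1)] ab[OF that(1)] a0 d0 b0(1) rel that(2,3)])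
    have "1 - i \<in> {0, 1}" using i by auto
    then show "\<eta> (- hf (1 - i) (w (1 - i)) (w (1 - i))) = - \<eta> (- hf i (w i) (w i))"
      using sgn[of "1 - i"] sgn[OF i] opp by simp
  qed
qed

text \<open>Here \<open>b0 = \<pi>\<close> works for every diagonal, since the trace-zero elements
  form the fixed line spanned by \<open>\<pi>\<close> over \<open>E\<close>.\<close>

lemma expansion_lie:
  fixes hf :: "nat \<Rightarrow> 'a^2 \<Rightarrow> 'a^2 \<Rightarrow> 'a" and w u :: "nat \<Rightarrow> 'a^2"
    and f :: "nat \<Rightarrow> 'a^2^2 \<Rightarrow> complex"
  defines "Y \<equiv> \<lambda>j. u_lie (hf j) (w j) (u j)"
  assumes hf: "\<And>j. j \<in> {0, 1} \<Longrightarrow> hermitian_form cj (hf j)"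
    and ab: "\<And>j. j \<in> {0, 1} \<Longrightarrow> adapted_basis (hf j) (w j) (u j)"
    and opp: "\<eta> (hf (1 - i) (w (1 - i)) (w (1 - i))) = - \<eta> (hf i (w i) (w i))"
    and \<nu>: "space \<nu> = norm_one cj"
    and f': "Cc_smooth (s_lie cj) f'" and f: "\<And>j. j \<in> {0, 1} \<Longrightarrow> Cc_smooth (Y j) (f j)"
    and tr: "transfers E cj \<mu> \<nu> (omega_s \<psi>) (s_lie cj) Y f' f"
    and a0: "a0 \<in> (\<lambda>x. \<pi> * x) ` E" and d0: "d0 \<in> (\<lambda>x. \<pi> * x) ` E"
    and i: "i \<in> {0, 1}" and vanish: "\<And>g. g \<in> Y i \<Longrightarrow> f i g = 0"
  shows "\<exists>U C. openin (top_of_set (s_lie cj)) U \<and> diag2 a0 d0 \<in> U \<and>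
      (\<forall>y\<in>U \<inter> matched (s_lie cj) (Y i). omega_s \<psi> y * dOrb E cj \<mu> y f' =
         1 / 2 * Orb_u \<nu> (diag2 a0 d0) (f (1 - i)) *
           complex_of_real (ln (nab (y $ 1 $ 2 * y $ 2 $ 1))) + C)"
proof (rule germ_expansion[where \<Delta> = "\<lambda>\<gamma>. \<gamma> $ 1 $ 2 * \<gamma> $ 2 $ 1" and Y = Y and \<nu> = \<nu> and i = i,
      OF f' f tr \<nu> pi_nonzero _ _ _ _ s_lie_dconj _ _ lie_near_diag[OF a0 d0] _ _ i opp vanish])
  have ad: "a0 + cj a0 = 0" "d0 + cj d0 = 0" using a0 d0 by (simp_all add: cj_anti)
  show "inverse \<pi> \<noteq> 0" "\<psi> (- \<pi>) \<noteq> 0"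
    using psi_nonzero by auto
  show "mat2 a0 (\<pi> * x) 0 d0 \<in> s_lie cj" "mat2 a0 0 (inverse \<pi> * x) d0 \<in> s_lie cj" if "x \<in> E" for x
    using that ad by (simp_all add: s_lie_iff)
  show "dconj h g \<in> Y j" if "j \<in> {0, 1}" "g \<in> Y j" "h \<in> norm_one cj" for j g h
    using u_lie_dconj[OF hf[OF that(1)] ab[OF that(1)]] that(2,3) unfolding Y_def by blast
  show "diag2 a0 d0 \<in> Y j" if "j \<in> {0, 1}" for j
    unfolding Y_def by (rule u_lie_diag[OF hf[OF that] ab[OF that] a0 d0])
  show "\<eta> (\<gamma> $ 1 $ 2 * \<gamma> $ 2 $ 1) = \<eta> (hf j (w j) (w j))"
    if "j \<in> {0, 1}" "\<gamma> \<in> s_lie cj" "g \<in> Y j" "matches \<gamma> g" for j \<gamma> g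
    using that(3,4) unfolding Y_def by (rule u_lie_sign[OF hf[OF that(1)] ab[OF that(1)]])
  show "\<exists>\<gamma>\<in>s_lie cj. \<exists>g\<in>Y j. matches \<gamma> g \<and>
      near_diag (omega_s \<psi>) (\<psi> (- \<pi>)) a0 d0 \<pi> (inverse \<pi>) (\<lambda>\<gamma>. \<gamma> $ 1 $ 2 * \<gamma> $ 2 $ 1) \<rho> \<gamma> \<and>
      dist g (diag2 a0 d0) < r" if "j \<in> {0, 1}" "\<rho> > 0" "r > 0" for j \<rho> r
    unfolding Y_def by (rule u_lie_test[OF hf[OF that(1)] ab[OF that(1)] a0 d0 that(2,3)])
qed

end

theorem theorem15p1:
  fixes p :: nat
    and F0 :: "'a::{field_char_0,metric_space} set"
    and cj :: "'a \<Rightarrow> 'a" and \<pi> :: 'a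
    and \<eta>t :: "'a \<Rightarrow> complex"
    and \<mu> \<nu> :: "'a measure"
    and hf :: "nat \<Rightarrow> 'a^2 \<Rightarrow> 'a^2 \<Rightarrow> 'a"
    and w u :: "nat \<Rightarrow> 'a^2"
  assumes p: "prime p" "odd p"
    and F0: "finite_ext_Qp p F0"
    and F: "padic_metric p (UNIV :: 'a set)" "ramified_quadratic F0 cj"
    and unif: "is_uniformizer UNIV \<pi>" "\<pi>\<^sup>2 \<in> F0"
    and eta: "extends_quad_char F0 cj \<eta>t"
    and mu: "haar_on (F0 - {0}) \<mu>" "emeasure \<mu> {x \<in> F0. av x = 1} = 1"
    and nu: "haar_on (norm_one cj) \<nu>" "emeasure \<nu> (norm_one cj) = 1"
    and W: "\<forall>i\<in>{0, 1}. hermitian_form cj (hf i) \<and> adapted_basis (hf i) (w i) (u i)"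
    and split: "split_form (hf 0)" "\<not> split_form (hf 1)"
  shows
    "(\<forall>f' f i a\<^sub>0 d\<^sub>0.
        Cc_smooth (S_space cj) f' \<and>
        (\<forall>j\<in>{0, 1}. Cc_smooth (U_group (hf j) (w j) (u j)) (f j)) \<and>
        transfers F0 cj \<mu> \<nu> (omega_S \<eta>t) (S_space cj)
          (\<lambda>j. U_group (hf j) (w j) (u j)) f' f \<and>
        a\<^sub>0 \<in> norm_one cj \<and> d\<^sub>0 \<in> norm_one cj \<and>
        i \<in> {0, 1} \<and> (\<forall>g\<in>U_group (hf i) (w i) (u i). f i g = 0) \<longrightarrow>
        (\<exists>U C. openin (top_of_set (S_space cj)) U \<and> diag2 a\<^sub>0 d\<^sub>0 \<in> U \<and>
          (\<forall>\<gamma>\<in>U \<inter> matched (S_space cj) (U_group (hf i) (w i) (u i)).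
             omega_S \<eta>t \<gamma> * dOrb F0 cj \<mu> \<gamma> f' =
               1 / 2 * Orb_u \<nu> (diag2 a\<^sub>0 d\<^sub>0) (f (1 - i)) *
                 complex_of_real (ln (nabs F0 (1 - nm cj (\<gamma> $ 1 $ 1)))) + C))) \<and>
     (\<forall>\<phi>' \<phi> i a\<^sub>0 d\<^sub>0.
        Cc_smooth (s_lie cj) \<phi>' \<and>
        (\<forall>j\<in>{0, 1}. Cc_smooth (u_lie (hf j) (w j) (u j)) (\<phi> j)) \<and>
        transfers F0 cj \<mu> \<nu> (omega_s \<eta>t) (s_lie cj)
          (\<lambda>j. u_lie (hf j) (w j) (u j)) \<phi>' \<phi> \<and>
        a\<^sub>0 \<in> (\<lambda>x. \<pi> * x) ` F0 \<and> d\<^sub>0 \<in> (\<lambda>x. \<pi> * x) ` F0 \<and>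
        i \<in> {0, 1} \<and> (\<forall>g\<in>u_lie (hf i) (w i) (u i). \<phi> i g = 0) \<longrightarrow>
        (\<exists>U C. openin (top_of_set (s_lie cj)) U \<and> diag2 a\<^sub>0 d\<^sub>0 \<in> U \<and>
          (\<forall>y\<in>U \<inter> matched (s_lie cj) (u_lie (hf i) (w i) (u i)).
             omega_s \<eta>t y * dOrb F0 cj \<mu> y \<phi>' =
               1 / 2 * Orb_u \<nu> (diag2 a\<^sub>0 d\<^sub>0) (\<phi> (1 - i)) *
                 complex_of_real (ln (nabs F0 (y $ 1 $ 2 * y $ 2 $ 1))) + C)))"
proof -
  interpret orbital_setting p F0 cj \<pi> \<eta>t \<mu>
    by unfold_locales (fact p F0 F unif eta mu)+
  have hf: "hermitian_form cj (hf j)" and ab: "adapted_basis (hf j) (w j) (u j)" if "j \<in> {0, 1}" for j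
    using W that by blast+
  have "sets \<nu> = sets (restrict_space borel (norm_one cj))"
    using nu by (simp add: haar_on_def)
  from sets_eq_imp_space_eq[OF this] have \<nu>: "space \<nu> = norm_one cj"
    by (simp add: space_restrict_space)
  \<comment> \<open>A space is split exactly when \<open>hf w w\<close> is a norm, so the two spaces
    carry opposite signs.\<close>
  have "\<eta> (hf 0 (w 0) (w 0)) = 1" "\<eta> (hf 1 (w 1) (w 1)) = - 1"
    using split split_form_iff[OF hf ab, of 0] split_form_iff[OF hf ab, of 1]
    by (auto simp: quad_char_def)
  then have opp: "\<eta> (hf (1 - i) (w (1 - i)) (w (1 - i))) = - \<eta> (hf i (w i) (w i))"
    if "i \<in> {0, 1}" for i
    using that by auto
  show ?thesis
    apply (intro conjI allI impI; elim conjE)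
    subgoal for f' f i a0 d0
      by (rule expansion_group[where hf = hf and w = w and u = u, OF hf ab opp \<nu>]) auto
    subgoal for f' f i a0 d0
      by (rule expansion_lie[where hf = hf and w = w and u = u, OF hf ab opp \<nu>]) auto
    done
qed

end
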